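(* Let $f:\Sigma\to M$ be an oriented CMC-$H$ immersion with legendrian lift $N:\Sigma\to\mathcal{C}$ equal to the unit normal of $f$, let $S$ be a Killing field on $M$ and let $F$ be a potential vector of $S$ (i.e. $\operatorname{curl}_M F=S$). Let $\mu_S$ be the Noether form of $S$, i.e. the class of $S\lrcorner\Lambda_0-2HF^\flat$ in $H^1(\mathcal{C})/\mathcal{E}$. Then the pullback $N^*\mu_S$ is well defined in $H^1(\Sigma)$ and $$N^*\mu_S=N^*\mu_S^0-2HN^*\mu_S'\quad\text{with}\quad N^*\mu_S^0=\langle S,*df\rangle\quad\text{and}\quad N^*\mu_S'=\langle F,df\rangle .$$
   Context: The study is local: $(M,\langle\cdot,\cdot\rangle)$ is an oriented 3-dimensional riemannian manifold, replaced by a contractible local chart domain; $\mathrm{vol}_M$ is its volume form and $H\in\mathbb{R}$ is a fixed constant (possibly zero, the minimal case). $\mathcal{C}=UM$ is the unit tangent bundle, with points $(x,e_0)$ and projection $\pi(x,e_0)=x$. Let $FM$ be the bundle of oriented orthonormal frames $(x,e)$, $e=(e_0,e_1,e_2)$, projecting to $\mathcal{C}$ by $(x,e)\mapsto(x,e_0)$. Forms are denoted as their pullbacks. On $FM$, $(\theta^0,\theta^1,\theta^2)$ are the tautological 1-forms dual to $(e_0,e_1,e_2)$, and $\omega^i_j=-\omega^j_i$ are the 1-forms with $d\theta^0=-\omega^0_1\wedge\theta^1+\omega^2_0\wedge\theta^2$, $d\theta^1=\omega^0_1\wedge\theta^0-\omega^1_2\wedge\theta^2$, $d\theta^2=-\omega^2_0\wedge\theta^0+\omega^1_2\wedge\theta^1$.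 The form $\theta^0$ descends to the contact form on $\mathcal{C}$, $\theta^0_{(x,e_0)}(u,\xi)=\langle e_0,u\rangle_x$. On $\mathcal{C}$ put $\Lambda_0=e_0\lrcorner\mathrm{vol}_M$ (which is $\theta^1\wedge\theta^2$ on $FM$) and $\Psi=\Psi_0+2H\Lambda_0$ with $\Psi_0=-\omega^2_0\wedge\theta^1-\omega^0_1\wedge\theta^2$ (basic forms, i.e. defined on $\mathcal{C}$). Let $\mathcal{E}\subset\Omega^*(\mathcal{C})$ be the differential ideal generated by $\{\theta^0,d\theta^0,\Psi\}$. $H^1(\mathcal{C})/\mathcal{E}$ denotes 1-forms on $\mathcal{C}$ modulo exact 1-forms and modulo $\mathcal{E}\cap\Omega^1(\mathcal{C})$; $H^1(\Sigma)$ is the first de Rham cohomology of $\Sigma$. The extension to $\mathcal{C}$ of a Killing field $S$ with flow $\varphi_t$ is the generator of $(x,e_0)\mapsto(\varphi_t(x),d\varphi_t\cdot e_0)$, also denoted $S$. $F^\flat=\langle F,\cdot\rangle$ is considered on $\mathcal{C}$ by pullback through $\pi$, and $\operatorname{curl}_M F=( *dF^\flat)^\sharp$, i.e. $dF^\flat=(\operatorname{curl}_MF)\lrcorner\mathrm{vol}_M$. A legendrian lift of an immersion $f:\Sigma\to M$ of a surface is a map $N:\Sigma\to\mathcal{C}$ with $\pi\circ N=f$ and $N^*\theta^0=0$, i.e. a unit normal field; $\Sigma$ is oriented so that for a positively oriented orthonormal tangent frame $(e_1,e_2)$ the frame $(N,e_1,e_2)$ is positively oriented in $M$. The immersion is CMC-$H$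 if $N^*\Psi=0$, i.e. if the shape operator $-\nabla N$ has trace $2H$. With $(\theta^1,\theta^2)$ the coframe on $\Sigma$ dual to $(e_1,e_2)$, one has $df=e_1\theta^1+e_2\theta^2$ and $*df=-e_2\theta^1+e_1\theta^2$. The components $\mu_S^0$ and $\mu_S'$ are called the minimal part and the CMC part of the Noether form. *)

theory Defs
  imports "HOL-Analysis.Analysis"
begin

section \<open>Smooth maps and differential forms on open subsets of Euclidean spaces\<close>

text \<open>Only meant for open sets, on which it is the usual notion of class \<open>C\<^sup>k\<close>.\<close>

primrec Ck_on :: "nat \<Rightarrow> 'a::euclidean_space set \<Rightarrow> ('a \<Rightarrow> 'b::euclidean_space) \<Rightarrow> bool" where
  "Ck_on 0 W f \<longleftrightarrow> continuous_on W f"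
| "Ck_on (Suc k) W f \<longleftrightarrow>
     (\<forall>x\<in>W. f differentiable (at x)) \<and> (\<forall>v. Ck_on k W (\<lambda>x. frechet_derivative f (at x) v))"

definition smooth_on :: "'a::euclidean_space set \<Rightarrow> ('a \<Rightarrow> 'b::euclidean_space) \<Rightarrow> bool" where
  "smooth_on W f \<longleftrightarrow> (\<forall>k. Ck_on k W f)"

text \<open>A form takes a point and the list of its vector arguments. The degree is carried separately;
  the values of a \<open>k\<close>-form on lists of length other than \<open>k\<close> are irrelevant.\<close>

type_synonym 'e form = "'e \<Rightarrow> 'e list \<Rightarrow> real"

definition alternating_form :: "nat \<Rightarrow> ('e::euclidean_space list \<Rightarrow> real) \<Rightarrow> bool" where
  "alternating_form k a \<longleftrightarrow>
     (\<forall>vs i. length vs = k \<and> i < k \<longrightarrow> linear (\<lambda>v. a (vs[i := v]))) \<and>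
     (\<forall>vs i j. length vs = k \<and> i < j \<and> j < k \<and> vs ! i = vs ! j \<longrightarrow> a vs = 0)"

definition smooth_form_on :: "'e::euclidean_space set \<Rightarrow> nat \<Rightarrow> 'e form \<Rightarrow> bool" where
  "smooth_form_on W k \<omega> \<longleftrightarrow>
     (\<forall>x\<in>W. alternating_form k (\<omega> x)) \<and>
     (\<forall>vs. length vs = k \<longrightarrow> smooth_on W (\<lambda>x. \<omega> x vs))"

definition ext_deriv :: "'e::euclidean_space form \<Rightarrow> 'e form" where
  "ext_deriv \<omega> x vs =
     (\<Sum>i<length vs. (-1) ^ i *
        frechet_derivative (\<lambda>y. \<omega> y (take i vs @ drop (Suc i) vs)) (at x) (vs ! i))"

text \<open>Normalised so that \<open>(\<alpha> \<and> \<beta>)(v, w) = \<alpha>(v) \<beta>(w) - \<alpha>(w) \<beta>(v)\<close> for 1-forms, which is the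
  normalisation matching \<^const>\<open>ext_deriv\<close>.\<close>

definition wedge :: "nat \<Rightarrow> nat \<Rightarrow> 'e form \<Rightarrow> 'e form \<Rightarrow> 'e form" where
  "wedge k l \<alpha> \<beta> x vs =
     (\<Sum>p | p permutes {..<k + l}. of_int (sign p) *
        \<alpha> x (take k (permute_list p vs)) * \<beta> x (drop k (permute_list p vs))) / (fact k * fact l)"

definition pullback :: "('d::euclidean_space \<Rightarrow> 'e::euclidean_space) \<Rightarrow> 'e form \<Rightarrow> 'd form" where
  "pullback h \<omega> x vs = \<omega> (h x) (map (frechet_derivative h (at x)) vs)"

definition interior_product :: "('e \<Rightarrow> 'e) \<Rightarrow> 'e form \<Rightarrow> 'e form" where
  "interior_product Y \<omega> x vs = \<omega> x (Y x # vs)"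


section \<open>Differential forms on embedded submanifolds\<close>

text \<open>The bundles \<open>UM\<close> and \<open>FM\<close> over a chart domain are embedded submanifolds of Euclidean spaces.
  For such a submanifold \<open>X\<close>, tangent vectors are velocities of curves in \<open>X\<close>, only the values of a
  form at points of \<open>X\<close> on tangent vectors matter, and smoothness and the exterior derivative are
  given by local smooth extensions to the ambient space (the restriction to \<open>X\<close> of the derivative
  of an extension does not depend on the extension).\<close>

definition tangent_space :: "'e::euclidean_space set \<Rightarrow> 'e \<Rightarrow> 'e set" where
  "tangent_space X p =
     {v. \<exists>\<gamma> \<delta>. \<delta> > 0 \<and> smooth_on {-\<delta><..<\<delta>} \<gamma> \<and> \<gamma> ` {-\<delta><..<\<delta>} \<subseteq> X \<and>
          \<gamma> 0 = p \<and> (\<gamma> has_vector_derivative v) (at (0::real))}"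

definition form_eq :: "'e::euclidean_space set \<Rightarrow> nat \<Rightarrow> 'e form \<Rightarrow> 'e form \<Rightarrow> bool" where
  "form_eq X k \<alpha> \<beta> \<longleftrightarrow>
     (\<forall>p\<in>X. \<forall>vs. length vs = k \<and> set vs \<subseteq> tangent_space X p \<longrightarrow> \<alpha> p vs = \<beta> p vs)"

definition smooth_form :: "'e::euclidean_space set \<Rightarrow> nat \<Rightarrow> 'e form \<Rightarrow> bool" where
  "smooth_form X k \<omega> \<longleftrightarrow>
     (\<forall>p\<in>X. \<exists>W \<omega>'. open W \<and> p \<in> W \<and> smooth_form_on W k \<omega>' \<and>
        (\<forall>q\<in>X \<inter> W. \<forall>vs. length vs = k \<and> set vs \<subseteq> tangent_space X q \<longrightarrow> \<omega> q vs = \<omega>' q vs))"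

definition has_ext_deriv :: "'e::euclidean_space set \<Rightarrow> nat \<Rightarrow> 'e form \<Rightarrow> 'e form \<Rightarrow> bool" where
  "has_ext_deriv X k \<omega> \<eta> \<longleftrightarrow>
     (\<forall>p\<in>X. \<exists>W \<omega>'. open W \<and> p \<in> W \<and> smooth_form_on W k \<omega>' \<and>
        (\<forall>q\<in>X \<inter> W. \<forall>vs. length vs = k \<and> set vs \<subseteq> tangent_space X q \<longrightarrow> \<omega> q vs = \<omega>' q vs) \<and>
        (\<forall>q\<in>X \<inter> W. \<forall>vs. length vs = Suc k \<and> set vs \<subseteq> tangent_space X q \<longrightarrow>
            \<eta> q vs = ext_deriv \<omega>' q vs))"

text \<open>The homogeneous elements of the differential ideal generated by a set of homogeneous forms
  (given with their degrees). The rule \<open>eq\<close> is needed because a form on \<open>X\<close> is represented by many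
  functions.\<close>

inductive diff_ideal :: "'e::euclidean_space set \<Rightarrow> (nat \<times> 'e form) set \<Rightarrow> nat \<Rightarrow> 'e form \<Rightarrow> bool"
  for X :: "'e set" and \<G> :: "(nat \<times> 'e form) set" where
  generator: "(k, \<omega>) \<in> \<G> \<Longrightarrow> diff_ideal X \<G> k \<omega>"
| zero: "diff_ideal X \<G> k (\<lambda>p vs. 0)"
| add: "diff_ideal X \<G> k \<alpha> \<Longrightarrow> diff_ideal X \<G> k \<beta> \<Longrightarrow> diff_ideal X \<G> k (\<lambda>p vs. \<alpha> p vs + \<beta> p vs)"
| wedge_left: "smooth_form X k \<alpha> \<Longrightarrow> diff_ideal X \<G> l \<beta> \<Longrightarrow> diff_ideal X \<G> (k + l) (wedge k l \<alpha> \<beta>)"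
| wedge_right: "diff_ideal X \<G> k \<alpha> \<Longrightarrow> smooth_form X l \<beta> \<Longrightarrow> diff_ideal X \<G> (k + l) (wedge k l \<alpha> \<beta>)"
| deriv: "diff_ideal X \<G> k \<omega> \<Longrightarrow> has_ext_deriv X k \<omega> \<eta> \<Longrightarrow> diff_ideal X \<G> (Suc k) \<eta>"
| eq: "diff_ideal X \<G> k \<alpha> \<Longrightarrow> form_eq X k \<alpha> \<beta> \<Longrightarrow> diff_ideal X \<G> k \<beta>"


section \<open>Riemannian geometry of an oriented chart domain\<close>

text \<open>The ambient manifold is a contractible open set \<open>U\<close> of \<open>\<real>\<^sup>3\<close> (an oriented chart domain, carrying
  the standard orientation) with metric \<open>\<langle>u, v\<rangle>\<^sub>x = u \<bullet> G(x) v\<close>.\<close>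

definition riemannian_metric :: "(real^3) set \<Rightarrow> (real^3 \<Rightarrow> real^3^3) \<Rightarrow> bool" where
  "riemannian_metric U G \<longleftrightarrow>
     smooth_on U G \<and>
     (\<forall>x\<in>U. transpose (G x) = G x \<and> (\<forall>v. v \<noteq> 0 \<longrightarrow> v \<bullet> (G x *v v) > 0))"

definition rinner :: "(real^3 \<Rightarrow> real^3^3) \<Rightarrow> real^3 \<Rightarrow> real^3 \<Rightarrow> real^3 \<Rightarrow> real" where
  "rinner G x u v = u \<bullet> (G x *v v)"

definition vol_form :: "(real^3 \<Rightarrow> real^3^3) \<Rightarrow> (real^3) form" where
  "vol_form G x vs = sqrt (det (G x)) * det (vector vs :: real^3^3)"

definition flat :: "(real^3 \<Rightarrow> real^3^3) \<Rightarrow> (real^3 \<Rightarrow> real^3) \<Rightarrow> (real^3) form" where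
  "flat G F x vs = rinner G x (F x) (hd vs)"

text \<open>The equation is \<open>L\<^sub>S \<langle>\<cdot>,\<cdot>\<rangle> = 0\<close> in the chart.\<close>

definition killing_field :: "(real^3) set \<Rightarrow> (real^3 \<Rightarrow> real^3^3) \<Rightarrow> (real^3 \<Rightarrow> real^3) \<Rightarrow> bool" where
  "killing_field U G S \<longleftrightarrow>
     smooth_on U S \<and>
     (\<forall>x\<in>U. \<forall>u v.
        frechet_derivative (\<lambda>y. rinner G y u v) (at x) (S x) +
        rinner G x (frechet_derivative S (at x) u) v +
        rinner G x u (frechet_derivative S (at x) v) = 0)"

text \<open>\<open>curl\<^sub>M F = S\<close>, that is \<open>dF\<^sup>\<flat> = S \<lrcorner> vol\<^sub>M\<close>.\<close>

definition potential_vector ::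
    "(real^3) set \<Rightarrow> (real^3 \<Rightarrow> real^3^3) \<Rightarrow> (real^3 \<Rightarrow> real^3) \<Rightarrow> (real^3 \<Rightarrow> real^3) \<Rightarrow> bool" where
  "potential_vector U G S F \<longleftrightarrow>
     smooth_on U F \<and>
     (\<forall>x\<in>U. \<forall>vs. length vs = 2 \<longrightarrow>
        ext_deriv (flat G F) x vs = interior_product S (vol_form G) x vs)"

definition local_flow ::
    "(real^3) set \<Rightarrow> (real^3 \<Rightarrow> real^3) \<Rightarrow> (real \<Rightarrow> real^3 \<Rightarrow> real^3) \<Rightarrow> bool" where
  "local_flow U S \<phi> \<longleftrightarrow>
     (\<exists>D. open D \<and> {0} \<times> U \<subseteq> D \<and> D \<subseteq> UNIV \<times> U \<and>
        (\<forall>x. is_interval {t. (t, x) \<in> D}) \<and>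
        smooth_on D (\<lambda>(t, x). \<phi> t x) \<and>
        (\<forall>x\<in>U. \<phi> 0 x = x) \<and>
        (\<forall>(t, x)\<in>D. \<phi> t x \<in> U \<and> ((\<lambda>s. \<phi> s x) has_vector_derivative S (\<phi> t x)) (at t)))"


section \<open>The unit tangent bundle and the frame bundle\<close>

type_synonym contact_pt = "(real^3) \<times> (real^3)"
type_synonym frame_pt = "(real^3) \<times> (real^3) \<times> (real^3) \<times> (real^3)"

definition unit_bundle :: "(real^3) set \<Rightarrow> (real^3 \<Rightarrow> real^3^3) \<Rightarrow> contact_pt set" where
  "unit_bundle U G = {(x, e0). x \<in> U \<and> rinner G x e0 e0 = 1}"

definition frame_bundle :: "(real^3) set \<Rightarrow> (real^3 \<Rightarrow> real^3^3) \<Rightarrow> frame_pt set" where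
  "frame_bundle U G = {(x, e0, e1, e2). x \<in> U \<and>
     rinner G x e0 e0 = 1 \<and> rinner G x e1 e1 = 1 \<and> rinner G x e2 e2 = 1 \<and>
     rinner G x e0 e1 = 0 \<and> rinner G x e0 e2 = 0 \<and> rinner G x e1 e2 = 0 \<and>
     vol_form G x [e0, e1, e2] > 0}"

definition frame_proj :: "frame_pt \<Rightarrow> contact_pt" where
  "frame_proj = (\<lambda>(x, e0, e1, e2). (x, e0))"

text \<open>The generator of \<open>(x, e\<^sub>0) \<mapsto> (\<phi>\<^sub>t(x), d\<phi>\<^sub>t e\<^sub>0)\<close>.\<close>

definition lifted_generator :: "(real \<Rightarrow> real^3 \<Rightarrow> real^3) \<Rightarrow> contact_pt \<Rightarrow> contact_pt" where
  "lifted_generator \<phi> = (\<lambda>(x, e0).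
     vector_derivative (\<lambda>t. (\<phi> t x, frechet_derivative (\<phi> t) (at x) e0)) (at 0))"

definition contact_form :: "(real^3 \<Rightarrow> real^3^3) \<Rightarrow> contact_pt form" where
  "contact_form G = (\<lambda>(x, e0) vs. rinner G x e0 (fst (hd vs)))"

text \<open>\<open>\<Lambda>\<^sub>0 = e\<^sub>0 \<lrcorner> vol\<^sub>M\<close>, where \<open>vol\<^sub>M\<close> is pulled back from the base.\<close>

definition Lambda0 :: "(real^3 \<Rightarrow> real^3^3) \<Rightarrow> contact_pt form" where
  "Lambda0 G = (\<lambda>(x, e0) vs. vol_form G x (e0 # map fst vs))"

definition theta0 :: "(real^3 \<Rightarrow> real^3^3) \<Rightarrow> frame_pt form" where
  "theta0 G = (\<lambda>(x, e0, e1, e2) vs. rinner G x e0 (fst (hd vs)))"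

definition theta1 :: "(real^3 \<Rightarrow> real^3^3) \<Rightarrow> frame_pt form" where
  "theta1 G = (\<lambda>(x, e0, e1, e2) vs. rinner G x e1 (fst (hd vs)))"

definition theta2 :: "(real^3 \<Rightarrow> real^3^3) \<Rightarrow> frame_pt form" where
  "theta2 G = (\<lambda>(x, e0, e1, e2) vs. rinner G x e2 (fst (hd vs)))"

text \<open>The three independent connection forms, \<open>w01 = \<omega>\<^sup>0\<^sub>1\<close>, \<open>w20 = \<omega>\<^sup>2\<^sub>0\<close>, \<open>w12 = \<omega>\<^sup>1\<^sub>2\<close>,
  characterised by the structure equations.\<close>

definition connection_forms ::
    "(real^3) set \<Rightarrow> (real^3 \<Rightarrow> real^3^3) \<Rightarrow> frame_pt form \<Rightarrow> frame_pt form \<Rightarrow> frame_pt form \<Rightarrow> bool"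
where
  "connection_forms U G w01 w20 w12 \<longleftrightarrow>
     smooth_form (frame_bundle U G) 1 w01 \<and>
     smooth_form (frame_bundle U G) 1 w20 \<and>
     smooth_form (frame_bundle U G) 1 w12 \<and>
     has_ext_deriv (frame_bundle U G) 1 (theta0 G)
       (\<lambda>p vs. - wedge 1 1 w01 (theta1 G) p vs + wedge 1 1 w20 (theta2 G) p vs) \<and>
     has_ext_deriv (frame_bundle U G) 1 (theta1 G)
       (\<lambda>p vs. wedge 1 1 w01 (theta0 G) p vs - wedge 1 1 w12 (theta2 G) p vs) \<and>
     has_ext_deriv (frame_bundle U G) 1 (theta2 G)
       (\<lambda>p vs. - wedge 1 1 w20 (theta0 G) p vs + wedge 1 1 w12 (theta1 G) p vs)"

text \<open>\<open>\<Psi>\<^sub>0\<close> is the form on the unit bundle whose pullback to the frame bundle is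
  \<open>-\<omega>\<^sup>2\<^sub>0 \<and> \<theta>\<^sup>1 - \<omega>\<^sup>0\<^sub>1 \<and> \<theta>\<^sup>2\<close>.\<close>

definition is_Psi0 :: "(real^3) set \<Rightarrow> (real^3 \<Rightarrow> real^3^3) \<Rightarrow> contact_pt form \<Rightarrow> bool" where
  "is_Psi0 U G \<Psi>\<^sub>0 \<longleftrightarrow>
     smooth_form (unit_bundle U G) 2 \<Psi>\<^sub>0 \<and>
     (\<exists>w01 w20 w12. connection_forms U G w01 w20 w12 \<and>
        form_eq (frame_bundle U G) 2 (pullback frame_proj \<Psi>\<^sub>0)
          (\<lambda>p vs. - wedge 1 1 w20 (theta1 G) p vs - wedge 1 1 w01 (theta2 G) p vs))"

definition Psi :: "(real^3 \<Rightarrow> real^3^3) \<Rightarrow> real \<Rightarrow> contact_pt form \<Rightarrow> contact_pt form" where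
  "Psi G H \<Psi>\<^sub>0 = (\<lambda>p vs. \<Psi>\<^sub>0 p vs + 2 * H * Lambda0 G p vs)"

text \<open>The differential ideal \<open>\<E>\<close> generated by \<open>\<theta>\<^sup>0\<close>, \<open>d\<theta>\<^sup>0\<close> and \<open>\<Psi>\<close>.\<close>

definition cmc_ideal ::
    "(real^3) set \<Rightarrow> (real^3 \<Rightarrow> real^3^3) \<Rightarrow> real \<Rightarrow> contact_pt form \<Rightarrow> nat \<Rightarrow> contact_pt form \<Rightarrow> bool"
where
  "cmc_ideal U G H \<Psi>\<^sub>0 =
     diff_ideal (unit_bundle U G)
       ({(1, contact_form G)} \<union>
        {(2, \<delta>) | \<delta>. has_ext_deriv (unit_bundle U G) 1 (contact_form G) \<delta>} \<union>
        {(2, Psi G H \<Psi>\<^sub>0)})"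

text \<open>The class of a 1-form on the unit bundle modulo exact 1-forms and modulo \<open>\<E>\<close>, as a set of
  1-forms.\<close>

definition class_mod_ideal ::
    "(real^3) set \<Rightarrow> (real^3 \<Rightarrow> real^3^3) \<Rightarrow> real \<Rightarrow> contact_pt form \<Rightarrow> contact_pt form \<Rightarrow>
     contact_pt form set"
where
  "class_mod_ideal U G H \<Psi>\<^sub>0 \<alpha> =
     {\<eta>. smooth_form (unit_bundle U G) 1 \<eta> \<and>
        (\<exists>h \<xi> \<epsilon>. smooth_form (unit_bundle U G) 0 h \<and> has_ext_deriv (unit_bundle U G) 0 h \<xi> \<and>
           smooth_form (unit_bundle U G) 1 \<epsilon> \<and> cmc_ideal U G H \<Psi>\<^sub>0 1 \<epsilon> \<and>
           form_eq (unit_bundle U G) 1 \<eta> (\<lambda>p vs. \<alpha> p vs + \<xi> p vs + \<epsilon> p vs))}"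

text \<open>The minimal part \<open>S \<lrcorner> \<Lambda>\<^sub>0\<close> and the CMC part \<open>F\<^sup>\<flat>\<close> of the Noether form. The Killing field \<open>S\<close>
  enters the former through its flow \<open>\<phi>\<close>.\<close>

definition noether_minimal ::
    "(real^3 \<Rightarrow> real^3^3) \<Rightarrow> (real \<Rightarrow> real^3 \<Rightarrow> real^3) \<Rightarrow> contact_pt form" where
  "noether_minimal G \<phi> = interior_product (lifted_generator \<phi>) (Lambda0 G)"

definition noether_cmc :: "(real^3 \<Rightarrow> real^3^3) \<Rightarrow> (real^3 \<Rightarrow> real^3) \<Rightarrow> contact_pt form" where
  "noether_cmc G F = pullback fst (flat G F)"

definition noether_form ::
    "(real^3) set \<Rightarrow> (real^3 \<Rightarrow> real^3^3) \<Rightarrow> real \<Rightarrow> contact_pt form \<Rightarrow>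
     (real \<Rightarrow> real^3 \<Rightarrow> real^3) \<Rightarrow> (real^3 \<Rightarrow> real^3) \<Rightarrow> contact_pt form set" where
  "noether_form U G H \<Psi>\<^sub>0 \<phi> F =
     class_mod_ideal U G H \<Psi>\<^sub>0
       (\<lambda>p vs. noether_minimal G \<phi> p vs - 2 * H * noether_cmc G F p vs)"


section \<open>Oriented smooth surfaces and their de Rham cohomology\<close>

text \<open>A chart is given by a local parametrisation \<open>(V, \<psi>)\<close> with \<open>V \<subseteq> \<real>\<^sup>2\<close> open.\<close>

type_synonym 's chart = "(real^2) set \<times> (real^2 \<Rightarrow> 's)"

definition overlap :: "'s chart \<Rightarrow> 's chart \<Rightarrow> (real^2) set" where
  "overlap c c' = {u \<in> fst c. snd c u \<in> snd c' ` fst c'}"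

definition transition :: "'s chart \<Rightarrow> 's chart \<Rightarrow> real^2 \<Rightarrow> real^2" where
  "transition c c' = inv_into (fst c') (snd c') \<circ> snd c"

definition oriented_surface :: "'s topology \<Rightarrow> 's chart set \<Rightarrow> bool" where
  "oriented_surface \<Sigma> A \<longleftrightarrow>
     Hausdorff_space \<Sigma> \<and> second_countable \<Sigma> \<and>
     (\<forall>c\<in>A. open (fst c) \<and> openin \<Sigma> (snd c ` fst c) \<and>
        homeomorphic_map (top_of_set (fst c)) (subtopology \<Sigma> (snd c ` fst c)) (snd c)) \<and>
     (\<Union>c\<in>A. snd c ` fst c) = topspace \<Sigma> \<and>
     (\<forall>c\<in>A. \<forall>c'\<in>A. smooth_on (overlap c c') (transition c c') \<and>
        (\<forall>u\<in>overlap c c'. det (matrix (frechet_derivative (transition c c') (at u))) > 0))"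

definition surface_smooth :: "'s chart set \<Rightarrow> ('s \<Rightarrow> 'e::euclidean_space) \<Rightarrow> bool" where
  "surface_smooth A f \<longleftrightarrow> (\<forall>c\<in>A. smooth_on (fst c) (f \<circ> snd c))"

text \<open>A form on a surface is the family of its coordinate expressions in the charts of the atlas.\<close>

type_synonym 's surface_form = "'s chart \<Rightarrow> (real^2) form"

definition smooth_surface_form :: "'s chart set \<Rightarrow> nat \<Rightarrow> 's surface_form \<Rightarrow> bool" where
  "smooth_surface_form A k \<alpha> \<longleftrightarrow>
     (\<forall>c\<in>A. smooth_form_on (fst c) k (\<alpha> c)) \<and>
     (\<forall>c\<in>A. \<forall>c'\<in>A. \<forall>u\<in>overlap c c'. \<forall>ws. length ws = k \<longrightarrow>
        \<alpha> c u ws = pullback (transition c c') (\<alpha> c') u ws)"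

definition surface_form_eq :: "'s chart set \<Rightarrow> nat \<Rightarrow> 's surface_form \<Rightarrow> 's surface_form \<Rightarrow> bool" where
  "surface_form_eq A k \<alpha> \<beta> \<longleftrightarrow>
     (\<forall>c\<in>A. \<forall>u\<in>fst c. \<forall>ws. length ws = k \<longrightarrow> \<alpha> c u ws = \<beta> c u ws)"

definition surface_ext_deriv :: "'s surface_form \<Rightarrow> 's surface_form" where
  "surface_ext_deriv \<alpha> = (\<lambda>c. ext_deriv (\<alpha> c))"

definition surface_pullback :: "('s \<Rightarrow> 'e::euclidean_space) \<Rightarrow> 'e form \<Rightarrow> 's surface_form" where
  "surface_pullback N \<eta> = (\<lambda>c. pullback (N \<circ> snd c) \<eta>)"

definition closed_1forms :: "'s chart set \<Rightarrow> 's surface_form set" where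
  "closed_1forms A =
     {\<alpha>. smooth_surface_form A 1 \<alpha> \<and> surface_form_eq A 2 (surface_ext_deriv \<alpha>) (\<lambda>c u ws. 0)}"

definition cohomologous :: "'s chart set \<Rightarrow> ('s surface_form \<times> 's surface_form) set" where
  "cohomologous A =
     {(\<alpha>, \<beta>). \<alpha> \<in> closed_1forms A \<and> \<beta> \<in> closed_1forms A \<and>
        (\<exists>h. smooth_surface_form A 0 h \<and>
           surface_form_eq A 1 (\<lambda>c u ws. \<beta> c u ws - \<alpha> c u ws) (surface_ext_deriv h))}"

definition H1 :: "'s chart set \<Rightarrow> 's surface_form set set" where
  "H1 A = closed_1forms A // cohomologous A"

text \<open>For \<open>\<alpha>\<close> not closed this is the empty set, which is not an element of \<^const>\<open>H1\<close>.\<close>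

definition H1_class :: "'s chart set \<Rightarrow> 's surface_form \<Rightarrow> 's surface_form set" where
  "H1_class A \<alpha> = cohomologous A `` {\<alpha>}"


section \<open>CMC immersions\<close>

definition immersion_into :: "'s topology \<Rightarrow> 's chart set \<Rightarrow> (real^3) set \<Rightarrow> ('s \<Rightarrow> real^3) \<Rightarrow> bool" where
  "immersion_into \<Sigma> A U f \<longleftrightarrow>
     f ` topspace \<Sigma> \<subseteq> U \<and> surface_smooth A f \<and>
     (\<forall>c\<in>A. \<forall>u\<in>fst c. inj (frechet_derivative (f \<circ> snd c) (at u)))"

definition df :: "('s \<Rightarrow> real^3) \<Rightarrow> 's chart \<Rightarrow> real^2 \<Rightarrow> real^2 \<Rightarrow> real^3" where
  "df f c u w = frechet_derivative (f \<circ> snd c) (at u) w"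

definition tangent_frame ::
    "(real^3 \<Rightarrow> real^3^3) \<Rightarrow> ('s \<Rightarrow> real^3) \<Rightarrow> 's chart \<Rightarrow> real^2 \<Rightarrow> real^3 \<Rightarrow> real^3 \<Rightarrow> bool" where
  "tangent_frame G f c u e1 e2 \<longleftrightarrow>
     (\<exists>a1 a2. det (vector [a1, a2] :: real^2^2) > 0 \<and> e1 = df f c u a1 \<and> e2 = df f c u a2) \<and>
     rinner G (f (snd c u)) e1 e1 = 1 \<and> rinner G (f (snd c u)) e2 e2 = 1 \<and>
     rinner G (f (snd c u)) e1 e2 = 0"

definition legendrian_lift ::
    "(real^3) set \<Rightarrow> (real^3 \<Rightarrow> real^3^3) \<Rightarrow> 's topology \<Rightarrow> 's chart set \<Rightarrow>
     ('s \<Rightarrow> real^3) \<Rightarrow> ('s \<Rightarrow> contact_pt) \<Rightarrow> bool" where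
  "legendrian_lift U G \<Sigma> A f N \<longleftrightarrow>
     N ` topspace \<Sigma> \<subseteq> unit_bundle U G \<and> surface_smooth A N \<and>
     (\<forall>p\<in>topspace \<Sigma>. fst (N p) = f p) \<and>
     surface_form_eq A 1 (surface_pullback N (contact_form G)) (\<lambda>c u ws. 0)"

text \<open>The orientation of the surface is the one induced by the unit normal.\<close>

definition oriented_by_normal ::
    "(real^3 \<Rightarrow> real^3^3) \<Rightarrow> 's chart set \<Rightarrow> ('s \<Rightarrow> real^3) \<Rightarrow> ('s \<Rightarrow> contact_pt) \<Rightarrow> bool" where
  "oriented_by_normal G A f N \<longleftrightarrow>
     (\<forall>c\<in>A. \<forall>u\<in>fst c. \<forall>e1 e2. tangent_frame G f c u e1 e2 \<longrightarrow>
        vol_form G (f (snd c u)) [snd (N (snd c u)), e1, e2] > 0)"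

definition cmc_lift ::
    "(real^3 \<Rightarrow> real^3^3) \<Rightarrow> real \<Rightarrow> contact_pt form \<Rightarrow> 's chart set \<Rightarrow> ('s \<Rightarrow> contact_pt) \<Rightarrow> bool" where
  "cmc_lift G H \<Psi>\<^sub>0 A N \<longleftrightarrow>
     surface_form_eq A 2 (surface_pullback N (Psi G H \<Psi>\<^sub>0)) (\<lambda>c u ws. 0)"

text \<open>\<open>*df = -e\<^sub>2 \<theta>\<^sup>1 + e\<^sub>1 \<theta>\<^sup>2\<close> for a positively oriented orthonormal tangent frame, on whose choice the
  value does not depend; the dual coframe is \<open>\<theta>\<^sup>i(w) = \<langle>e\<^sub>i, df(w)\<rangle>\<close>.\<close>

definition star_df ::
    "(real^3 \<Rightarrow> real^3^3) \<Rightarrow> ('s \<Rightarrow> real^3) \<Rightarrow> 's chart \<Rightarrow> real^2 \<Rightarrow> real^2 \<Rightarrow> real^3" where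
  "star_df G f c u w =
     (let (e1, e2) = (SOME (e1, e2). tangent_frame G f c u e1 e2)
      in - (rinner G (f (snd c u)) e1 (df f c u w) *\<^sub>R e2)
         + rinner G (f (snd c u)) e2 (df f c u w) *\<^sub>R e1)"

definition inner_star_df ::
    "(real^3 \<Rightarrow> real^3^3) \<Rightarrow> (real^3 \<Rightarrow> real^3) \<Rightarrow> ('s \<Rightarrow> real^3) \<Rightarrow> 's surface_form" where
  "inner_star_df G S f c u ws = rinner G (f (snd c u)) (S (f (snd c u))) (star_df G f c u (hd ws))"

definition inner_df ::
    "(real^3 \<Rightarrow> real^3^3) \<Rightarrow> (real^3 \<Rightarrow> real^3) \<Rightarrow> ('s \<Rightarrow> real^3) \<Rightarrow> 's surface_form" where
  "inner_df G F f c u ws = rinner G (f (snd c u)) (F (f (snd c u))) (df f c u (hd ws))"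

end

theory Submission
  imports Defs
begin

text \<open>The heart of the matter is that \<open>N\<^sup>*(S \<lrcorner> \<Lambda>\<^sub>0 - 2H F\<^sup>\<flat>)\<close> is closed. On the frame bundle \<open>\<Lambda>\<^sub>0 = \<theta>\<^sup>1 \<and> \<theta>\<^sup>2\<close>, so
  \<open>S \<lrcorner> \<Lambda>\<^sub>0 = \<theta>\<^sup>1(S) \<theta>\<^sup>2 - \<theta>\<^sup>2(S) \<theta>\<^sup>1\<close>. As \<open>S\<close> is a Killing field, its flow lifts to frames and preserves
  the tautological forms, whence \<open>d(\<theta>\<^sup>i(S)) = - S \<lrcorner> d\<theta>\<^sup>i\<close>
  (\<open>killing_leg_derivative\<close>). Inserting the structure equations, one finds
  \<open>d(S \<lrcorner> \<Lambda>\<^sub>0) = - \<theta>\<^sup>0(S) \<Psi>\<^sub>0\<close> on vectors on which \<open>\<theta>\<^sup>0\<close> vanishes (\<open>ext_deriv_noether_frame_form\<close>). On a CMC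
  lift \<open>\<Psi>\<^sub>0 = -2H \<Lambda>\<^sub>0\<close>, so this is \<open>2H \<theta>\<^sup>0(S) \<Lambda>\<^sub>0\<close>, the restriction of \<open>2H S \<lrcorner> vol\<^sub>M = 2H dF\<^sup>\<flat>\<close> to the surface
  (\<open>ext_deriv_noether_chart\<close>).

  The structure equations hold for exterior derivatives on the frame bundle, which are given by
  unspecified local extensions to the ambient space. They are made explicit by a smooth retraction
  of a neighbourhood onto the bundle, the Gram-Schmidt process: pulling back by it shows
  that the derivative, on tangent vectors, can be computed from any smooth
  extension (\<open>has_ext_deriv_retract\<close>). The same process turns the unit normal into a moving frame on the
  surface, and shows that the lift of \<open>S\<close> to frames is tangent to the bundle
  (\<open>frame_lift_tangent\<close>).

  The class does not depend on the representative, since exact forms are pulled back to exact forms and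
  elements of degree one of \<open>\<E>\<close> to zero (\<open>pullback_diff_ideal_vanishes\<close>). The two parts of the
  Noether form are identified by evaluating the volume form in a frame \<open>(N, e\<^sub>1, e\<^sub>2)\<close>.\<close>

section \<open>Calculus of smooth maps\<close>

lemma frechet_derivative_eq_if_has_derivative:
  "(f has_derivative f') (at x) \<Longrightarrow> frechet_derivative f (at x) = f'"
  using frechet_derivative_at by metis

lemma has_derivative_frechet:
  "f differentiable (at x) \<Longrightarrow> (f has_derivative frechet_derivative f (at x)) (at x)"
  by (simp add: frechet_derivative_works)

lemma frechet_derivative_cong_open:
  assumes "open W" "x \<in> W" "\<And>y. y \<in> W \<Longrightarrow> f y = g y"
  shows "frechet_derivative f (at x) = frechet_derivative g (at x)"
proof -
  have "(f has_derivative d) (at x) \<longleftrightarrow> (g has_derivative d) (at x)" for d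
    using has_derivative_transform_within_open[OF _ assms(1,2)] assms(3) by metis
  then show ?thesis unfolding frechet_derivative_def by simp
qed

lemma differentiable_cong_open:
  assumes "open W" "x \<in> W" "\<And>y. y \<in> W \<Longrightarrow> f y = g y" "f differentiable (at x)"
  shows "g differentiable (at x)"
  using assms has_derivative_transform_within_open unfolding differentiable_def by metis

lemma Ck_on_SucD: "Ck_on (Suc k) W f \<Longrightarrow> Ck_on k W f"
proof (induction k arbitrary: f)
  case 0
  then show ?case
    by (auto intro!: continuous_at_imp_continuous_on differentiable_imp_continuous_within)
next
  case (Suc k)
  then show ?case by (metis Ck_on.simps(2))
qed

lemma Ck_on_subset: "Ck_on k W f \<Longrightarrow> V \<subseteq> W \<Longrightarrow> Ck_on k V f"
  by (induction k arbitrary: f) (auto intro: continuous_on_subset)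

lemma Ck_on_cong:
  assumes "open W" "\<And>y. y \<in> W \<Longrightarrow> f y = g y" "Ck_on k W f"
  shows "Ck_on k W g"
  using assms(2,3)
proof (induction k arbitrary: f g)
  case 0
  then show ?case by (auto intro: continuous_on_eq)
next
  case (Suc k)
  have d: "frechet_derivative f (at x) = frechet_derivative g (at x)" if "x \<in> W" for x
    using frechet_derivative_cong_open[OF assms(1) that] Suc.prems by blast
  have "Ck_on k W (\<lambda>x. frechet_derivative g (at x) v)" for v
    using Suc.prems(2) by - (rule Suc.IH[of "\<lambda>x. frechet_derivative f (at x) v"], simp_all add: d)
  moreover have "g differentiable (at x)" if "x \<in> W" for x
    using differentiable_cong_open[OF assms(1) that Suc.prems(1)] Suc.prems(2) that by simp
  ultimately show ?case by simp
qed

lemma Ck_on_locally: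
  assumes "\<And>x. x \<in> W \<Longrightarrow> \<exists>V. open V \<and> x \<in> V \<and> Ck_on k V f"
  shows "Ck_on k W f"
  using assms
proof (induction k arbitrary: f)
  case 0
  then show ?case
    by (metis Ck_on.simps(1) continuous_at_imp_continuous_on continuous_on_eq_continuous_at)
next
  case (Suc k)
  then show ?case by (metis Ck_on.simps(2))
qed

lemma Ck_on_const: "Ck_on k W (\<lambda>x. c)"
  by (induction k arbitrary: c) auto

lemma Ck_on_bounded_linear:
  assumes "bounded_linear L"
  shows "Ck_on k W L"
proof -
  have "frechet_derivative L (at x) = L" for x
    by (intro frechet_derivative_eq_if_has_derivative bounded_linear_imp_has_derivative assms)
  moreover have "continuous_on W L"
    using assms by (simp add: linear_continuous_on)
  moreover have "L differentiable (at x)" for x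
    using assms bounded_linear_imp_differentiable by blast
  ultimately show ?thesis by (cases k) (auto intro: Ck_on_const)
qed

lemma Ck_on_compose_linear:
  assumes "bounded_linear L" "open W" "Ck_on k W f"
  shows "Ck_on k W (\<lambda>x. L (f x))"
  using assms(3)
proof (induction k arbitrary: f)
  case 0
  then show ?case
    using assms(1) bounded_linear.continuous_on by auto
next
  case (Suc k)
  have d: "((\<lambda>x. L (f x)) has_derivative (\<lambda>v. L (frechet_derivative f (at x) v))) (at x)"
    if "x \<in> W" for x
    using Suc.prems that
    by (auto intro!: bounded_linear.has_derivative[OF assms(1)] has_derivative_frechet)
  have "Ck_on k W (\<lambda>x. L (frechet_derivative f (at x) v))" for v
    using Suc by auto
  then have "Ck_on k W (\<lambda>x. frechet_derivative (\<lambda>x. L (f x)) (at x) v)" for v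
    by (rule Ck_on_cong[OF assms(2), rotated])
       (simp add: frechet_derivative_eq_if_has_derivative[OF d])
  then show ?case using Derivative.differentiableI[OF d] by simp
qed

lemma Ck_on_add:
  assumes "open W" "Ck_on k W f" "Ck_on k W g"
  shows "Ck_on k W (\<lambda>x. f x + g x)"
  using assms(2,3)
proof (induction k arbitrary: f g)
  case 0
  then show ?case by (auto intro: continuous_intros)
next
  case (Suc k)
  have d: "((\<lambda>x. f x + g x) has_derivative
      (\<lambda>v. frechet_derivative f (at x) v + frechet_derivative g (at x) v)) (at x)"
    if "x \<in> W" for x
    using Suc.prems that by (auto intro!: has_derivative_add has_derivative_frechet)
  have "Ck_on k W (\<lambda>x. frechet_derivative f (at x) v + frechet_derivative g (at x) v)" for v
    using Suc by auto
  then have "Ck_on k W (\<lambda>x. frechet_derivative (\<lambda>x. f x + g x) (at x) v)" for v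
    by (rule Ck_on_cong[OF assms(1), rotated])
       (simp add: frechet_derivative_eq_if_has_derivative[OF d])
  then show ?case using Derivative.differentiableI[OF d] by simp
qed

lemma Ck_on_bilinear:
  assumes B: "bounded_bilinear B" and "open W" "Ck_on k W f" "Ck_on k W g"
  shows "Ck_on k W (\<lambda>x. B (f x) (g x))"
  using assms(3,4)
proof (induction k arbitrary: f g)
  case 0
  then show ?case by (auto intro: bounded_bilinear.continuous_on[OF B])
next
  case (Suc k)
  have d: "((\<lambda>x. B (f x) (g x)) has_derivative
      (\<lambda>v. B (f x) (frechet_derivative g (at x) v) + B (frechet_derivative f (at x) v) (g x))) (at x)"
    if "x \<in> W" for x
    using Suc.prems that
    by (auto intro!: bounded_bilinear.FDERIV[OF B] has_derivative_frechet)
  have "Ck_on k W f" "Ck_on k W g"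
    using Suc.prems by (auto intro!: Ck_on_SucD simp del: Ck_on.simps)
  then have "Ck_on k W (\<lambda>x. B (f x) (frechet_derivative g (at x) v)
        + B (frechet_derivative f (at x) v) (g x))" for v
    using Suc by (intro Ck_on_add assms(2)) auto
  then have "Ck_on k W (\<lambda>x. frechet_derivative (\<lambda>x. B (f x) (g x)) (at x) v)" for v
    by (rule Ck_on_cong[OF assms(2), rotated])
       (simp add: frechet_derivative_eq_if_has_derivative[OF d])
  then show ?case using Derivative.differentiableI[OF d] by simp
qed

lemma Ck_on_sum:
  assumes "open W" "\<And>i. i \<in> I \<Longrightarrow> Ck_on k W (f i)"
  shows "Ck_on k W (\<lambda>x. \<Sum>i\<in>I. f i x)"
  using assms(2)
  by (induction I rule: infinite_finite_induct) (auto intro: Ck_on_const Ck_on_add[OF assms(1)])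

lemma linear_eq_sum_Basis:
  fixes L :: "'a::euclidean_space \<Rightarrow> 'b::real_vector"
  assumes "linear L"
  shows "L v = (\<Sum>b\<in>Basis. (v \<bullet> b) *\<^sub>R L b)"
proof -
  have "L v = L (\<Sum>b\<in>Basis. (v \<bullet> b) *\<^sub>R b)"
    by (simp add: euclidean_representation)
  also have "\<dots> = (\<Sum>b\<in>Basis. (v \<bullet> b) *\<^sub>R L b)"
    by (simp add: linear_sum[OF assms] linear_cmul[OF assms])
  finally show ?thesis .
qed

lemma Ck_on_compose:
  fixes f :: "'a::euclidean_space \<Rightarrow> 'b::euclidean_space" and g :: "'b \<Rightarrow> 'c::euclidean_space"
  assumes "open W" "f ` W \<subseteq> V" "Ck_on k W f" "Ck_on k V g"
  shows "Ck_on k W (\<lambda>x. g (f x))"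
  using assms(3,4)
proof (induction k arbitrary: g)
  case 0
  then show ?case using assms(2) continuous_on_compose2 by (metis Ck_on.simps(1))
next
  case (Suc k)
  have df: "f differentiable (at x)" if "x \<in> W" for x using Suc.prems that by auto
  have dg: "g differentiable (at (f x))" if "x \<in> W" for x using Suc.prems that assms(2) by auto
  have d: "((\<lambda>x. g (f x)) has_derivative
      (\<lambda>v. frechet_derivative g (at (f x)) (frechet_derivative f (at x) v))) (at x)"
    if "x \<in> W" for x
    using has_derivative_compose[OF has_derivative_frechet[OF df[OF that]]
        has_derivative_frechet[OF dg[OF that]]] .
  \<comment> \<open>Only derivatives in a fixed direction are known to be of class \<open>C\<^sup>k\<close>, hence the basis.\<close>
  have "Ck_on k W (\<lambda>x. \<Sum>b\<in>Basis.
      (frechet_derivative f (at x) v \<bullet> b) *\<^sub>R frechet_derivative g (at (f x)) b)" for v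
  proof (intro Ck_on_sum assms(1) Ck_on_bilinear[OF bounded_bilinear_scaleR])
    fix b :: 'b
    show "Ck_on k W (\<lambda>x. frechet_derivative f (at x) v \<bullet> b)"
      using Suc.prems by (intro Ck_on_compose_linear[OF bounded_linear_inner_left assms(1)]) auto
    show "Ck_on k W (\<lambda>x. frechet_derivative g (at (f x)) b)"
      using Suc.prems by (intro Suc.IH Ck_on_SucD[of k W f]) auto
  qed
  then have "Ck_on k W (\<lambda>x. frechet_derivative (\<lambda>x. g (f x)) (at x) v)" for v
  proof (rule Ck_on_cong[OF assms(1), rotated])
    fix x assume "x \<in> W"
    show "(\<Sum>b\<in>Basis. (frechet_derivative f (at x) v \<bullet> b) *\<^sub>R frechet_derivative g (at (f x)) b)
        = frechet_derivative (\<lambda>x. g (f x)) (at x) v"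
      using linear_eq_sum_Basis[OF linear_frechet_derivative[OF dg[OF \<open>x \<in> W\<close>]]]
        frechet_derivative_eq_if_has_derivative[OF d[OF \<open>x \<in> W\<close>]] by metis
  qed
  then show ?case using Derivative.differentiableI[OF d] by simp
qed

lemma Ck_on_Pair:
  assumes "open W" "Ck_on k W f" "Ck_on k W g"
  shows "Ck_on k W (\<lambda>x. (f x, g x))"
proof -
  have 1: "bounded_linear (\<lambda>y. (y, 0::'c))" and 2: "bounded_linear (\<lambda>y. (0::'b, y))"
    by (auto intro!: bounded_linear_Pair bounded_linear_ident bounded_linear_zero)
  have "Ck_on k W (\<lambda>x. (f x, 0) + (0, g x))"
    by (intro Ck_on_add assms Ck_on_compose_linear[OF 1] Ck_on_compose_linear[OF 2])
  then show ?thesis by simp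
qed

lemma Ck_on_inverse: "Ck_on k {0::real<..} inverse"
proof (induction k)
  case 0
  show ?case by (auto intro!: continuous_intros)
next
  case (Suc k)
  have d: "(inverse has_derivative (\<lambda>v. - (inverse x * inverse x) * v)) (at x)" if "x > 0" for x :: real
    using that by (auto intro!: derivative_eq_intros)
  have "Ck_on k {0::real<..} (\<lambda>x. (- v) * (inverse x * inverse x))" for v
    by (intro Ck_on_bilinear[OF bounded_bilinear_mult] Ck_on_const Suc) auto
  then have "Ck_on k {0::real<..} (\<lambda>x. frechet_derivative inverse (at x) v)" for v
    by (rule Ck_on_cong[rotated 2]) (auto simp: frechet_derivative_eq_if_has_derivative[OF d])
  then show ?case using Derivative.differentiableI[OF d] by simp
qed

lemma Ck_on_sqrt: "Ck_on k {0::real<..} sqrt"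
proof (induction k)
  case 0
  show ?case by (auto intro!: continuous_intros)
next
  case (Suc k)
  have d: "(sqrt has_derivative (\<lambda>v. v / 2 * inverse (sqrt x))) (at x)" if "x > 0" for x :: real
    using that by (auto intro!: derivative_eq_intros simp: field_simps)
  have "Ck_on k {0::real<..} (\<lambda>x. inverse (sqrt x))"
    by (rule Ck_on_compose[OF _ _ Suc Ck_on_inverse]) auto
  then have "Ck_on k {0::real<..} (\<lambda>x. v / 2 * inverse (sqrt x))" for v
    by (intro Ck_on_bilinear[OF bounded_bilinear_mult] Ck_on_const) auto
  then have "Ck_on k {0::real<..} (\<lambda>x. frechet_derivative sqrt (at x) v)" for v
    by (rule Ck_on_cong[rotated 2]) (auto simp: frechet_derivative_eq_if_has_derivative[OF d])
  then show ?case using Derivative.differentiableI[OF d] by simp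
qed

lemma smooth_on_differentiable: "smooth_on W f \<Longrightarrow> x \<in> W \<Longrightarrow> f differentiable (at x)"
  unfolding smooth_on_def by (metis Ck_on.simps(2))

lemma smooth_on_derivative: "smooth_on W f \<Longrightarrow> smooth_on W (\<lambda>x. frechet_derivative f (at x) v)"
  unfolding smooth_on_def by (metis Ck_on.simps(2))

lemma smooth_on_has_derivative:
  "smooth_on W f \<Longrightarrow> x \<in> W \<Longrightarrow> (f has_derivative frechet_derivative f (at x)) (at x)"
  by (simp add: smooth_on_differentiable has_derivative_frechet)

lemma smooth_on_imp_continuous_on: "smooth_on W f \<Longrightarrow> continuous_on W f"
  unfolding smooth_on_def by (metis Ck_on.simps(1))

lemma smooth_on_subset: "smooth_on W f \<Longrightarrow> V \<subseteq> W \<Longrightarrow> smooth_on V f"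
  unfolding smooth_on_def by (blast intro: Ck_on_subset)

lemma smooth_on_cong:
  "open W \<Longrightarrow> (\<And>y. y \<in> W \<Longrightarrow> f y = g y) \<Longrightarrow> smooth_on W f \<Longrightarrow> smooth_on W g"
  unfolding smooth_on_def by (blast intro: Ck_on_cong)

lemma smooth_on_locally:
  "(\<And>x. x \<in> W \<Longrightarrow> \<exists>V. open V \<and> x \<in> V \<and> smooth_on V f) \<Longrightarrow> smooth_on W f"
  unfolding smooth_on_def by (intro allI Ck_on_locally) meson

lemma smooth_on_const: "smooth_on W (\<lambda>x. c)"
  unfolding smooth_on_def by (blast intro: Ck_on_const)

lemma smooth_on_linear: "bounded_linear L \<Longrightarrow> smooth_on W L"
  unfolding smooth_on_def by (blast intro: Ck_on_bounded_linear)

lemma smooth_on_compose_linear: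
  "bounded_linear L \<Longrightarrow> open W \<Longrightarrow> smooth_on W f \<Longrightarrow> smooth_on W (\<lambda>x. L (f x))"
  unfolding smooth_on_def by (blast intro: Ck_on_compose_linear)

lemma smooth_on_bilinear:
  "bounded_bilinear B \<Longrightarrow> open W \<Longrightarrow> smooth_on W f \<Longrightarrow> smooth_on W g \<Longrightarrow> smooth_on W (\<lambda>x. B (f x) (g x))"
  unfolding smooth_on_def by (blast intro: Ck_on_bilinear)

lemma smooth_on_add:
  "open W \<Longrightarrow> smooth_on W f \<Longrightarrow> smooth_on W g \<Longrightarrow> smooth_on W (\<lambda>x. f x + g x)"
  unfolding smooth_on_def by (blast intro: Ck_on_add)

lemma smooth_on_sum:
  "open W \<Longrightarrow> (\<And>i. i \<in> I \<Longrightarrow> smooth_on W (f i)) \<Longrightarrow> smooth_on W (\<lambda>x. \<Sum>i\<in>I. f i x)"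
  unfolding smooth_on_def by (blast intro: Ck_on_sum)

lemma smooth_on_compose:
  "open W \<Longrightarrow> f ` W \<subseteq> V \<Longrightarrow> smooth_on W f \<Longrightarrow> smooth_on V g \<Longrightarrow> smooth_on W (\<lambda>x. g (f x))"
  unfolding smooth_on_def by (blast intro: Ck_on_compose)

lemma smooth_on_Pair:
  "open W \<Longrightarrow> smooth_on W f \<Longrightarrow> smooth_on W g \<Longrightarrow> smooth_on W (\<lambda>x. (f x, g x))"
  unfolding smooth_on_def by (blast intro: Ck_on_Pair)

lemma smooth_on_inverse_sqrt:
  assumes "open W" "smooth_on W f" "\<And>x. x \<in> W \<Longrightarrow> f x > (0::real)"
  shows "smooth_on W (\<lambda>x. inverse (sqrt (f x)))"
proof -
  have "smooth_on {0::real<..} sqrt" "smooth_on {0::real<..} inverse"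
    by (auto simp: smooth_on_def Ck_on_sqrt Ck_on_inverse)
  then have "smooth_on {0::real<..} (\<lambda>x. inverse (sqrt x))"
    by - (rule smooth_on_compose[of "{0<..}" sqrt "{0<..}" inverse], auto)
  then show ?thesis
    using assms by - (rule smooth_on_compose[of W f "{0<..}"], auto)
qed

lemma smooth_on_sqrt:
  assumes "open W" "smooth_on W f" "\<And>x. x \<in> W \<Longrightarrow> f x > (0::real)"
  shows "smooth_on W (\<lambda>x. sqrt (f x))"
  using assms by - (rule smooth_on_compose[of W f "{0<..}" sqrt], auto simp: smooth_on_def Ck_on_sqrt)

lemmas smooth_on_mult = smooth_on_bilinear[OF bounded_bilinear_mult]
lemmas smooth_on_scaleR = smooth_on_bilinear[OF bounded_bilinear_scaleR]
lemmas smooth_on_inner = smooth_on_bilinear[OF bounded_bilinear_inner]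
lemmas smooth_on_fst = smooth_on_compose_linear[OF bounded_linear_fst]
lemmas smooth_on_snd = smooth_on_compose_linear[OF bounded_linear_snd]
lemmas smooth_on_nth = smooth_on_compose_linear[OF bounded_linear_vec_nth]
lemmas smooth_on_uminus = smooth_on_compose_linear[OF bounded_linear_minus[OF bounded_linear_ident]]
lemmas smooth_on_ident = smooth_on_linear[OF bounded_linear_ident]

lemma smooth_on_diff:
  "open W \<Longrightarrow> smooth_on W f \<Longrightarrow> smooth_on W g \<Longrightarrow> smooth_on W (\<lambda>x. f x - g x)"
  using smooth_on_add[OF _ _ smooth_on_uminus, of W f g] by simp

lemmas smooth_intros = smooth_on_const smooth_on_ident smooth_on_add smooth_on_diff smooth_on_uminus
  smooth_on_mult smooth_on_scaleR smooth_on_inner smooth_on_fst smooth_on_snd smooth_on_nth smooth_on_Pair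

text \<open>Schwarz's theorem: by the mean value theorem, applied twice, the second difference
  quotient takes a value of either mixed derivative at points that tend to \<open>x\<close>.\<close>

lemma second_difference:
  fixes f :: "'a::euclidean_space \<Rightarrow> real"
  assumes f: "smooth_on (ball x r) f" and h: "h > 0" "h * (norm v + norm w) < r"
  shows "\<exists>\<sigma> \<tau>. 0 < \<sigma> \<and> \<sigma> < h \<and> 0 < \<tau> \<and> \<tau> < h \<and>
    f (x + h *\<^sub>R v + h *\<^sub>R w) - f (x + h *\<^sub>R v) - f (x + h *\<^sub>R w) + f x =
    h * (h * frechet_derivative (\<lambda>y. frechet_derivative f (at y) v) (at (x + \<sigma> *\<^sub>R v + \<tau> *\<^sub>R w)) w)"
proof -
  have in_ball: "x + s *\<^sub>R v + t *\<^sub>R w \<in> ball x r" if "0 \<le> s" "s \<le> h" "0 \<le> t" "t \<le> h" for s t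
  proof -
    have "norm (s *\<^sub>R v + t *\<^sub>R w) \<le> s * norm v + t * norm w"
      using norm_triangle_ineq[of "s *\<^sub>R v" "t *\<^sub>R w"] that by simp
    also have "\<dots> \<le> h * norm v + h * norm w"
      using that by (intro add_mono mult_right_mono) auto
    also have "\<dots> < r" using h by (simp add: distrib_left)
    finally show ?thesis by (metis add.assoc add_diff_cancel_left' dist_commute dist_norm mem_ball)
  qed
  have line: "((\<lambda>s. g (p + s *\<^sub>R v)) has_real_derivative frechet_derivative g (at (p + s *\<^sub>R v)) v) (at s)"
    if "g differentiable (at (p + s *\<^sub>R v))" for g :: "'a \<Rightarrow> real" and p v s
  proof -
    have "((\<lambda>s. p + s *\<^sub>R v) has_derivative (\<lambda>t. t *\<^sub>R v)) (at s)"
      by (auto intro!: derivative_eq_intros)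
    from has_derivative_compose[OF this has_derivative_frechet[OF that]]
    show ?thesis
      unfolding has_field_derivative_def linear_cmul[OF linear_frechet_derivative[OF that]]
      by (simp add: mult_commute_abs)
  qed
  define \<phi> where "\<phi> s = f ((x + h *\<^sub>R w) + s *\<^sub>R v) - f (x + s *\<^sub>R v)" for s
  have "\<exists>\<sigma>. 0 < \<sigma> \<and> \<sigma> < h \<and> \<phi> h - \<phi> 0 = (h - 0) *
      (frechet_derivative f (at ((x + h *\<^sub>R w) + \<sigma> *\<^sub>R v)) v - frechet_derivative f (at (x + \<sigma> *\<^sub>R v)) v)"
  proof (intro MVT2 h)
    fix s assume s: "0 \<le> s" "s \<le> h"
    have "x + s *\<^sub>R v + h *\<^sub>R w \<in> ball x r" "x + s *\<^sub>R v + 0 *\<^sub>R w \<in> ball x r"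
      using in_ball[of s h] in_ball[of s 0] s h by simp_all
    then have "f differentiable (at ((x + h *\<^sub>R w) + s *\<^sub>R v))" "f differentiable (at (x + s *\<^sub>R v))"
      using smooth_on_differentiable[OF f] by (simp_all add: ac_simps)
    then show "(\<phi> has_real_derivative
      (frechet_derivative f (at ((x + h *\<^sub>R w) + s *\<^sub>R v)) v - frechet_derivative f (at (x + s *\<^sub>R v)) v)) (at s)"
      unfolding \<phi>_def by (intro DERIV_diff line)
  qed
  then obtain \<sigma> where \<sigma>: "0 < \<sigma>" "\<sigma> < h" and \<phi>: "\<phi> h - \<phi> 0 = h *
      (frechet_derivative f (at ((x + h *\<^sub>R w) + \<sigma> *\<^sub>R v)) v - frechet_derivative f (at (x + \<sigma> *\<^sub>R v)) v)"
    by auto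
  define g where "g y = frechet_derivative f (at y) v" for y
  have "\<exists>\<tau>. 0 < \<tau> \<and> \<tau> < h \<and> g (x + \<sigma> *\<^sub>R v + h *\<^sub>R w) - g (x + \<sigma> *\<^sub>R v + 0 *\<^sub>R w) =
      (h - 0) * frechet_derivative g (at (x + \<sigma> *\<^sub>R v + \<tau> *\<^sub>R w)) w"
    using smooth_on_differentiable[OF smooth_on_derivative[OF f]] in_ball \<sigma> h
    by (intro MVT2 h line) (simp add: g_def)
  then obtain \<tau> where \<tau>: "0 < \<tau>" "\<tau> < h" and g: "g (x + \<sigma> *\<^sub>R v + h *\<^sub>R w) - g (x + \<sigma> *\<^sub>R v) =
      h * frechet_derivative g (at (x + \<sigma> *\<^sub>R v + \<tau> *\<^sub>R w)) w" by auto
  have "f (x + h *\<^sub>R v + h *\<^sub>R w) - f (x + h *\<^sub>R v) - f (x + h *\<^sub>R w) + f x = \<phi> h - \<phi> 0"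
    by (simp add: \<phi>_def ac_simps)
  also have "\<dots> = h * (g (x + \<sigma> *\<^sub>R v + h *\<^sub>R w) - g (x + \<sigma> *\<^sub>R v))"
    unfolding \<phi> g_def by (simp add: ac_simps)
  also have "\<dots> = h * (h * frechet_derivative g (at (x + \<sigma> *\<^sub>R v + \<tau> *\<^sub>R w)) w)"
    using g by simp
  finally show ?thesis using \<sigma> \<tau> unfolding g_def by blast
qed

lemma symmetric_second_derivative_real:
  fixes f :: "'a::euclidean_space \<Rightarrow> real"
  assumes "open W" "x \<in> W" and f: "smooth_on W f"
  shows "frechet_derivative (\<lambda>y. frechet_derivative f (at y) v) (at x) w =
         frechet_derivative (\<lambda>y. frechet_derivative f (at y) w) (at x) v"
proof -
  define g where "g v w y = frechet_derivative (\<lambda>y. frechet_derivative f (at y) v) (at y) w" for v w y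
  have "continuous_on W (g v w)" for v w
    using smooth_on_imp_continuous_on[OF smooth_on_derivative[OF smooth_on_derivative[OF f]]]
    unfolding g_def .
  then have cont: "isCont (g v w) x" for v w
    using assms continuous_on_eq_continuous_at by blast
  have "\<bar>g v w x - g w v x\<bar> \<le> e" if "e > 0" for e
  proof -
    have "\<exists>d>0. \<forall>y. dist y x < d \<longrightarrow> dist (g v w y) (g v w x) < e/2" for v w
      using cont[of v w] \<open>e > 0\<close> unfolding continuous_at_eps_delta by (meson half_gt_zero)
    then obtain d1 d2 where d: "d1 > 0" "d2 > 0" 
      "\<And>y. dist y x < d1 \<Longrightarrow> dist (g v w y) (g v w x) < e/2"
      "\<And>y. dist y x < d2 \<Longrightarrow> dist (g w v y) (g w v x) < e/2" by metis
    obtain r where r: "r > 0" "ball x r \<subseteq> W" using assms openE by blast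
    define m where "m = min r (min d1 d2)"
    define h where "h = m / (2 * (norm v + norm w + 1))"
    have m: "m > 0" using r d by (simp add: m_def)
    have h: "h > 0" using m by (auto simp: h_def intro!: divide_pos_pos add_nonneg_pos)
    have "h * (norm v + norm w) \<le> h * (norm v + norm w + 1)" using h by simp
    also have "\<dots> = m / 2"
    proof -
      have "norm v + norm w + 1 > 0" by (simp add: add_nonneg_pos)
      then show ?thesis by (simp add: h_def field_simps)
    qed
    also have "\<dots> < m" using m by simp
    finally have hm: "h * (norm v + norm w) < m" .
    have close: "dist (x + \<sigma> *\<^sub>R v + \<tau> *\<^sub>R w) x < m" if "0 < \<sigma>" "\<sigma> < h" "0 < \<tau>" "\<tau> < h" for \<sigma> \<tau>
    proof -
      have "norm (\<sigma> *\<^sub>R v + \<tau> *\<^sub>R w) \<le> \<sigma> * norm v + \<tau> * norm w"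
        using norm_triangle_ineq[of "\<sigma> *\<^sub>R v" "\<tau> *\<^sub>R w"] that by simp
      also have "\<dots> \<le> h * norm v + h * norm w" using that by (intro add_mono mult_right_mono) auto
      finally show ?thesis using hm by (simp add: dist_norm distrib_left add.assoc)
    qed
    have fr: "smooth_on (ball x r) f" using f r smooth_on_subset by blast
    have hr: "h * (norm v + norm w) < r" "h * (norm w + norm v) < r"
      using hm by (auto simp: m_def add.commute)
    obtain s t where st: "0 < s" "s < h" "0 < t" "t < h" 
      "f (x + h *\<^sub>R v + h *\<^sub>R w) - f (x + h *\<^sub>R v) - f (x + h *\<^sub>R w) + f x = h * (h * g v w (x + s *\<^sub>R v + t *\<^sub>R w))"
      using second_difference[OF fr h hr(1)] unfolding g_def by blast
    obtain s' t' where st': "0 < s'" "s' < h" "0 < t'" "t' < h"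
      "f (x + h *\<^sub>R w + h *\<^sub>R v) - f (x + h *\<^sub>R w) - f (x + h *\<^sub>R v) + f x = h * (h * g w v (x + s' *\<^sub>R w + t' *\<^sub>R v))"
      using second_difference[OF fr h hr(2)] unfolding g_def by blast
    have "h * (h * g v w (x + s *\<^sub>R v + t *\<^sub>R w)) = h * (h * g w v (x + t' *\<^sub>R v + s' *\<^sub>R w))"
      using st(5) st'(5) by (simp add: algebra_simps)
    then have "g v w (x + s *\<^sub>R v + t *\<^sub>R w) = g w v (x + t' *\<^sub>R v + s' *\<^sub>R w)" using h by simp
    moreover have "dist (g v w (x + s *\<^sub>R v + t *\<^sub>R w)) (g v w x) < e/2"
      using close[OF st(1-4)] by (intro d(3)) (simp add: m_def)
    moreover have "dist (g w v (x + t' *\<^sub>R v + s' *\<^sub>R w)) (g w v x) < e/2"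
      using close[OF st'(3,4,1,2)] by (intro d(4)) (simp add: m_def)
    ultimately show ?thesis unfolding dist_real_def by linarith
  qed
  then have "\<bar>g v w x - g w v x\<bar> \<le> 0" by (rule field_le_epsilon) simp
  then show ?thesis by (simp add: g_def)
qed

lemma symmetric_second_derivative:
  fixes f :: "'a::euclidean_space \<Rightarrow> 'b::euclidean_space"
  assumes "open W" "x \<in> W" and f: "smooth_on W f"
  shows "frechet_derivative (\<lambda>y. frechet_derivative f (at y) v) (at x) w =
         frechet_derivative (\<lambda>y. frechet_derivative f (at y) w) (at x) v"
proof (rule euclidean_eqI)
  fix b :: 'b
  have 1: "frechet_derivative (\<lambda>y. f y \<bullet> b) (at y) v = frechet_derivative f (at y) v \<bullet> b"
    if "y \<in> W" for y v
    using frechet_derivative_eq_if_has_derivative[OF has_derivative_inner_left[OF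
        smooth_on_has_derivative[OF f that]], of b] by simp
  have 2: "frechet_derivative (\<lambda>y. frechet_derivative (\<lambda>y. f y \<bullet> b) (at y) v) (at x) w =
        frechet_derivative (\<lambda>y. frechet_derivative f (at y) v) (at x) w \<bullet> b" for v w
  proof -
    have "frechet_derivative (\<lambda>y. frechet_derivative (\<lambda>y. f y \<bullet> b) (at y) v) (at x) =
        frechet_derivative (\<lambda>y. frechet_derivative f (at y) v \<bullet> b) (at x)"
      using 1 by (intro frechet_derivative_cong_open[OF assms(1,2)]) simp
    then show ?thesis
      using frechet_derivative_eq_if_has_derivative[OF has_derivative_inner_left[OF
          smooth_on_has_derivative[OF smooth_on_derivative[OF f] assms(2)]], of v b] by simp
  qed
  have "smooth_on W (\<lambda>y. f y \<bullet> b)"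
    by (intro smooth_intros assms)
  from symmetric_second_derivative_real[OF assms(1,2) this, of v w]
  show "frechet_derivative (\<lambda>y. frechet_derivative f (at y) v) (at x) w \<bullet> b =
         frechet_derivative (\<lambda>y. frechet_derivative f (at y) w) (at x) v \<bullet> b"
    unfolding 2 .
qed

section \<open>Functions and 1-forms: pullback and exterior derivative\<close>

lemma linear_compose_fun: "linear L \<Longrightarrow> linear M \<Longrightarrow> linear (\<lambda>x. L (M x))"
  using linear_compose[of M L] by (simp add: o_def)

lemma length_1_iff: "length vs = Suc 0 \<longleftrightarrow> (\<exists>v. vs = [v])"
  by (auto simp: length_Suc_conv)

lemma length_2_iff: "length vs = Suc (Suc 0) \<longleftrightarrow> (\<exists>v w. vs = [v, w])"
  by (auto simp: length_Suc_conv)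

lemma smooth_form_on_0_iff: "smooth_form_on W 0 \<omega> \<longleftrightarrow> smooth_on W (\<lambda>x. \<omega> x [])"
  by (auto simp: smooth_form_on_def alternating_form_def)

lemma alternating_form_1_iff: "alternating_form (Suc 0) a \<longleftrightarrow> linear (\<lambda>v. a [v])"
proof
  assume "alternating_form (Suc 0) a"
  from conjunct1[OF this[unfolded alternating_form_def], rule_format, of "[0]" 0]
  show "linear (\<lambda>v. a [v])" by simp
qed (auto simp: alternating_form_def length_1_iff)

lemma smooth_form_on_1_iff:
  "smooth_form_on W (Suc 0) \<omega> \<longleftrightarrow>
     (\<forall>x\<in>W. linear (\<lambda>v. \<omega> x [v])) \<and> (\<forall>v. smooth_on W (\<lambda>x. \<omega> x [v]))"
  by (auto simp: smooth_form_on_def alternating_form_1_iff length_1_iff)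

lemma ext_deriv_0: "ext_deriv \<omega> x [v] = frechet_derivative (\<lambda>y. \<omega> y []) (at x) v"
  by (simp add: ext_deriv_def)

lemma ext_deriv_1:
  "ext_deriv \<omega> x [v, w] =
     frechet_derivative (\<lambda>y. \<omega> y [w]) (at x) v - frechet_derivative (\<lambda>y. \<omega> y [v]) (at x) w"
  by (simp add: ext_deriv_def lessThan_Suc)

lemma ext_deriv_1_cong:
  assumes "open W" "x \<in> W" "\<And>y v. y \<in> W \<Longrightarrow> \<alpha> y [v] = \<beta> y [v]"
  shows "ext_deriv \<alpha> x [v, w] = ext_deriv \<beta> x [v, w]"
  using frechet_derivative_cong_open[OF assms(1,2), of "\<lambda>y. \<alpha> y [z]" "\<lambda>y. \<beta> y [z]" for z] assms(3)
  by (simp add: ext_deriv_1)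

text \<open>The coefficients of a form are smooth for constant arguments only, so a moving argument is
  expanded in the standard basis.\<close>

lemma form_apply_eq_sum_Basis:
  assumes "linear (\<lambda>v. \<omega> [v])"
  shows "\<omega> [v] = (\<Sum>b\<in>Basis. (v \<bullet> b) *\<^sub>R (\<omega> [b] :: real))"
  using linear_eq_sum_Basis[OF assms] .

lemma smooth_on_form_apply:
  assumes \<omega>: "smooth_form_on W (Suc 0) \<omega>" and V: "open V" "h ` V \<subseteq> W"
    and h: "smooth_on V h" and k: "smooth_on V k"
  shows "smooth_on V (\<lambda>y. \<omega> (h y) [k y])"
proof (rule smooth_on_cong[OF V(1)])
  show "(\<Sum>b\<in>Basis. (k y \<bullet> b) *\<^sub>R \<omega> (h y) [b]) = \<omega> (h y) [k y]" if "y \<in> V" for y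
    using \<omega> V that by (intro form_apply_eq_sum_Basis[symmetric]) (auto simp: smooth_form_on_1_iff)
  have "smooth_on V (\<lambda>y. \<omega> (h y) [b])" for b
    using \<omega> by (intro smooth_on_compose[OF V h]) (auto simp: smooth_form_on_1_iff)
  then show "smooth_on V (\<lambda>y. \<Sum>b\<in>Basis. (k y \<bullet> b) *\<^sub>R \<omega> (h y) [b])"
    by (intro smooth_on_sum smooth_intros V k)
qed

lemma derivative_form_apply:
  assumes \<omega>: "smooth_form_on W (Suc 0) \<omega>" and W: "open W" and V: "open V" "h ` V \<subseteq> W"
    and h: "smooth_on V h" and k: "smooth_on V k" and u: "u \<in> V"
  shows "frechet_derivative (\<lambda>y. \<omega> (h y) [k y]) (at u) v =
    frechet_derivative (\<lambda>x. \<omega> x [k u]) (at (h u)) (frechet_derivative h (at u) v) +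
    \<omega> (h u) [frechet_derivative k (at u) v]"
proof -
  have lin: "\<omega> x [w] = (\<Sum>b\<in>Basis. (w \<bullet> b) *\<^sub>R \<omega> x [b])" if "x \<in> W" for x w
    using \<omega> that by (intro form_apply_eq_sum_Basis) (auto simp: smooth_form_on_1_iff)
  have hu: "h u \<in> W" using V u by auto
  let ?D = "\<lambda>w. frechet_derivative (\<lambda>x. \<omega> x [w]) (at (h u))"
  let ?h' = "frechet_derivative h (at u)" and ?k' = "frechet_derivative k (at u)"
  have D\<omega>: "((\<lambda>x. \<omega> x [w]) has_derivative ?D w) (at (h u))" for w
    using \<omega> hu by (intro smooth_on_has_derivative[of W]) (auto simp: smooth_form_on_1_iff)
  have "((\<lambda>x. \<Sum>b\<in>Basis. (k u \<bullet> b) *\<^sub>R \<omega> x [b]) has_derivative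
      (\<lambda>z. \<Sum>b\<in>Basis. (k u \<bullet> b) *\<^sub>R ?D b z)) (at (h u))"
    by (intro has_derivative_sum has_derivative_scaleR_right D\<omega>)
  then have "((\<lambda>x. \<omega> x [k u]) has_derivative (\<lambda>z. \<Sum>b\<in>Basis. (k u \<bullet> b) *\<^sub>R ?D b z)) (at (h u))"
    by (rule has_derivative_transform_within_open[OF _ W hu]) (simp add: lin)
  then have D_sum: "?D (k u) z = (\<Sum>b\<in>Basis. (k u \<bullet> b) *\<^sub>R ?D b z)" for z
    by (simp add: frechet_derivative_eq_if_has_derivative)
  have D\<omega>h: "((\<lambda>y. \<omega> (h y) [b]) has_derivative (\<lambda>z. ?D b (?h' z))) (at u)" for b
    by (rule has_derivative_compose[OF smooth_on_has_derivative[OF h u] D\<omega>])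
  have "((\<lambda>y. \<Sum>b\<in>Basis. (k y \<bullet> b) *\<^sub>R \<omega> (h y) [b]) has_derivative
      (\<lambda>z. \<Sum>b\<in>Basis. (k u \<bullet> b) *\<^sub>R ?D b (?h' z) + (?k' z \<bullet> b) *\<^sub>R \<omega> (h u) [b])) (at u)"
    by (intro has_derivative_sum has_derivative_scaleR has_derivative_inner_left
        smooth_on_has_derivative[OF k u] D\<omega>h)
  then have "((\<lambda>y. \<omega> (h y) [k y]) has_derivative
      (\<lambda>z. \<Sum>b\<in>Basis. (k u \<bullet> b) *\<^sub>R ?D b (?h' z) + (?k' z \<bullet> b) *\<^sub>R \<omega> (h u) [b])) (at u)"
    by (rule has_derivative_transform_within_open[OF _ V(1) u]) (use V lin in auto)
  then show ?thesis
    by (simp add: frechet_derivative_eq_if_has_derivative sum.distrib D_sum lin[OF hu, of "?k' v"])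
qed

lemma smooth_form_on_pullback:
  assumes \<omega>: "smooth_form_on W (Suc 0) \<omega>" and V: "open V" "h ` V \<subseteq> W" and h: "smooth_on V h"
  shows "smooth_form_on V (Suc 0) (pullback h \<omega>)"
  unfolding smooth_form_on_1_iff
proof (intro conjI ballI allI)
  fix u assume u: "u \<in> V"
  have "linear (\<lambda>v. \<omega> (h u) [v])" using \<omega> V u by (auto simp: smooth_form_on_1_iff)
  from linear_compose_fun[OF this linear_frechet_derivative[OF smooth_on_differentiable[OF h u]]]
  show "linear (\<lambda>v. pullback h \<omega> u [v])" by (simp add: pullback_def)
next
  fix v
  show "smooth_on V (\<lambda>x. pullback h \<omega> x [v])"
    using smooth_on_form_apply[OF \<omega> V h smooth_on_derivative[OF h]] by (simp add: pullback_def)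
qed

text \<open>The terms in which the second derivative of the map occurs cancel by Schwarz's theorem.\<close>

lemma ext_deriv_pullback:
  assumes \<omega>: "smooth_form_on W (Suc 0) \<omega>" and W: "open W" and V: "open V" "h ` V \<subseteq> W"
    and h: "smooth_on V h" and u: "u \<in> V"
  shows "ext_deriv (pullback h \<omega>) u [v, w] =
    ext_deriv \<omega> (h u) [frechet_derivative h (at u) v, frechet_derivative h (at u) w]"
  using symmetric_second_derivative[OF V(1) u h, of v w]
  by (simp add: ext_deriv_1 pullback_def
      derivative_form_apply[OF \<omega> W V h smooth_on_derivative[OF h] u])

lemma smooth_on_line: "smooth_on W (\<lambda>t::real. p + t *\<^sub>R w)"
proof -
  have "smooth_on UNIV (\<lambda>t::real. p + t *\<^sub>R w)" by (intro smooth_intros open_UNIV)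
  then show ?thesis using smooth_on_subset by blast
qed

lemma has_vector_derivative_along_line:
  assumes "h differentiable (at u)"
  shows "((\<lambda>t. h (u + t *\<^sub>R w)) has_vector_derivative frechet_derivative h (at u) w) (at 0)"
proof -
  have "((\<lambda>t::real. u + t *\<^sub>R w) has_derivative (\<lambda>t. t *\<^sub>R w)) (at 0)"
    by (auto intro!: derivative_eq_intros)
  moreover have "(h has_derivative frechet_derivative h (at u)) (at (u + 0 *\<^sub>R w))"
    using has_derivative_frechet[OF assms] by simp
  ultimately have "((\<lambda>t. h (u + t *\<^sub>R w)) has_derivative (\<lambda>t. frechet_derivative h (at u) (t *\<^sub>R w))) (at 0)"
    by (rule has_derivative_compose)
  then show ?thesis
    by (simp add: has_vector_derivative_def linear_cmul[OF linear_frechet_derivative[OF assms]])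
qed

lemma tangent_space_image:
  assumes V: "open V" and h: "smooth_on V h" "h ` V \<subseteq> X" and u: "u \<in> V"
  shows "frechet_derivative h (at u) w \<in> tangent_space X (h u)"
proof -
  obtain e where e: "e > 0" "ball u e \<subseteq> V" using V u openE by blast
  define \<delta> where "\<delta> = e / (norm w + 1)"
  have \<delta>: "\<delta> > 0" using e by (simp add: \<delta>_def add_nonneg_pos)
  have line: "u + t *\<^sub>R w \<in> V" if t: "t \<in> {-\<delta><..<\<delta>}" for t
  proof -
    have "norm (t *\<^sub>R w) \<le> \<bar>t\<bar> * (norm w + 1)" by (simp add: mult_left_mono)
    also have "\<dots> < \<delta> * (norm w + 1)" using t by (intro mult_strict_right_mono) (auto simp: add_nonneg_pos)
    also have "\<dots> = e"
    proof -
      have "norm w + 1 \<noteq> 0" by (smt (verit) norm_ge_zero)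
      then show ?thesis by (simp add: \<delta>_def)
    qed
    finally have "u + t *\<^sub>R w \<in> ball u e" by (simp add: dist_norm)
    then show ?thesis using e by blast
  qed
  then have "smooth_on {-\<delta><..<\<delta>} (\<lambda>t. h (u + t *\<^sub>R w))"
    by - (rule smooth_on_compose[OF _ _ smooth_on_line h(1)], auto)
  moreover have "(\<lambda>t. h (u + t *\<^sub>R w)) ` {-\<delta><..<\<delta>} \<subseteq> X"
    using line h(2) by blast
  ultimately show ?thesis
    unfolding tangent_space_def
    using \<delta> has_vector_derivative_along_line[OF smooth_on_differentiable[OF h(1) u], of w]
    by (intro CollectI exI[of _ "\<lambda>t. h (u + t *\<^sub>R w)"] exI[of _ \<delta>]) simp
qed

section \<open>Pullback of forms from an embedded submanifold\<close>

lemma open_preimage: "open V \<Longrightarrow> smooth_on V h \<Longrightarrow> open W \<Longrightarrow> open (V \<inter> h -` W)"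
  by (intro continuous_open_preimage smooth_on_imp_continuous_on)

text \<open>A form on the submanifold agrees with a smooth ambient form only locally and only on tangent
  vectors. Both suffice, as the derivative of a map into the submanifold has tangent values.\<close>

lemma pullback_smooth_form_1:
  assumes \<eta>: "smooth_form X (Suc 0) \<eta>" and V: "open V" and h: "smooth_on V h" "h ` V \<subseteq> X"
  shows "smooth_form_on V (Suc 0) (pullback h \<eta>)"
proof -
  have loc: "\<exists>V'. open V' \<and> u \<in> V' \<and> V' \<subseteq> V \<and> (\<exists>\<omega>. smooth_form_on V' (Suc 0) \<omega> \<and>
      (\<forall>y\<in>V'. \<forall>v. pullback h \<eta> y [v] = \<omega> y [v]))" if u: "u \<in> V" for u
  proof -
    have "h u \<in> X" using h(2) u by blast
    then obtain W \<omega> where W: "open W" "h u \<in> W" and \<omega>: "smooth_form_on W (Suc 0) \<omega>"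
      and eq: "\<forall>q\<in>X \<inter> W. \<forall>vs. length vs = Suc 0 \<and> set vs \<subseteq> tangent_space X q \<longrightarrow> \<eta> q vs = \<omega> q vs"
      using bspec[OF \<eta>[unfolded smooth_form_def]] by metis
    define V' where "V' = V \<inter> h -` W"
    have V': "open V'" "u \<in> V'" "V' \<subseteq> V"
      using open_preimage[OF V h(1) W(1)] u W by (auto simp: V'_def)
    have "smooth_form_on V' (Suc 0) (pullback h \<omega>)"
      using smooth_on_subset[OF h(1) V'(3)]
      by (intro smooth_form_on_pullback[OF \<omega> V'(1)]) (auto simp: V'_def)
    moreover have "pullback h \<eta> y [v] = pullback h \<omega> y [v]" if "y \<in> V'" for y v
      using eq tangent_space_image[OF V h] that h(2) by (auto simp: V'_def pullback_def)
    ultimately show ?thesis using V' by blast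
  qed
  show ?thesis unfolding smooth_form_on_1_iff
  proof (intro conjI ballI allI smooth_on_locally)
    fix u assume "u \<in> V"
    from loc[OF this] obtain V' \<omega> where "u \<in> V'" "smooth_form_on V' (Suc 0) \<omega>"
      "\<forall>y\<in>V'. \<forall>v. pullback h \<eta> y [v] = \<omega> y [v]" by metis
    then show "linear (\<lambda>v. pullback h \<eta> u [v])"
      by (simp add: smooth_form_on_1_iff)
  next
    fix v u assume "u \<in> V"
    from loc[OF this] obtain V' \<omega> where V': "open V'" "u \<in> V'" "smooth_form_on V' (Suc 0) \<omega>"
      "\<forall>y\<in>V'. \<forall>v. pullback h \<eta> y [v] = \<omega> y [v]" by metis
    then have "smooth_on V' (\<lambda>y. pullback h \<eta> y [v])"
      by - (rule smooth_on_cong[of V' "\<lambda>y. \<omega> y [v]"], auto simp: smooth_form_on_1_iff)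
    with V' show "\<exists>V'. open V' \<and> u \<in> V' \<and> smooth_on V' (\<lambda>y. pullback h \<eta> y [v])" by blast
  qed
qed

lemma pullback_smooth_form_0:
  assumes \<eta>: "smooth_form X 0 \<eta>" and V: "open V" and h: "smooth_on V h" "h ` V \<subseteq> X"
  shows "smooth_form_on V 0 (pullback h \<eta>)"
  unfolding smooth_form_on_0_iff
proof (intro smooth_on_locally)
  fix u assume u: "u \<in> V"
  have "h u \<in> X" using h(2) u by blast
  then obtain W \<omega> where W: "open W" "h u \<in> W" and \<omega>: "smooth_form_on W 0 \<omega>"
    and eq: "\<forall>q\<in>X \<inter> W. \<forall>vs. length vs = 0 \<and> set vs \<subseteq> tangent_space X q \<longrightarrow> \<eta> q vs = \<omega> q vs"
    using bspec[OF \<eta>[unfolded smooth_form_def]] by metis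
  have V': "open (V \<inter> h -` W)" using open_preimage[OF V h(1) W(1)] .
  have "smooth_on (V \<inter> h -` W) (\<lambda>y. \<omega> (h y) [])"
    using \<omega> smooth_on_subset[OF h(1), of "V \<inter> h -` W"]
    by - (rule smooth_on_compose[OF V', of h W], auto simp: smooth_form_on_0_iff)
  then have "smooth_on (V \<inter> h -` W) (\<lambda>y. pullback h \<eta> y [])"
    by (rule smooth_on_cong[OF V', rotated]) (use eq h(2) in \<open>auto simp: pullback_def\<close>)
  then show "\<exists>V. open V \<and> u \<in> V \<and> smooth_on V (\<lambda>y. pullback h \<eta> y [])"
    using V' u W by blast
qed

lemma pullback_has_ext_deriv_0:
  assumes d: "has_ext_deriv X 0 \<eta> \<xi>" and V: "open V" and h: "smooth_on V h" "h ` V \<subseteq> X" and u: "u \<in> V"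
  shows "pullback h \<xi> u [w] = ext_deriv (pullback h \<eta>) u [w]"
proof -
  have "h u \<in> X" using h(2) u by blast
  then obtain W \<omega> where W: "open W" "h u \<in> W" and \<omega>: "smooth_form_on W 0 \<omega>"
    and eq: "\<forall>q\<in>X \<inter> W. \<forall>vs. length vs = 0 \<and> set vs \<subseteq> tangent_space X q \<longrightarrow> \<eta> q vs = \<omega> q vs"
    and d: "\<forall>q\<in>X \<inter> W. \<forall>vs. length vs = Suc 0 \<and> set vs \<subseteq> tangent_space X q \<longrightarrow> \<xi> q vs = ext_deriv \<omega> q vs"
    using bspec[OF d[unfolded has_ext_deriv_def]] by metis
  have "pullback h \<xi> u [w] = ext_deriv \<omega> (h u) [frechet_derivative h (at u) w]"
    using d W u h(2) tangent_space_image[OF V h u] by (auto simp: pullback_def)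
  also have "\<dots> = frechet_derivative (\<lambda>y. \<omega> (h y) []) (at u) w"
    using \<omega> W smooth_on_has_derivative[OF h(1) u]
    by (subst frechet_derivative_eq_if_has_derivative[OF has_derivative_compose])
       (auto simp: ext_deriv_0 smooth_form_on_0_iff intro: smooth_on_has_derivative)
  also have "\<dots> = ext_deriv (pullback h \<eta>) u [w]"
    unfolding ext_deriv_0
    by (subst frechet_derivative_cong_open[of "V \<inter> h -` W" u _ "\<lambda>y. pullback h \<eta> y []"])
       (use open_preimage[OF V h(1) W(1)] u W eq h(2) in \<open>auto simp: pullback_def\<close>)
  finally show ?thesis .
qed

text \<open>In degree at most one the differential ideal is reached from its generators of degree at most
  one: a wedge product of degree at most one has factors of degree at most one, and the exterior
  derivatives of degree at most one are those of elements of degree zero. For \<open>\<E>\<close> the only such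
  generator is \<open>\<theta>\<^sup>0\<close>, which a legendrian map pulls back to zero.\<close>

lemma pullback_diff_ideal_vanishes:
  assumes "diff_ideal X \<G> k \<omega>" and V: "open V" and h: "smooth_on V h" "h ` V \<subseteq> X"
    and gen: "\<And>k \<omega> u ws. (k, \<omega>) \<in> \<G> \<Longrightarrow> k \<le> 1 \<Longrightarrow> u \<in> V \<Longrightarrow> length ws = k \<Longrightarrow> pullback h \<omega> u ws = 0"
    and "k \<le> 1" "u \<in> V" "length ws = k"
  shows "pullback h \<omega> u ws = 0"
  using assms(1,6-)
proof (induction arbitrary: u ws rule: diff_ideal.induct)
  case (generator k \<omega>)
  then show ?case using gen by blast
next
  case (zero k)
  show ?case by (simp add: pullback_def)
next
  case (add k \<alpha> \<beta>)
  then show ?case by (simp add: pullback_def)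
next
  case (wedge_left k \<alpha> l \<beta>)
  have "\<beta> (h u) (drop k (permute_list p (map (frechet_derivative h (at u)) ws))) = 0"
    if "p permutes {..<k + l}" for p
    using wedge_left.IH[of u "drop k (permute_list p ws)"] wedge_left.prems that
    by (simp add: pullback_def permute_list_map drop_map)
  then show ?case by (simp add: pullback_def wedge_def)
next
  case (wedge_right k \<alpha> l \<beta>)
  have "\<alpha> (h u) (take k (permute_list p (map (frechet_derivative h (at u)) ws))) = 0"
    if "p permutes {..<k + l}" for p
    using wedge_right.IH[of u "take k (permute_list p ws)"] wedge_right.prems that
    by (simp add: pullback_def permute_list_map take_map)
  then show ?case by (simp add: pullback_def wedge_def)
next
  case (deriv k \<omega> \<eta>)
  then have k: "k = 0" by simp
  then obtain w where ws: "ws = [w]" using deriv.prems by (auto simp: length_1_iff)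
  have "frechet_derivative (\<lambda>y. pullback h \<omega> y []) (at u) = frechet_derivative (\<lambda>y. 0) (at u)"
    using deriv.IH[of _ "[]"] k by (intro frechet_derivative_cong_open[OF V deriv.prems(2)]) auto
  then show ?case
    using pullback_has_ext_deriv_0[OF _ V h deriv.prems(2)] deriv.hyps(2) k
    by (simp add: ws ext_deriv_0)
next
  case (eq k \<alpha> \<beta>)
  have "pullback h \<beta> u ws = pullback h \<alpha> u ws"
    using eq.hyps(2) eq.prems h(2) tangent_space_image[OF V h eq.prems(2)]
    unfolding form_eq_def pullback_def
    by (metis (no_types, lifting) imageE image_subset_iff length_map list.set_map subsetI)
  then show ?case using eq by simp
qed

section \<open>Forms and cohomology of a surface\<close>

lemma surface_chart_open: "oriented_surface \<Sigma> A \<Longrightarrow> c \<in> A \<Longrightarrow> open (fst c)"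
  by (simp add: oriented_surface_def)

lemma surface_chart_in: "oriented_surface \<Sigma> A \<Longrightarrow> c \<in> A \<Longrightarrow> u \<in> fst c \<Longrightarrow> snd c u \<in> topspace \<Sigma>"
  unfolding oriented_surface_def by blast

lemma surface_overlap_open:
  assumes "oriented_surface \<Sigma> A" "c \<in> A" "c' \<in> A"
  shows "open (overlap c c')"
proof -
  have "continuous_map (top_of_set (fst c)) (subtopology \<Sigma> (snd c ` fst c)) (snd c)"
    and o: "open (fst c)" and o': "openin \<Sigma> (snd c' ` fst c')"
    using assms unfolding oriented_surface_def by (auto dest: homeomorphic_imp_continuous_map)
  then have "continuous_map (top_of_set (fst c)) \<Sigma> (snd c)"
    by (simp add: continuous_map_in_subtopology)
  then have "openin (top_of_set (fst c)) {u \<in> topspace (top_of_set (fst c)). snd c u \<in> snd c' ` fst c'}"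
    using o' by (rule openin_continuous_map_preimage)
  then show ?thesis
    using o by (simp add: overlap_def openin_open_eq)
qed

lemma transition_in: "u \<in> overlap c c' \<Longrightarrow> transition c c' u \<in> fst c'"
  by (simp add: overlap_def transition_def inv_into_into)

lemma transition_point: "u \<in> overlap c c' \<Longrightarrow> snd c' (transition c c' u) = snd c u"
  by (simp add: overlap_def transition_def f_inv_into_f)

lemma surface_pullback_transition:
  assumes S: "oriented_surface \<Sigma> A" and c: "c \<in> A" "c' \<in> A" and u: "u \<in> overlap c c'"
    and N: "surface_smooth A N"
  shows "surface_pullback N \<eta> c u ws = pullback (transition c c') (surface_pullback N \<eta> c') u ws"
proof -
  let ?t = "transition c c'"
  have t: "smooth_on (overlap c c') ?t" using S c unfolding oriented_surface_def by blast
  have N': "smooth_on (fst c') (N \<circ> snd c')" using N c by (simp add: surface_smooth_def)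
  have "((\<lambda>y. (N \<circ> snd c') (?t y)) has_derivative
      (\<lambda>w. frechet_derivative (N \<circ> snd c') (at (?t u)) (frechet_derivative ?t (at u) w))) (at u)"
    by (rule has_derivative_compose[OF smooth_on_has_derivative[OF t u]
        smooth_on_has_derivative[OF N' transition_in[OF u]]])
  moreover have "frechet_derivative (N \<circ> snd c) (at u) = frechet_derivative (\<lambda>y. (N \<circ> snd c') (?t y)) (at u)"
    by (rule frechet_derivative_cong_open[OF surface_overlap_open[OF S c] u])
       (simp add: transition_point)
  ultimately have "frechet_derivative (N \<circ> snd c) (at u) =
      (\<lambda>w. frechet_derivative (N \<circ> snd c') (at (?t u)) (frechet_derivative ?t (at u) w))"
    by (simp add: frechet_derivative_eq_if_has_derivative)
  then show ?thesis
    by (simp add: surface_pullback_def pullback_def transition_point[OF u] o_def)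
qed

lemma smooth_surface_form_pullback:
  assumes S: "oriented_surface \<Sigma> A" and N: "surface_smooth A N" "N ` topspace \<Sigma> \<subseteq> X"
    and \<eta>: "smooth_form X k \<eta>" "k \<le> 1"
  shows "smooth_surface_form A k (surface_pullback N \<eta>)"
proof -
  have "smooth_form_on (fst c) k (surface_pullback N \<eta> c)" if c: "c \<in> A" for c
  proof -
    note h = surface_chart_open[OF S c]
    have h': "smooth_on (fst c) (N \<circ> snd c)" "(N \<circ> snd c) ` fst c \<subseteq> X"
      using N c surface_chart_in[OF S c] by (auto simp: surface_smooth_def)
    consider "k = 0" | "k = Suc 0" using \<eta>(2) by linarith
    then show ?thesis
      using \<eta>(1) pullback_smooth_form_0[OF _ h h'] pullback_smooth_form_1[OF _ h h']
      unfolding surface_pullback_def by cases blast+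
  qed
  then show ?thesis
    using surface_pullback_transition[OF S _ _ _ N(1)] unfolding smooth_surface_form_def by blast
qed

lemma smooth_surface_form_cong:
  assumes S: "oriented_surface \<Sigma> A" and \<alpha>: "smooth_surface_form A k \<alpha>" and eq: "surface_form_eq A k \<alpha> \<beta>"
  shows "smooth_surface_form A k \<beta>"
  unfolding smooth_surface_form_def
proof (intro conjI ballI allI impI)
  fix c assume c: "c \<in> A"
  have e: "\<beta> c u ws = \<alpha> c u ws" if "u \<in> fst c" "length ws = k" for u ws
    using eq c that by (simp add: surface_form_eq_def)
  have "smooth_form_on (fst c) k (\<alpha> c)" using \<alpha> c by (simp add: smooth_surface_form_def)
  then show "smooth_form_on (fst c) k (\<beta> c)"
    using smooth_on_cong[OF surface_chart_open[OF S c], of "\<lambda>x. \<alpha> c x ws" "\<lambda>x. \<beta> c x ws" for ws] e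
    unfolding smooth_form_on_def alternating_form_def by simp
next
  fix c c' u and ws :: "(real^2) list"
  assume c: "c \<in> A" "c' \<in> A" "u \<in> overlap c c'" "length ws = k"
  moreover have "u \<in> fst c" using c by (simp add: overlap_def)
  moreover have "\<alpha> c u ws = pullback (transition c c') (\<alpha> c') u ws"
    using \<alpha> c unfolding smooth_surface_form_def by blast
  ultimately show "\<beta> c u ws = pullback (transition c c') (\<beta> c') u ws"
    using eq transition_in[of u c c'] by (simp add: surface_form_eq_def pullback_def)
qed

text \<open>The relation \<open>d d h = 0\<close> behind this is Schwarz's theorem in a chart.\<close>

lemma closed_1forms_add_exact:
  assumes S: "oriented_surface \<Sigma> A" and \<alpha>: "\<alpha> \<in> closed_1forms A"
    and \<beta>: "smooth_surface_form A 1 \<beta>" and h: "smooth_surface_form A 0 h"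
    and eq: "surface_form_eq A 1 (\<lambda>c u ws. \<beta> c u ws - \<alpha> c u ws) (surface_ext_deriv h)"
  shows "\<beta> \<in> closed_1forms A"
proof -
  have "ext_deriv (\<beta> c) u [v, w] = 0" if c: "c \<in> A" and u: "u \<in> fst c" for c u v w
  proof -
    note o = surface_chart_open[OF S c]
    let ?h = "\<lambda>y. h c y []"
    have h': "smooth_on (fst c) ?h" using h c by (simp add: smooth_surface_form_def smooth_form_on_0_iff)
    have e: "\<beta> c y [z] = \<alpha> c y [z] + frechet_derivative ?h (at y) z" if "y \<in> fst c" for y z
      using eq c that by (auto simp: surface_form_eq_def surface_ext_deriv_def ext_deriv_0 diff_eq_eq)
    have \<alpha>': "smooth_on (fst c) (\<lambda>y. \<alpha> c y [z])" for z
      using \<alpha> c by (simp add: closed_1forms_def smooth_surface_form_def smooth_form_on_1_iff)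
    have D: "frechet_derivative (\<lambda>y. \<beta> c y [z]) (at u) = (\<lambda>x. frechet_derivative (\<lambda>y. \<alpha> c y [z]) (at u) x
        + frechet_derivative (\<lambda>y. frechet_derivative ?h (at y) z) (at u) x)" for z
    proof (rule frechet_derivative_eq_if_has_derivative)
      have "((\<lambda>y. \<alpha> c y [z] + frechet_derivative ?h (at y) z) has_derivative
        (\<lambda>x. frechet_derivative (\<lambda>y. \<alpha> c y [z]) (at u) x
        + frechet_derivative (\<lambda>y. frechet_derivative ?h (at y) z) (at u) x)) (at u)"
        using smooth_on_has_derivative[OF \<alpha>' u] smooth_on_has_derivative[OF smooth_on_derivative[OF h'] u]
        by (intro has_derivative_add)
      then show "((\<lambda>y. \<beta> c y [z]) has_derivative (\<lambda>x. frechet_derivative (\<lambda>y. \<alpha> c y [z]) (at u) x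
        + frechet_derivative (\<lambda>y. frechet_derivative ?h (at y) z) (at u) x)) (at u)"
        by (rule has_derivative_transform_within_open[OF _ o u]) (simp add: e)
    qed
    have "ext_deriv (\<alpha> c) u [v, w] = 0"
      using \<alpha> c u by (simp add: closed_1forms_def surface_form_eq_def surface_ext_deriv_def)
    then show ?thesis
      using symmetric_second_derivative[OF o u h', of v w] by (simp add: ext_deriv_1 D)
  qed
  then show ?thesis
    using \<beta> by (auto simp: closed_1forms_def surface_form_eq_def surface_ext_deriv_def numeral_2_eq_2 length_2_iff)
qed

lemma smooth_surface_form_zero: "smooth_surface_form A 0 (\<lambda>c u ws. 0)"
  by (simp add: smooth_surface_form_def smooth_form_on_0_iff smooth_on_const pullback_def)

lemma cohomologous_if_eq:
  assumes S: "oriented_surface \<Sigma> A" and \<alpha>: "\<alpha> \<in> closed_1forms A" and eq: "surface_form_eq A 1 \<alpha> \<beta>"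
  shows "(\<alpha>, \<beta>) \<in> cohomologous A"
proof -
  have e: "surface_form_eq A 1 (\<lambda>c u ws. \<beta> c u ws - \<alpha> c u ws) (surface_ext_deriv (\<lambda>c u ws. 0))"
    using eq by (auto simp: surface_form_eq_def surface_ext_deriv_def length_1_iff ext_deriv_0)
  have "smooth_surface_form A 1 \<beta>"
    using \<alpha> smooth_surface_form_cong[OF S _ eq] by (simp add: closed_1forms_def)
  then have "\<beta> \<in> closed_1forms A"
    using closed_1forms_add_exact[OF S \<alpha> _ smooth_surface_form_zero e] by blast
  then show ?thesis
    using \<alpha> e smooth_surface_form_zero unfolding cohomologous_def by blast
qed

lemma smooth_surface_form_0_linear_combination:
  assumes S: "oriented_surface \<Sigma> A" and "smooth_surface_form A 0 h" "smooth_surface_form A 0 k"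
  shows "smooth_surface_form A 0 (\<lambda>c u ws. a * h c u ws + b * k c u ws)"
    "surface_form_eq A 1 (surface_ext_deriv (\<lambda>c u ws. a * h c u ws + b * k c u ws))
      (\<lambda>c u ws. a * surface_ext_deriv h c u ws + b * surface_ext_deriv k c u ws)"
proof -
  have sm: "smooth_on (fst c) (\<lambda>y. h c y [])" "smooth_on (fst c) (\<lambda>y. k c y [])" if "c \<in> A" for c
    using assms that by (auto simp: smooth_surface_form_def smooth_form_on_0_iff)
  then have "smooth_on (fst c) (\<lambda>y. a * h c y [] + b * k c y [])" if "c \<in> A" for c
    using that by (intro smooth_intros surface_chart_open[OF S])
  then show "smooth_surface_form A 0 (\<lambda>c u ws. a * h c u ws + b * k c u ws)"
    using assms by (simp add: smooth_surface_form_def smooth_form_on_0_iff pullback_def)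
  have "frechet_derivative (\<lambda>y. a * h c y [] + b * k c y []) (at u) =
      (\<lambda>w. a * frechet_derivative (\<lambda>y. h c y []) (at u) w + b * frechet_derivative (\<lambda>y. k c y []) (at u) w)"
    if "c \<in> A" "u \<in> fst c" for c u
    using sm[OF that(1)] that(2)
    by (intro frechet_derivative_eq_if_has_derivative has_derivative_add has_derivative_mult_right
        smooth_on_has_derivative)
  then show "surface_form_eq A 1 (surface_ext_deriv (\<lambda>c u ws. a * h c u ws + b * k c u ws))
      (\<lambda>c u ws. a * surface_ext_deriv h c u ws + b * surface_ext_deriv k c u ws)"
    by (auto simp: surface_form_eq_def surface_ext_deriv_def length_1_iff ext_deriv_0)
qed

lemma equiv_cohomologous:
  assumes S: "oriented_surface \<Sigma> A"
  shows "equiv (closed_1forms A) (cohomologous A)"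
proof (rule equivI)
  show "cohomologous A \<subseteq> closed_1forms A \<times> closed_1forms A"
    by (auto simp: cohomologous_def)
  show "refl_on (closed_1forms A) (cohomologous A)"
    using cohomologous_if_eq[OF S] by (auto simp: refl_on_def surface_form_eq_def cohomologous_def)
  show "sym (cohomologous A)"
  proof (rule symI)
    fix \<alpha> \<beta> assume "(\<alpha>, \<beta>) \<in> cohomologous A"
    then obtain h where h: "\<alpha> \<in> closed_1forms A" "\<beta> \<in> closed_1forms A" "smooth_surface_form A 0 h"
      "surface_form_eq A 1 (\<lambda>c u ws. \<beta> c u ws - \<alpha> c u ws) (surface_ext_deriv h)"
      by (auto simp: cohomologous_def)
    have e: "surface_form_eq A 1 (\<lambda>c u ws. \<alpha> c u ws - \<beta> c u ws) (surface_ext_deriv (\<lambda>c u ws. - h c u ws))"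
      using h(4) smooth_surface_form_0_linear_combination(2)[OF S h(3,3), of "-1" 0]
      by (simp add: surface_form_eq_def) (metis minus_diff_eq)
    then show "(\<beta>, \<alpha>) \<in> cohomologous A"
      using h smooth_surface_form_0_linear_combination(1)[OF S h(3,3), of "-1" 0]
      unfolding cohomologous_def by auto
  qed
  show "trans (cohomologous A)"
  proof (rule transI)
    fix \<alpha> \<beta> \<gamma> assume "(\<alpha>, \<beta>) \<in> cohomologous A" "(\<beta>, \<gamma>) \<in> cohomologous A"
    then obtain h k where h: "\<alpha> \<in> closed_1forms A" "\<gamma> \<in> closed_1forms A" "smooth_surface_form A 0 h"
      "smooth_surface_form A 0 k"
      "surface_form_eq A 1 (\<lambda>c u ws. \<beta> c u ws - \<alpha> c u ws) (surface_ext_deriv h)"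
      "surface_form_eq A 1 (\<lambda>c u ws. \<gamma> c u ws - \<beta> c u ws) (surface_ext_deriv k)"
      by (auto simp: cohomologous_def)
    have e: "surface_form_eq A 1 (\<lambda>c u ws. \<gamma> c u ws - \<alpha> c u ws)
        (surface_ext_deriv (\<lambda>c u ws. h c u ws + k c u ws))"
      using h(5,6) smooth_surface_form_0_linear_combination(2)[OF S h(3,4), of 1 1]
      by (simp add: surface_form_eq_def) (smt (verit))
    then show "(\<alpha>, \<gamma>) \<in> cohomologous A"
      using h smooth_surface_form_0_linear_combination(1)[OF S h(3,4), of 1 1]
      unfolding cohomologous_def by auto
  qed
qed

section \<open>Linear algebra of the metric\<close>

lemma rinner_simps:
  "rinner G x (u + v) w = rinner G x u w + rinner G x v w"
  "rinner G x w (u + v) = rinner G x w u + rinner G x w v"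
  "rinner G x (u - v) w = rinner G x u w - rinner G x v w"
  "rinner G x w (u - v) = rinner G x w u - rinner G x w v"
  "rinner G x (- u) w = - rinner G x u w"
  "rinner G x w (- u) = - rinner G x w u"
  "rinner G x (k *\<^sub>R u) w = k * rinner G x u w"
  "rinner G x w (k *\<^sub>R u) = k * rinner G x w u"
  "rinner G x 0 w = 0" "rinner G x w 0 = 0"
proof -
  note l = matrix_vector_mul_linear[of "G x"]
  note l' = linear_add[OF l] linear_diff[OF l] linear_neg[OF l] linear_cmul[OF l] linear_0[OF l]
  show "rinner G x (u + v) w = rinner G x u w + rinner G x v w"
    "rinner G x w (u + v) = rinner G x w u + rinner G x w v"
    "rinner G x (u - v) w = rinner G x u w - rinner G x v w"
    "rinner G x w (u - v) = rinner G x w u - rinner G x w v"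
    "rinner G x (- u) w = - rinner G x u w"
    "rinner G x w (- u) = - rinner G x w u"
    "rinner G x (k *\<^sub>R u) w = k * rinner G x u w"
    "rinner G x w (k *\<^sub>R u) = k * rinner G x w u"
    "rinner G x 0 w = 0" "rinner G x w 0 = 0"
    by (simp_all add: rinner_def inner_simps l')
qed

lemma rinner_commute:
  assumes "riemannian_metric U G" "x \<in> U"
  shows "rinner G x u v = rinner G x v u"
proof -
  have "rinner G x v u = v \<bullet> (transpose (G x) *v u)"
    using assms by (simp add: riemannian_metric_def rinner_def)
  also have "\<dots> = (u v* G x) \<bullet> v" by (simp add: transpose_matrix_vector inner_commute)
  also have "\<dots> = rinner G x u v" by (simp add: dot_lmul_matrix rinner_def)
  finally show ?thesis by simp
qed

lemma rinner_pos: "riemannian_metric U G \<Longrightarrow> x \<in> U \<Longrightarrow> v \<noteq> 0 \<Longrightarrow> rinner G x v v > 0"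
  by (simp add: riemannian_metric_def rinner_def)

lemma det_vector_3:
  "det (vector [a, b, c] :: real^3^3) =
     a$1 * b$2 * c$3 + a$2 * b$3 * c$1 + a$3 * b$1 * c$2 -
     a$1 * b$3 * c$2 - a$2 * b$1 * c$3 - a$3 * b$2 * c$1"
  by (simp add: det_3)

lemma det_vector_3_simps:
  "det (vector [k *\<^sub>R a, b, c] :: real^3^3) = k * det (vector [a, b, c] :: real^3^3)"
  "det (vector [a, k *\<^sub>R b, c] :: real^3^3) = k * det (vector [a, b, c] :: real^3^3)"
  "det (vector [a, b, k *\<^sub>R c] :: real^3^3) = k * det (vector [a, b, c] :: real^3^3)"
  "det (vector [a, b + b', c] :: real^3^3) = det (vector [a, b, c] :: real^3^3) + det (vector [a, b', c] :: real^3^3)"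
  "det (vector [a, b, c + c'] :: real^3^3) = det (vector [a, b, c] :: real^3^3) + det (vector [a, b, c'] :: real^3^3)"
  "det (vector [a, b - b', c] :: real^3^3) = det (vector [a, b, c] :: real^3^3) - det (vector [a, b', c] :: real^3^3)"
  "det (vector [a, b, c - c'] :: real^3^3) = det (vector [a, b, c] :: real^3^3) - det (vector [a, b, c'] :: real^3^3)"
  "det (vector [a, a, c] :: real^3^3) = 0"
  "det (vector [a, b, a] :: real^3^3) = 0"
  "det (vector [a, b, b] :: real^3^3) = 0"
  "det (vector [0, b, c] :: real^3^3) = 0"
  "det (vector [a, 0, c] :: real^3^3) = 0"
  "det (vector [a, b, 0] :: real^3^3) = 0"
  by (simp_all add: det_vector_3 algebra_simps)

text \<open>The Gram determinant, as the determinant of \<open>A G E\<^sup>T\<close> for matrices with the given rows.\<close>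

lemma det_gram:
  "det (vector [a, b, c] :: real^3^3) * det (G x) * det (vector [e, f, g] :: real^3^3) =
   det (vector [vector [rinner G x a e, rinner G x a f, rinner G x a g],
                vector [rinner G x b e, rinner G x b f, rinner G x b g],
                vector [rinner G x c e, rinner G x c f, rinner G x c g]] :: real^3^3)"
proof -
  have "(vector [a, b, c] :: real^3^3) ** G x ** transpose (vector [e, f, g] :: real^3^3) =
     (vector [vector [rinner G x a e, rinner G x a f, rinner G x a g],
                vector [rinner G x b e, rinner G x b f, rinner G x b g],
                vector [rinner G x c e, rinner G x c f, rinner G x c g]] :: real^3^3)"
    by (simp add: vec_eq_iff forall_3 matrix_matrix_mult_def transpose_def rinner_def
        matrix_vector_mult_def inner_vec_def sum_3 algebra_simps)
  then show ?thesis by (metis det_mul det_transpose)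
qed

text \<open>The Gram-Schmidt process is needed as a map that is smooth in the base point as well, since it
  serves as a smooth retraction of the open set \<open>basis_domain\<close> onto the frame bundle. It is split into stages so that each stage can be followed separately.\<close>

definition gs_unit :: "(real^3 \<Rightarrow> real^3^3) \<Rightarrow> real^3 \<Rightarrow> real^3 \<Rightarrow> real^3" where
  "gs_unit G x v = inverse (sqrt (rinner G x v v)) *\<^sub>R v"

definition gs_reject :: "(real^3 \<Rightarrow> real^3^3) \<Rightarrow> real^3 \<Rightarrow> real^3 \<Rightarrow> real^3 \<Rightarrow> real^3" where
  "gs_reject G x e v = v - rinner G x e v *\<^sub>R e"

definition gs0 :: "(real^3 \<Rightarrow> real^3^3) \<Rightarrow> frame_pt \<Rightarrow> real^3" where
  "gs0 G = (\<lambda>(x, e0, e1, e2). gs_unit G x e0)"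

definition gs1 :: "(real^3 \<Rightarrow> real^3^3) \<Rightarrow> frame_pt \<Rightarrow> real^3" where
  "gs1 G = (\<lambda>(x, e0, e1, e2). gs_unit G x (gs_reject G x (gs0 G (x, e0, e1, e2)) e1))"

definition gs2 :: "(real^3 \<Rightarrow> real^3^3) \<Rightarrow> frame_pt \<Rightarrow> real^3" where
  "gs2 G = (\<lambda>(x, e0, e1, e2). gs_unit G x (gs_reject G x (gs1 G (x, e0, e1, e2))
     (gs_reject G x (gs0 G (x, e0, e1, e2)) e2)))"

definition gram_schmidt :: "(real^3 \<Rightarrow> real^3^3) \<Rightarrow> frame_pt \<Rightarrow> frame_pt" where
  "gram_schmidt G p = (fst p, gs0 G p, gs1 G p, gs2 G p)"

definition basis_domain :: "(real^3) set \<Rightarrow> frame_pt set" where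
  "basis_domain U = {(x, e0, e1, e2). x \<in> U \<and> det (vector [e0, e1, e2] :: real^3^3) > 0}"

lemma gs_unit_norm:
  assumes "riemannian_metric U G" "x \<in> U" "v \<noteq> 0"
  shows "rinner G x (gs_unit G x v) (gs_unit G x v) = 1"
proof -
  define s where "s = sqrt (rinner G x v v)"
  have "s > 0" "rinner G x v v = s * s"
    using rinner_pos[OF assms] by (simp_all add: s_def)
  then show ?thesis by (simp add: gs_unit_def rinner_simps field_simps flip: s_def)
qed

lemma gs_unit_scale_pos:
  assumes "riemannian_metric U G" "x \<in> U" "v \<noteq> 0"
  shows "inverse (sqrt (rinner G x v v)) > 0"
  using rinner_pos[OF assms] by simp

lemma gs_unit_orthogonal: "rinner G x u v = 0 \<Longrightarrow> rinner G x u (gs_unit G x v) = 0"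
  by (simp add: gs_unit_def rinner_simps)

lemma gs_reject_orthogonal: "rinner G x e e = 1 \<Longrightarrow> rinner G x e (gs_reject G x e v) = 0"
  by (simp add: gs_reject_def rinner_simps)

lemma gs_reject_orthogonal':
  "rinner G x u e = 0 \<Longrightarrow> rinner G x u v = 0 \<Longrightarrow> rinner G x u (gs_reject G x e v) = 0"
  by (simp add: gs_reject_def rinner_simps)

text \<open>The intermediate vectors whose norms the process divides by do not vanish, since all partially
  orthonormalised bases have positive determinant.\<close>

lemma gram_schmidt_positive:
  assumes G: "riemannian_metric U G" and p: "p \<in> basis_domain U" "p = (x, e0, e1, e2)"
  shows "e0 \<noteq> 0" "gs_reject G x (gs0 G p) e1 \<noteq> 0"
    "gs_reject G x (gs1 G p) (gs_reject G x (gs0 G p) e2) \<noteq> 0"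
    "det (vector [gs0 G p, gs1 G p, gs2 G p] :: real^3^3) > 0"
proof -
  let ?f0 = "gs0 G p" and ?f1 = "gs1 G p" and ?f2 = "gs2 G p"
  let ?g1 = "gs_reject G x ?f0 e1" and ?g2 = "gs_reject G x ?f1 (gs_reject G x ?f0 e2)"
  have x: "x \<in> U" and d: "det (vector [e0, e1, e2] :: real^3^3) > 0"
    using p by (auto simp: basis_domain_def)
  show e0: "e0 \<noteq> 0" using d by (auto simp: det_vector_3_simps)
  have f0: "?f0 = gs_unit G x e0" "?f1 = gs_unit G x ?g1" "?f2 = gs_unit G x ?g2"
    by (simp_all add: p(2) gs0_def gs1_def gs2_def)
  have d0: "det (vector [?f0, e1, e2] :: real^3^3) > 0"
    using d gs_unit_scale_pos[OF G x e0] by (simp add: f0(1) gs_unit_def det_vector_3_simps)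
  have d1: "det (vector [?f0, ?g1, e2] :: real^3^3) > 0"
    using d0 by (simp add: gs_reject_def det_vector_3_simps)
  then show g1: "?g1 \<noteq> 0" by (auto simp: det_vector_3_simps)
  have d2: "det (vector [?f0, ?f1, e2] :: real^3^3) > 0"
    using d1 gs_unit_scale_pos[OF G x g1] by (simp add: f0(2) gs_unit_def[of G x ?g1] det_vector_3_simps)
  have d3: "det (vector [?f0, ?f1, ?g2] :: real^3^3) > 0"
    using d2 by (simp add: gs_reject_def[of G x ?f1] gs_reject_def[of G x ?f0 e2] det_vector_3_simps)
  then show g2: "?g2 \<noteq> 0" by (auto simp: det_vector_3_simps)
  show "det (vector [?f0, ?f1, ?f2] :: real^3^3) > 0"
    using d3 gs_unit_scale_pos[OF G x g2] by (simp add: f0(3) gs_unit_def[of G x ?g2] det_vector_3_simps)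
qed

lemma gram_schmidt_orthonormal:
  assumes G: "riemannian_metric U G" and p: "p \<in> basis_domain U" and x: "x = fst p"
  shows "rinner G x (gs0 G p) (gs0 G p) = 1" "rinner G x (gs1 G p) (gs1 G p) = 1"
    "rinner G x (gs2 G p) (gs2 G p) = 1" "rinner G x (gs0 G p) (gs1 G p) = 0"
    "rinner G x (gs0 G p) (gs2 G p) = 0" "rinner G x (gs1 G p) (gs2 G p) = 0"
proof -
  obtain e0 e1 e2 where p': "p = (x, e0, e1, e2)" using x by (metis prod.collapse)
  have xU: "x \<in> U" using p p' by (auto simp: basis_domain_def)
  note ne = gram_schmidt_positive[OF G p p']
  show f0: "rinner G x (gs0 G p) (gs0 G p) = 1"
    using gs_unit_norm[OF G xU ne(1)] by (simp add: p' gs0_def)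
  show f1: "rinner G x (gs1 G p) (gs1 G p) = 1"
    using gs_unit_norm[OF G xU ne(2)] by (simp add: p' gs1_def)
  show "rinner G x (gs2 G p) (gs2 G p) = 1"
    using gs_unit_norm[OF G xU ne(3)] by (simp add: p' gs2_def)
  have f1': "gs1 G p = gs_unit G x (gs_reject G x (gs0 G p) e1)"
    and f2': "gs2 G p = gs_unit G x (gs_reject G x (gs1 G p) (gs_reject G x (gs0 G p) e2))"
    by (simp_all add: p' gs1_def gs2_def)
  show f01: "rinner G x (gs0 G p) (gs1 G p) = 0"
    unfolding f1' by (intro gs_unit_orthogonal gs_reject_orthogonal f0)
  show "rinner G x (gs0 G p) (gs2 G p) = 0"
    unfolding f2' by (intro gs_unit_orthogonal gs_reject_orthogonal' gs_reject_orthogonal f0 f01)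
  show "rinner G x (gs1 G p) (gs2 G p) = 0"
    unfolding f2' by (intro gs_unit_orthogonal gs_reject_orthogonal f1)
qed

text \<open>For any orthonormal basis with matrix \<open>E\<close> the Gram determinant \<open>(det E)\<^sup>2 det G\<close> is 1.\<close>

lemma det_metric_pos:
  assumes G: "riemannian_metric U G" and x: "x \<in> U"
  shows "det (G x) > 0"
proof -
  define p :: frame_pt where "p = (x, axis 1 1, axis 2 1, axis 3 1)"
  have "det (vector [axis 1 1, axis 2 1, axis 3 1] :: real^3^3) = 1"
    by (simp add: det_vector_3 axis_def)
  then have p: "p \<in> basis_domain U" "x = fst p" using x by (simp_all add: p_def basis_domain_def)
  note o = gram_schmidt_orthonormal[OF G p]
  let ?d = "det (vector [gs0 G p, gs1 G p, gs2 G p] :: real^3^3)"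
  have "?d * det (G x) * ?d = 1"
    unfolding det_gram using o rinner_commute[OF G x] by (simp add: det_vector_3)
  then have "det (G x) * ?d\<^sup>2 = 1" by (simp add: power2_eq_square ac_simps)
  then show ?thesis by (metis zero_less_mult_pos2 zero_less_one zero_less_power2 mult_zero_right zero_neq_one mult.commute power_zero_numeral)
qed

lemma mem_frame_bundle_iff:
  assumes G: "riemannian_metric U G"
  shows "(x, e0, e1, e2) \<in> frame_bundle U G \<longleftrightarrow> (x, e0, e1, e2) \<in> basis_domain U \<and>
     rinner G x e0 e0 = 1 \<and> rinner G x e1 e1 = 1 \<and> rinner G x e2 e2 = 1 \<and>
     rinner G x e0 e1 = 0 \<and> rinner G x e0 e2 = 0 \<and> rinner G x e1 e2 = 0"
proof -
  have "vol_form G x [e0, e1, e2] > 0 \<longleftrightarrow> det (vector [e0, e1, e2] :: real^3^3) > 0" if "x \<in> U"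
    using det_metric_pos[OF G that] by (simp add: vol_form_def zero_less_mult_iff)
  then show ?thesis by (auto simp: frame_bundle_def basis_domain_def)
qed

lemma frame_bundle_subset: "riemannian_metric U G \<Longrightarrow> frame_bundle U G \<subseteq> basis_domain U"
  using mem_frame_bundle_iff by auto

lemma gram_schmidt_in_frame_bundle:
  assumes G: "riemannian_metric U G" and p: "p \<in> basis_domain U"
  shows "gram_schmidt G p \<in> frame_bundle U G"
proof -
  have "gram_schmidt G p \<in> basis_domain U"
    using p gram_schmidt_positive(4)[OF G p] 
    by (cases p) (auto simp: gram_schmidt_def basis_domain_def)
  then show ?thesis
    using gram_schmidt_orthonormal[OF G p refl] mem_frame_bundle_iff[OF G]
    by (simp add: gram_schmidt_def)
qed

lemma gs_unit_idem: "rinner G x v v = 1 \<Longrightarrow> gs_unit G x v = v"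
  by (simp add: gs_unit_def)

lemma gs_reject_idem: "rinner G x e v = 0 \<Longrightarrow> gs_reject G x e v = v"
  by (simp add: gs_reject_def)

lemma gram_schmidt_frame: "p \<in> frame_bundle U G \<Longrightarrow> gram_schmidt G p = p"
  by (auto simp: frame_bundle_def gram_schmidt_def gs0_def gs1_def gs2_def gs_unit_idem gs_reject_idem)

text \<open>The Gram determinant of the three vectors against the frame is the product of their volume and the
  volume of the frame, and the latter is 1, being positive with square the Gram determinant of
  the frame.\<close>

lemma frame_gram:
  assumes G: "riemannian_metric U G" and p: "(x, e0, e1, e2) \<in> frame_bundle U G"
  shows "vol_form G x [a, b, c] =
    det (vector [vector [rinner G x e0 a, rinner G x e1 a, rinner G x e2 a],
                 vector [rinner G x e0 b, rinner G x e1 b, rinner G x e2 b],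
                 vector [rinner G x e0 c, rinner G x e1 c, rinner G x e2 c]] :: real^3^3)"
proof -
  have x: "x \<in> U" and o: "rinner G x e0 e0 = 1" "rinner G x e1 e1 = 1" "rinner G x e2 e2 = 1"
     "rinner G x e0 e1 = 0" "rinner G x e0 e2 = 0" "rinner G x e1 e2 = 0" 
     and pos: "vol_form G x [e0, e1, e2] > 0"
    using p by (auto simp: frame_bundle_def)
  note s = rinner_commute[OF G x]
  have vol: "vol_form G x [a, b, c] * vol_form G x [e0, e1, e2] =
    det (vector [vector [rinner G x a e0, rinner G x a e1, rinner G x a e2],
                vector [rinner G x b e0, rinner G x b e1, rinner G x b e2],
                vector [rinner G x c e0, rinner G x c e1, rinner G x c e2]] :: real^3^3)" for a b c
  proof -
    have "sqrt (det (G x)) * sqrt (det (G x)) = det (G x)" using det_metric_pos[OF G x] by simp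
    moreover have "(r * k) * (r * l) = k * (r * r) * l" for r k l :: real by simp
    ultimately show ?thesis unfolding vol_form_def det_gram[symmetric] by (simp only:)
  qed
  have "vol_form G x [e0, e1, e2] * vol_form G x [e0, e1, e2] = 1"
    unfolding vol using o s by (simp add: det_vector_3)
  then have "vol_form G x [e0, e1, e2] = 1" 
    using pos unfolding square_eq_1_iff by linarith
  then show ?thesis using vol[of a b c] s by simp
qed

lemma frame_vol:
  assumes G: "riemannian_metric U G" and p: "(x, e0, e1, e2) \<in> frame_bundle U G"
  shows "vol_form G x [e0, v, w] = rinner G x e1 v * rinner G x e2 w - rinner G x e2 v * rinner G x e1 w"
  using p rinner_commute[OF G, of x e1 e0] rinner_commute[OF G, of x e2 e0]
  unfolding frame_gram[OF assms] by (auto simp: frame_bundle_def det_vector_3)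

lemma frame_vol_tangent:
  assumes G: "riemannian_metric U G" and p: "(x, e0, e1, e2) \<in> frame_bundle U G"
    and "rinner G x e0 v = 0" "rinner G x e0 w = 0"
  shows "vol_form G x [s, v, w] = rinner G x e0 s * vol_form G x [e0, v, w]"
  unfolding frame_vol[OF G p] unfolding frame_gram[OF G p]
  using assms(3,4) by (simp add: det_vector_3 algebra_simps)

section \<open>Smoothness of the metric and of the Gram-Schmidt process\<close>

lemma bounded_bilinear_matrix_vector: "bounded_bilinear (\<lambda>(A :: real^3^3) (v :: real^3). A *v v)"
  unfolding bilinear_conv_bounded_bilinear[symmetric] bilinear_def
  by (auto intro!: linearI simp: matrix_vector_mult_add_rdistrib matrix_vector_right_distrib
      scaleR_matrix_vector_assoc matrix_vector_mult_scaleR)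

lemma smooth_on_rinner:
  assumes G: "riemannian_metric U G" and W: "open W" "x ` W \<subseteq> U"
    and "smooth_on W x" "smooth_on W u" "smooth_on W v"
  shows "smooth_on W (\<lambda>q. rinner G (x q) (u q) (v q))"
  unfolding rinner_def using assms
  by (intro smooth_on_inner smooth_on_bilinear[OF bounded_bilinear_matrix_vector] smooth_on_compose[of W x U G])
     (auto simp: riemannian_metric_def)

lemma smooth_on_det_vector:
  assumes "open W" "smooth_on W a" "smooth_on W b" "smooth_on W c"
  shows "smooth_on W (\<lambda>q. det (vector [a q, b q, c q] :: real^3^3))"
  unfolding det_vector_3 by (intro smooth_intros assms)

lemma smooth_on_det:
  fixes M :: "'a::euclidean_space \<Rightarrow> real^3^3"
  assumes "open W" "smooth_on W M"
  shows "smooth_on W (\<lambda>q. det (M q))"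
  unfolding det_3 by (intro smooth_intros assms)

lemma smooth_on_vol_form:
  assumes G: "riemannian_metric U G" and W: "open W" "x ` W \<subseteq> U"
    and "smooth_on W x" "smooth_on W a" "smooth_on W b" "smooth_on W c"
  shows "smooth_on W (\<lambda>q. vol_form G (x q) [a q, b q, c q])"
proof -
  have "smooth_on W (\<lambda>q. G (x q))"
    using G assms by (intro smooth_on_compose[of W x U G]) (auto simp: riemannian_metric_def)
  then have "smooth_on W (\<lambda>q. sqrt (det (G (x q))))"
    using det_metric_pos[OF G] W by (intro smooth_on_sqrt smooth_on_det) auto
  then show ?thesis
    unfolding vol_form_def by (intro smooth_on_mult smooth_on_det_vector assms)
qed

lemma open_basis_domain:
  assumes "open U"
  shows "open (basis_domain U)"
proof -
  let ?d = "\<lambda>p::frame_pt. det (vector [fst (snd p), fst (snd (snd p)), snd (snd (snd p))] :: real^3^3)"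
  have s: "smooth_on UNIV ?d" by (intro smooth_on_det_vector smooth_intros open_UNIV)
  have "open ((U \<times> UNIV) \<inter> ?d -` {0<..})"
    using assms s smooth_on_subset[OF s] by (intro open_preimage) (auto intro: open_Times)
  moreover have "basis_domain U = (U \<times> UNIV) \<inter> ?d -` {0<..}"
    by (auto simp: basis_domain_def)
  ultimately show ?thesis by simp
qed

lemma smooth_on_gs_unit:
  assumes G: "riemannian_metric U G" and W: "open W" "x ` W \<subseteq> U"
    and "smooth_on W x" "smooth_on W v" and nz: "\<And>q. q \<in> W \<Longrightarrow> v q \<noteq> 0"
  shows "smooth_on W (\<lambda>q. gs_unit G (x q) (v q))"
  unfolding gs_unit_def
  using rinner_pos[OF G] W nz
  by (intro smooth_on_scaleR smooth_on_inverse_sqrt smooth_on_rinner[OF G W] assms) auto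

lemma smooth_on_gs_reject:
  assumes G: "riemannian_metric U G" and W: "open W" "x ` W \<subseteq> U"
    and "smooth_on W x" "smooth_on W v" "smooth_on W e"
  shows "smooth_on W (\<lambda>q. gs_reject G (x q) (e q) (v q))"
  unfolding gs_reject_def
  by (intro smooth_intros smooth_on_rinner[OF G W] assms)

lemma smooth_on_gram_schmidt:
  assumes U: "open U" and G: "riemannian_metric U G"
  shows "smooth_on (basis_domain U) (gram_schmidt G)"
proof -
  note W = open_basis_domain[OF U]
  let ?W = "basis_domain U"
  have x: "fst ` ?W \<subseteq> U" by (auto simp: basis_domain_def)
  have ne: "fst (snd p) \<noteq> 0" "gs_reject G (fst p) (gs0 G p) (fst (snd (snd p))) \<noteq> 0"
    "gs_reject G (fst p) (gs1 G p) (gs_reject G (fst p) (gs0 G p) (snd (snd (snd p)))) \<noteq> 0"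
    if "p \<in> ?W" for p
    using gram_schmidt_positive[OF G that, of "fst p" "fst (snd p)" "fst (snd (snd p))" "snd (snd (snd p))"]
    by simp_all
  have "smooth_on ?W (\<lambda>p. gs_unit G (fst p) (fst (snd p)))"
    by (intro smooth_on_gs_unit[OF G W x] smooth_intros W ne)
  then have 0: "smooth_on ?W (gs0 G)" by (simp add: gs0_def case_prod_beta')
  have "smooth_on ?W (\<lambda>p. gs_unit G (fst p) (gs_reject G (fst p) (gs0 G p) (fst (snd (snd p)))))"
    by (intro smooth_on_gs_unit[OF G W x] smooth_on_gs_reject[OF G W x] smooth_intros W ne 0)
  then have 1: "smooth_on ?W (gs1 G)" by (simp add: gs1_def case_prod_beta')
  have "smooth_on ?W (\<lambda>p. gs_unit G (fst p) (gs_reject G (fst p) (gs1 G p) (gs_reject G (fst p) (gs0 G p) (snd (snd (snd p))))))"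
    by (intro smooth_on_gs_unit[OF G W x] smooth_on_gs_reject[OF G W x] smooth_intros W ne 0 1)
  then have 2: "smooth_on ?W (gs2 G)" by (simp add: gs2_def case_prod_beta')
  show ?thesis
    unfolding gram_schmidt_def by (intro smooth_intros W 0 1 2)
qed

section \<open>Killing fields and the frame bundle\<close>

abbreviation metric_deriv ::
    "(real^3 \<Rightarrow> real^3^3) \<Rightarrow> real^3 \<Rightarrow> real^3 \<Rightarrow> real^3 \<Rightarrow> real^3 \<Rightarrow> real" where
  "metric_deriv G x v u w \<equiv> frechet_derivative (\<lambda>y. rinner G y u w) (at x) v"

lemma has_derivative_rinner:
  assumes G: "riemannian_metric U G" and xU: "x q \<in> U"
    and x: "(x has_derivative x') (at q)" and u: "(u has_derivative u') (at q)" and v: "(v has_derivative v') (at q)"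
  shows "((\<lambda>q. rinner G (x q) (u q) (v q)) has_derivative
     (\<lambda>h. metric_deriv G (x q) (x' h) (u q) (v q) + rinner G (x q) (u' h) (v q) + rinner G (x q) (u q) (v' h))) (at q)"
proof -
  note mv = bounded_bilinear.FDERIV[OF bounded_bilinear_matrix_vector]
  let ?G' = "frechet_derivative G (at (x q))"
  have G': "(G has_derivative ?G') (at (x q))"
    using G xU by (intro smooth_on_has_derivative[of U]) (auto simp: riemannian_metric_def)
  have D: "((\<lambda>y. rinner G y a b) has_derivative (\<lambda>h. a \<bullet> (?G' h *v b))) (at (x q))" for a b
  proof -
    have "((\<lambda>y. a \<bullet> (G y *v b)) has_derivative (\<lambda>h. a \<bullet> (G (x q) *v 0 + ?G' h *v b))) (at (x q))"
      by (intro has_derivative_inner_right mv G' has_derivative_const)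
    then show ?thesis by (simp add: rinner_def)
  qed
  have m: "metric_deriv G (x q) h a b = a \<bullet> (?G' h *v b)" for h a b
    unfolding frechet_derivative_eq_if_has_derivative[OF D] ..
  have "((\<lambda>q. u q \<bullet> (G (x q) *v v q)) has_derivative
     (\<lambda>h. u q \<bullet> (G (x q) *v v' h + ?G' (x' h) *v v q) + u' h \<bullet> (G (x q) *v v q))) (at q)"
    by (intro has_derivative_inner u mv has_derivative_compose[OF x G'] v)
  then show ?thesis
    unfolding rinner_def[symmetric] m by (simp add: inner_add_right rinner_def ac_simps)
qed

lemma killing_field_differentiable: "killing_field U G S \<Longrightarrow> x \<in> U \<Longrightarrow> S differentiable (at x)"
  by (auto simp: killing_field_def intro: smooth_on_differentiable)

text \<open>Vectors that the linearised flow of a Killing field drags along keep, to first order, all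
  inner products. The class of these curves is closed under each step of the Gram-Schmidt process,
  which is how the flow is seen to act on orthonormal frames without integrating it.\<close>

definition dragged :: "(real^3 \<Rightarrow> real^3) \<Rightarrow> real^3 \<Rightarrow> (real \<Rightarrow> real^3) \<Rightarrow> bool" where
  "dragged S x u \<longleftrightarrow> (u has_vector_derivative frechet_derivative S (at x) (u 0)) (at 0)"

lemma dragged_rinner:
  assumes G: "riemannian_metric U G" and S: "killing_field U G S"
    and c: "(c has_vector_derivative S x) (at 0)" "c 0 = x" "x \<in> U"
    and u: "dragged S x u" and v: "dragged S x v"
  shows "((\<lambda>t. rinner G (c t) (u t) (v t)) has_real_derivative 0) (at 0)"
proof -
  let ?S' = "frechet_derivative S (at x)"
  have m: "metric_deriv G x (t *\<^sub>R S x) (u 0) (v 0) = t * metric_deriv G x (S x) (u 0) (v 0)" for t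
  proof -
    have "(\<lambda>y. rinner G y (u 0) (v 0)) differentiable (at x)"
      using Derivative.differentiableI[OF has_derivative_rinner[OF G, of "\<lambda>y. y" x,
          OF c(3) has_derivative_ident has_derivative_const has_derivative_const]] .
    from linear_cmul[OF linear_frechet_derivative[OF this]] show ?thesis by simp
  qed
  have k: "metric_deriv G x (S x) (u 0) (v 0) + rinner G x (?S' (u 0)) (v 0) + rinner G x (u 0) (?S' (v 0)) = 0"
    using S c(3) unfolding killing_field_def by blast
  have "((\<lambda>t. rinner G (c t) (u t) (v t)) has_derivative
     (\<lambda>t. metric_deriv G (c 0) (t *\<^sub>R S x) (u 0) (v 0) + rinner G (c 0) (t *\<^sub>R ?S' (u 0)) (v 0)
        + rinner G (c 0) (u 0) (t *\<^sub>R ?S' (v 0)))) (at 0)"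
    using c u v by (intro has_derivative_rinner[OF G]) (auto simp: has_vector_derivative_def dragged_def)
  moreover have "metric_deriv G (c 0) (t *\<^sub>R S x) (u 0) (v 0) + rinner G (c 0) (t *\<^sub>R ?S' (u 0)) (v 0)
        + rinner G (c 0) (u 0) (t *\<^sub>R ?S' (v 0)) =
      t * (metric_deriv G x (S x) (u 0) (v 0) + rinner G x (?S' (u 0)) (v 0) + rinner G x (u 0) (?S' (v 0)))" for t
    by (simp add: c(2) m rinner_simps algebra_simps)
  ultimately show ?thesis
    by (simp add: k has_field_derivative_def lambda_zero)
qed

lemma dragged_scaleR:
  assumes S: "S differentiable (at x)" and k: "(k has_real_derivative 0) (at 0)" and u: "dragged S x u"
  shows "dragged S x (\<lambda>t. k t *\<^sub>R u t)"
proof -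
  have "((\<lambda>t. k t *\<^sub>R u t) has_vector_derivative
      (k 0 *\<^sub>R frechet_derivative S (at x) (u 0) + 0 *\<^sub>R u 0)) (at 0)"
    using k u by (intro has_vector_derivative_scaleR) (auto simp: dragged_def)
  then show ?thesis
    by (simp add: dragged_def linear_cmul[OF linear_frechet_derivative[OF S]])
qed

lemma dragged_diff:
  assumes S: "S differentiable (at x)" and u: "dragged S x u" and v: "dragged S x v"
  shows "dragged S x (\<lambda>t. u t - v t)"
  using has_vector_derivative_diff[OF u[unfolded dragged_def] v[unfolded dragged_def]]
  by (simp add: dragged_def linear_diff[OF linear_frechet_derivative[OF S]])

lemma dragged_gs_unit:
  assumes G: "riemannian_metric U G" and S: "killing_field U G S"
    and c: "(c has_vector_derivative S x) (at 0)" "c 0 = x" "x \<in> U"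
    and u: "dragged S x u" "u 0 \<noteq> 0"
  shows "dragged S x (\<lambda>t. gs_unit G (c t) (u t))"
  unfolding gs_unit_def
proof (rule dragged_scaleR[OF killing_field_differentiable[OF S c(3)] _ u(1)])
  have "rinner G (c 0) (u 0) (u 0) > 0" using rinner_pos[OF G c(3) u(2)] c(2) by simp
  then show "((\<lambda>t. inverse (sqrt (rinner G (c t) (u t) (u t)))) has_real_derivative 0) (at 0)"
    using dragged_rinner[OF G S c u(1) u(1)]
    by (auto intro!: derivative_eq_intros)
qed

lemma dragged_gs_reject:
  assumes G: "riemannian_metric U G" and S: "killing_field U G S"
    and c: "(c has_vector_derivative S x) (at 0)" "c 0 = x" "x \<in> U"
    and e: "dragged S x e" and u: "dragged S x u"
  shows "dragged S x (\<lambda>t. gs_reject G (c t) (e t) (u t))"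
  unfolding gs_reject_def
  by (intro dragged_diff dragged_scaleR killing_field_differentiable[OF S c(3)] e u
      dragged_rinner[OF G S c])

text \<open>The generator of the action of the flow of \<open>S\<close> on frames.\<close>

definition frame_lift :: "(real^3 \<Rightarrow> real^3) \<Rightarrow> frame_pt \<Rightarrow> frame_pt" where
  "frame_lift S = (\<lambda>(x, e0, e1, e2). (S x, frechet_derivative S (at x) e0,
     frechet_derivative S (at x) e1, frechet_derivative S (at x) e2))"

text \<open>The straight line from \<open>p\<close> in the direction of the lift need not stay in the frame bundle, but its legs are
  dragged curves. Gram-Schmidt pushes it back into the bundle without changing its velocity.\<close>

lemma frame_lift_tangent:
  assumes U: "open U" and G: "riemannian_metric U G" and S: "killing_field U G S"
    and p: "p \<in> frame_bundle U G"
  shows "frame_lift S p \<in> tangent_space (frame_bundle U G) p"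
proof -
  obtain x e0 e1 e2 where p': "p = (x, e0, e1, e2)" by (metis prod.collapse)
  have x: "x \<in> U" using p by (simp add: p' frame_bundle_def)
  have W: "p \<in> basis_domain U" using p frame_bundle_subset[OF G] by blast
  let ?S' = "frechet_derivative S (at x)" and ?v = "frame_lift S p"
  let ?q = "\<lambda>t::real. p + t *\<^sub>R ?v"
  define c where "c t = x + t *\<^sub>R S x" for t
  have c: "(c has_vector_derivative S x) (at 0)" "c 0 = x"
    unfolding c_def by (auto intro!: derivative_eq_intros simp: has_vector_derivative_def)
  have drag: "dragged S x (\<lambda>t. e + t *\<^sub>R ?S' e)" for e
    unfolding dragged_def by (auto intro!: derivative_eq_intros simp: has_vector_derivative_def)
  have q: "?q t = (c t, e0 + t *\<^sub>R ?S' e0, e1 + t *\<^sub>R ?S' e1, e2 + t *\<^sub>R ?S' e2)" for t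
    by (simp add: p' c_def frame_lift_def)
  note ne = gram_schmidt_positive[OF G W p']
  have f: "gs0 G p = e0" "gs1 G p = e1" "gs2 G p = e2"
    using gram_schmidt_frame[OF p] by (simp_all add: gram_schmidt_def p')
  have d0: "dragged S x (\<lambda>t. gs0 G (?q t))"
    unfolding q gs0_def prod.case using ne by (intro dragged_gs_unit[OF G S c x] drag) simp
  have d1: "dragged S x (\<lambda>t. gs1 G (?q t))"
    unfolding q gs1_def prod.case unfolding q[symmetric] using ne
    by (intro dragged_gs_unit[OF G S c x] dragged_gs_reject[OF G S c x] drag d0) (simp add: c)
  have d2: "dragged S x (\<lambda>t. gs2 G (?q t))"
    unfolding q gs2_def prod.case unfolding q[symmetric] using ne
    by (intro dragged_gs_unit[OF G S c x] dragged_gs_reject[OF G S c x] drag d0 d1) (simp add: c)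
  have "((\<lambda>t. (c t, gs0 G (?q t), gs1 G (?q t), gs2 G (?q t))) has_vector_derivative ?v) (at 0)"
    using c d0 d1 d2 f
    by (auto simp: dragged_def p' frame_lift_def intro!: has_vector_derivative_Pair)
  moreover have "gram_schmidt G (?q t) = (c t, gs0 G (?q t), gs1 G (?q t), gs2 G (?q t))" for t
    by (simp add: gram_schmidt_def c_def p' frame_lift_def)
  ultimately have "((\<lambda>t. gram_schmidt G (?q t)) has_vector_derivative ?v) (at 0)" by simp
  moreover note sm = smooth_on_gram_schmidt[OF U G]
  ultimately have "frechet_derivative (gram_schmidt G) (at p) ?v = ?v"
    using has_vector_derivative_along_line[OF smooth_on_differentiable[OF sm W], of ?v]
      vector_derivative_unique_at by blast
  moreover have "frechet_derivative (gram_schmidt G) (at p) ?v \<in> tangent_space (frame_bundle U G) (gram_schmidt G p)"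
    using gram_schmidt_in_frame_bundle[OF G] by (intro tangent_space_image[OF open_basis_domain[OF U] sm _ W]) auto
  ultimately show ?thesis using gram_schmidt_frame[OF p] by simp
qed

section \<open>The exterior derivative on a smooth retract\<close>

text \<open>The retraction fixes every curve in \<open>X\<close>, hence also its velocity.\<close>

lemma retraction_derivative:
  assumes W: "open W" "p \<in> W" and R: "smooth_on W R" "\<And>q. q \<in> X \<inter> W \<Longrightarrow> R q = q"
    and a: "a \<in> tangent_space X p"
  shows "frechet_derivative R (at p) a = a"
proof -
  obtain \<gamma> \<delta> where \<delta>: "\<delta> > 0" and s: "smooth_on {-\<delta><..<\<delta>} \<gamma>" and X: "\<gamma> ` {-\<delta><..<\<delta>} \<subseteq> X"
    and p: "\<gamma> 0 = p" and \<gamma>: "(\<gamma> has_vector_derivative a) (at (0::real))"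
    using a unfolding tangent_space_def by blast
  let ?T = "{-\<delta><..<\<delta>} \<inter> \<gamma> -` W"
  have T: "open ?T" "0 \<in> ?T" using open_preimage[OF _ s W(1)] \<delta> p W(2) by auto
  have DR: "(R has_derivative frechet_derivative R (at p)) (at (\<gamma> 0))"
    using smooth_on_has_derivative[OF R(1) W(2)] p by simp
  have "((\<lambda>t. R (\<gamma> t)) has_vector_derivative frechet_derivative R (at p) a) (at 0)"
    using has_derivative_compose[OF \<gamma>[unfolded has_vector_derivative_def] DR]
    by (simp add: has_vector_derivative_def
        linear_cmul[OF linear_frechet_derivative[OF smooth_on_differentiable[OF R(1) W(2)]]])
  moreover have "((\<lambda>t. R (\<gamma> t)) has_vector_derivative a) (at 0)"
    using \<gamma> unfolding has_vector_derivative_def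
    by (rule has_derivative_transform_within_open[OF _ T]) (use R(2) X in \<open>auto simp: image_subset_iff\<close>)
  ultimately show ?thesis by (rule vector_derivative_unique_at)
qed

text \<open>On tangent vectors the derivative of a form does not depend on the extension: two extensions
  become equal when they are pulled back by the retraction, and this pullback does not change the
  values on tangent vectors.\<close>

lemma has_ext_deriv_retract:
  assumes d: "has_ext_deriv X (Suc 0) \<omega> \<eta>" and \<omega>: "smooth_form_on W (Suc 0) \<omega>"
    and W: "open W" "p \<in> X" "p \<in> W"
    and R: "smooth_on W R" "R ` W \<subseteq> X \<inter> W" "\<And>q. q \<in> X \<inter> W \<Longrightarrow> R q = q"
    and a: "a \<in> tangent_space X p" "b \<in> tangent_space X p"
  shows "\<eta> p [a, b] = ext_deriv \<omega> p [a, b]"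
proof -
  obtain W' \<omega>' where W': "open W'" "p \<in> W'" and \<omega>': "smooth_form_on W' (Suc 0) \<omega>'"
    and eq: "\<forall>q\<in>X \<inter> W'. \<forall>vs. length vs = Suc 0 \<and> set vs \<subseteq> tangent_space X q \<longrightarrow> \<omega> q vs = \<omega>' q vs"
    and d': "\<forall>q\<in>X \<inter> W'. \<forall>vs. length vs = Suc (Suc 0) \<and> set vs \<subseteq> tangent_space X q \<longrightarrow> \<eta> q vs = ext_deriv \<omega>' q vs"
    using bspec[OF d[unfolded has_ext_deriv_def] W(2)] by metis
  have Rp: "R p = p" using R(3) W by blast
  let ?V = "W \<inter> R -` W'"
  have V: "open ?V" "p \<in> ?V" using open_preimage[OF W(1) R(1) W'(1)] W W' Rp by auto
  have RV: "smooth_on ?V R" using R(1) smooth_on_subset by blast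
  have RW: "R ` ?V \<subseteq> W" "R ` ?V \<subseteq> W'" using R(2) by auto
  have Da: "frechet_derivative R (at p) v = v" if "v \<in> tangent_space X p" for v
    by (rule retraction_derivative[OF W(1,3) R(1,3) that])
  have "ext_deriv \<omega> p [a, b] = ext_deriv (pullback R \<omega>) p [a, b]"
    using ext_deriv_pullback[OF \<omega> W(1) V(1) _ RV V(2), of a b] RW(1) Da a Rp by simp
  also have "\<dots> = ext_deriv (pullback R \<omega>') p [a, b]"
  proof (rule ext_deriv_1_cong[OF V])
    fix y v assume y: "y \<in> ?V"
    have "frechet_derivative R (at y) v \<in> tangent_space X (R y)"
      using y R(2) by (intro tangent_space_image[OF V(1) RV]) auto
    then show "pullback R \<omega> y [v] = pullback R \<omega>' y [v]"
      using eq R(2) y by (auto simp: pullback_def)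
  qed
  also have "\<dots> = ext_deriv \<omega>' p [a, b]"
    using ext_deriv_pullback[OF \<omega>' W'(1) V(1) _ RV V(2), of a b] RW(2) Da a Rp by simp
  also have "\<dots> = \<eta> p [a, b]"
    using d' W(2) W'(2) a by simp
  finally show ?thesis by simp
qed

section \<open>The structure equations at a frame\<close>

text \<open>The coframe forms \<open>\<theta>\<^sup>1\<close> and \<open>\<theta>\<^sup>2\<close> are the instances of one form, for \<open>k\<close> the projection to a leg
  of the frame.\<close>

definition leg_form :: "(real^3 \<Rightarrow> real^3^3) \<Rightarrow> (frame_pt \<Rightarrow> real^3) \<Rightarrow> frame_pt form" where
  "leg_form G k p vs = rinner G (fst p) (k p) (fst (hd vs))"

lemma theta1_leg: "theta1 G = leg_form G (\<lambda>p. fst (snd (snd p)))"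
  by (auto simp: theta1_def leg_form_def fun_eq_iff)

lemma theta2_leg: "theta2 G = leg_form G (\<lambda>p. snd (snd (snd p)))"
  by (auto simp: theta2_def leg_form_def fun_eq_iff)

lemma linear_rinner_right: "linear f \<Longrightarrow> linear (\<lambda>v. rinner G x u (f v))"
  by (auto intro!: linearI simp: rinner_simps linear_add linear_cmul)

lemma smooth_leg_form:
  assumes U: "open U" and G: "riemannian_metric U G" and k: "bounded_linear k"
  shows "smooth_form_on (basis_domain U) (Suc 0) (leg_form G k)"
  unfolding smooth_form_on_1_iff leg_form_def list.sel
proof (intro conjI ballI allI)
  show "linear (\<lambda>v. rinner G (fst p) (k p) (fst v))" for p
    by (rule linear_rinner_right) (simp add: linear_fst)
  show "smooth_on (basis_domain U) (\<lambda>p. rinner G (fst p) (k p) (fst v))" for v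
    by (intro smooth_on_rinner[OF G] smooth_intros open_basis_domain U smooth_on_linear k)
       (auto simp: basis_domain_def)
qed

lemma ext_deriv_leg_form:
  assumes G: "riemannian_metric U G" and k: "bounded_linear k" and p: "p \<in> basis_domain U"
  shows "ext_deriv (leg_form G k) p [a, b] =
    (metric_deriv G (fst p) (fst a) (k p) (fst b) + rinner G (fst p) (k a) (fst b)) -
    (metric_deriv G (fst p) (fst b) (k p) (fst a) + rinner G (fst p) (k b) (fst a))"
proof -
  have x: "fst p \<in> U" using p by (auto simp: basis_domain_def)
  have "((\<lambda>q. rinner G (fst q) (k q) v) has_derivative
     (\<lambda>h. metric_deriv G (fst p) (fst h) (k p) v + rinner G (fst p) (k h) v + rinner G (fst p) (k p) 0)) (at p)" for v
    by (intro has_derivative_rinner[of U G fst p, OF G x] bounded_linear_imp_has_derivative k bounded_linear_fst has_derivative_const)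
  from frechet_derivative_eq_if_has_derivative[OF this]
  show ?thesis by (simp add: ext_deriv_1 leg_form_def rinner_simps)
qed

lemma ext_deriv_leg_form_unique:
  assumes U: "open U" and G: "riemannian_metric U G" and k: "bounded_linear k"
    and d: "has_ext_deriv (frame_bundle U G) 1 (leg_form G k) \<eta>"
    and p: "p \<in> frame_bundle U G"
    and a: "a \<in> tangent_space (frame_bundle U G) p" "b \<in> tangent_space (frame_bundle U G) p"
  shows "\<eta> p [a, b] = ext_deriv (leg_form G k) p [a, b]"
proof (rule has_ext_deriv_retract[OF d[unfolded One_nat_def] smooth_leg_form[OF U G k] open_basis_domain[OF U] p _
      smooth_on_gram_schmidt[OF U G] _ _ a])
  show "p \<in> basis_domain U" using p frame_bundle_subset[OF G] by blast
  show "gram_schmidt G ` basis_domain U \<subseteq> frame_bundle U G \<inter> basis_domain U"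
    using gram_schmidt_in_frame_bundle[OF G] frame_bundle_subset[OF G] by blast
  show "gram_schmidt G q = q" if "q \<in> frame_bundle U G \<inter> basis_domain U" for q
    using that gram_schmidt_frame by blast
qed

text \<open>The lifted flow of a Killing field preserves the tautological forms, \<open>L\<^sub>S\<theta> = 0\<close>, so that Cartan's
  formula gives \<open>d(\<theta>(S)) = - S \<lrcorner> d\<theta>\<close>. Written out in coordinates this is the Killing equation.\<close>

lemma killing_leg_derivative:
  assumes G: "riemannian_metric U G" and S: "killing_field U G S" and k: "bounded_linear k"
    and p: "p \<in> basis_domain U" and kS: "k (frame_lift S p) = frechet_derivative S (at (fst p)) (k p)"
  shows "((\<lambda>q. rinner G (fst q) (k q) (S (fst q))) has_derivative
     (\<lambda>a. - ext_deriv (leg_form G k) p [frame_lift S p, a])) (at p)"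
proof -
  let ?x = "fst p" and ?S' = "frechet_derivative S (at (fst p))"
  have x: "?x \<in> U" using p by (auto simp: basis_domain_def)
  have fS: "fst (frame_lift S p) = S ?x" by (simp add: frame_lift_def case_prod_beta')
  have "((\<lambda>q. rinner G (fst q) (k q) (S (fst q))) has_derivative
     (\<lambda>h. metric_deriv G ?x (fst h) (k p) (S ?x) + rinner G ?x (k h) (S ?x) + rinner G ?x (k p) (?S' (fst h)))) (at p)"
    by (intro has_derivative_rinner[of U G fst p, OF G x] bounded_linear_imp_has_derivative k bounded_linear_fst
        has_derivative_compose[OF bounded_linear_imp_has_derivative[OF bounded_linear_fst]]
        has_derivative_frechet killing_field_differentiable[OF S x])
  moreover have "metric_deriv G ?x (fst h) (k p) (S ?x) + rinner G ?x (k h) (S ?x) + rinner G ?x (k p) (?S' (fst h)) =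
      - ext_deriv (leg_form G k) p [frame_lift S p, h]" for h
  proof -
    have "metric_deriv G ?x (S ?x) (k p) (fst h) + rinner G ?x (?S' (k p)) (fst h) + rinner G ?x (k p) (?S' (fst h)) = 0"
      using S x unfolding killing_field_def by blast
    then show ?thesis by (simp add: ext_deriv_leg_form[OF G k p] fS kS)
  qed
  ultimately show ?thesis by simp
qed

lemma wedge_1_1: "wedge 1 1 \<alpha> \<beta> x [a, b] = \<alpha> x [a] * \<beta> x [b] - \<alpha> x [b] * \<beta> x [a]"
proof -
  have s: "{..<1 + 1} = {0, Suc 0}" by auto
  have "{p. p permutes {..<1 + 1 :: nat}} = {id, Transposition.transpose 0 (Suc 0)}"
    unfolding s permutes_doubleton_iff by auto
  moreover have "id \<noteq> Transposition.transpose 0 (Suc 0)" by (auto simp: fun_eq_iff Transposition.transpose_def)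
  ultimately show ?thesis
    by (simp add: wedge_def sign_id sign_swap_id permute_list_def)
qed

section \<open>The minimal part of the Noether form on frames\<close>

text \<open>This is \<open>S \<lrcorner> (\<theta>\<^sup>1 \<and> \<theta>\<^sup>2)\<close>, for \<open>S\<close> lifted to frames.\<close>

definition noether_frame_form :: "(real^3 \<Rightarrow> real^3^3) \<Rightarrow> (real^3 \<Rightarrow> real^3) \<Rightarrow> frame_pt form" where
  "noether_frame_form G S = (\<lambda>p vs.
     theta1 G p [frame_lift S p] * theta2 G p vs - theta2 G p [frame_lift S p] * theta1 G p vs)"

lemma theta_frame_lift:
  "theta0 G (x, e0, e1, e2) [frame_lift S (x, e0, e1, e2)] = rinner G x e0 (S x)"
  "theta1 G p [frame_lift S p] = rinner G (fst p) (fst (snd (snd p))) (S (fst p))"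
  "theta2 G p [frame_lift S p] = rinner G (fst p) (snd (snd (snd p))) (S (fst p))"
  by (simp_all add: theta0_def theta1_def theta2_def frame_lift_def case_prod_beta')

lemma bounded_linear_legs:
  "bounded_linear (\<lambda>p::frame_pt. fst (snd (snd p)))" "bounded_linear (\<lambda>p::frame_pt. snd (snd (snd p)))"
  by (auto intro!: bounded_linear_fst_comp bounded_linear_snd_comp bounded_linear_ident)

lemma smooth_thetas:
  assumes U: "open U" and G: "riemannian_metric U G"
  shows "smooth_form_on (basis_domain U) (Suc 0) (theta1 G)"
    "smooth_form_on (basis_domain U) (Suc 0) (theta2 G)"
  unfolding theta1_leg theta2_leg by (intro smooth_leg_form U G bounded_linear_legs)+

lemma linear_mult_right: "linear f \<Longrightarrow> linear (\<lambda>v. c * (f v :: real))"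
  by (auto intro!: linearI simp: linear_add linear_cmul algebra_simps)

lemma smooth_noether_frame_form:
  assumes U: "open U" and G: "riemannian_metric U G" and S: "smooth_on U S"
  shows "smooth_form_on (basis_domain U) (Suc 0) (noether_frame_form G S)"
proof -
  note W = open_basis_domain[OF U]
  have x: "fst ` basis_domain U \<subseteq> U" by (auto simp: basis_domain_def)
  have Sx: "smooth_on (basis_domain U) (\<lambda>p. S (fst p))"
    by (rule smooth_on_compose[OF W x _ S]) (intro smooth_intros W)
  note th = smooth_thetas[OF U G]
  show ?thesis
    unfolding smooth_form_on_1_iff noether_frame_form_def theta_frame_lift
  proof (intro conjI ballI allI smooth_intros W)
    show "linear (\<lambda>v. rinner G (fst p) (fst (snd (snd p))) (S (fst p)) * theta2 G p [v] -
       rinner G (fst p) (snd (snd (snd p))) (S (fst p)) * theta1 G p [v])" if "p \<in> basis_domain U" for p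
      using th that by (intro linear_compose_sub linear_mult_right)
        (auto simp: smooth_form_on_1_iff)
  qed (use th in \<open>auto simp: smooth_form_on_1_iff intro!: smooth_on_rinner[OF G W x] smooth_intros W Sx\<close>)
qed

text \<open>With \<open>A\<^sub>i = \<theta>\<^sup>i(S)\<close> the form is \<open>A\<^sub>1 \<theta>\<^sup>2 - A\<^sub>2 \<theta>\<^sup>1\<close>. Cartan's formula and the structure equations
  express \<open>dA\<^sub>i\<close> and \<open>d\<theta>\<^sup>i\<close> through the connection forms; on vectors on which \<open>\<theta>\<^sup>0\<close> vanishes the terms
  with \<open>\<omega>\<^sup>1\<^sub>2\<close> cancel, and what remains is \<open>-\<theta>\<^sup>0(S) \<Psi>\<^sub>0\<close>.\<close>

lemma ext_deriv_noether_frame_form: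
  assumes U: "open U" and G: "riemannian_metric U G" and S: "killing_field U G S"
    and conn: "connection_forms U G w01 w20 w12" and p: "p \<in> frame_bundle U G"
    and a: "a \<in> tangent_space (frame_bundle U G) p" "theta0 G p [a] = 0"
    and b: "b \<in> tangent_space (frame_bundle U G) p" "theta0 G p [b] = 0"
  shows "ext_deriv (noether_frame_form G S) p [a, b] =
    - theta0 G p [frame_lift S p] * (- wedge 1 1 w20 (theta1 G) p [a, b] - wedge 1 1 w01 (theta2 G) p [a, b])"
proof -
  note W = frame_bundle_subset[OF G, THEN subsetD, OF p]
  let ?s = "frame_lift S p"
  note s = frame_lift_tangent[OF U G S p]
  let ?A1 = "\<lambda>q. theta1 G q [frame_lift S q]" and ?A2 = "\<lambda>q. theta2 G q [frame_lift S q]"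
  have h: "has_ext_deriv (frame_bundle U G) 1 (theta1 G)
       (\<lambda>p vs. wedge 1 1 w01 (theta0 G) p vs - wedge 1 1 w12 (theta2 G) p vs)"
    "has_ext_deriv (frame_bundle U G) 1 (theta2 G)
       (\<lambda>p vs. - wedge 1 1 w20 (theta0 G) p vs + wedge 1 1 w12 (theta1 G) p vs)"
    using conn unfolding connection_forms_def by blast+
  have d1: "ext_deriv (theta1 G) p [v, w] = wedge 1 1 w01 (theta0 G) p [v, w] - wedge 1 1 w12 (theta2 G) p [v, w]"
    and d2: "ext_deriv (theta2 G) p [v, w] = - wedge 1 1 w20 (theta0 G) p [v, w] + wedge 1 1 w12 (theta1 G) p [v, w]"
    if "v \<in> tangent_space (frame_bundle U G) p" "w \<in> tangent_space (frame_bundle U G) p" for v w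
    using ext_deriv_leg_form_unique[OF U G bounded_linear_legs(1) h(1)[unfolded theta1_leg] p that]
      ext_deriv_leg_form_unique[OF U G bounded_linear_legs(2) h(2)[unfolded theta2_leg] p that]
    by (simp_all add: theta1_leg theta2_leg)
  have A: "(?A1 has_derivative (\<lambda>v. - ext_deriv (theta1 G) p [?s, v])) (at p)"
    "(?A2 has_derivative (\<lambda>v. - ext_deriv (theta2 G) p [?s, v])) (at p)"
    unfolding theta_frame_lift unfolding theta1_leg theta2_leg
    by (intro killing_leg_derivative[OF G S _ W] bounded_linear_legs; simp add: frame_lift_def case_prod_beta')+
  have th: "((\<lambda>q. theta1 G q [v]) has_derivative frechet_derivative (\<lambda>q. theta1 G q [v]) (at p)) (at p)"
    "((\<lambda>q. theta2 G q [v]) has_derivative frechet_derivative (\<lambda>q. theta2 G q [v]) (at p)) (at p)" for v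
    using smooth_thetas[OF U G] unfolding smooth_form_on_1_iff
    by (blast intro: smooth_on_has_derivative[OF _ W])+
  have D: "frechet_derivative (\<lambda>q. noether_frame_form G S q [v]) (at p) w =
     (?A1 p * frechet_derivative (\<lambda>q. theta2 G q [v]) (at p) w + - ext_deriv (theta1 G) p [?s, w] * theta2 G p [v]) -
     (?A2 p * frechet_derivative (\<lambda>q. theta1 G q [v]) (at p) w + - ext_deriv (theta2 G) p [?s, w] * theta1 G p [v])" for v w
  proof -
    have "((\<lambda>q. noether_frame_form G S q [v]) has_derivative (\<lambda>w.
     (?A1 p * frechet_derivative (\<lambda>q. theta2 G q [v]) (at p) w + - ext_deriv (theta1 G) p [?s, w] * theta2 G p [v]) -
     (?A2 p * frechet_derivative (\<lambda>q. theta1 G q [v]) (at p) w + - ext_deriv (theta2 G) p [?s, w] * theta1 G p [v]))) (at p)"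
      unfolding noether_frame_form_def by (intro has_derivative_diff has_derivative_mult A th)
    from frechet_derivative_eq_if_has_derivative[OF this] show ?thesis by simp
  qed
  have "ext_deriv (noether_frame_form G S) p [a, b] =
     ?A1 p * ext_deriv (theta2 G) p [a, b] - ?A2 p * ext_deriv (theta1 G) p [a, b]
     - (ext_deriv (theta1 G) p [?s, a] * theta2 G p [b] - ext_deriv (theta1 G) p [?s, b] * theta2 G p [a])
     + (ext_deriv (theta2 G) p [?s, a] * theta1 G p [b] - ext_deriv (theta2 G) p [?s, b] * theta1 G p [a])"
    unfolding ext_deriv_1[of "noether_frame_form G S"] D
    unfolding ext_deriv_1[of _ _ a b] by (simp add: algebra_simps)
  then show ?thesis
    unfolding d1[OF a(1) b(1)] d2[OF a(1) b(1)] d1[OF s a(1)] d1[OF s b(1)] d2[OF s a(1)] d2[OF s b(1)]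
      wedge_1_1 a(2) b(2)
    by (simp add: algebra_simps)
qed

section \<open>Closedness of the Noether form on a surface\<close>

text \<open>Here \<open>V\<close> is the domain of a chart and \<open>\<nu>\<close> the legendrian lift in the chart. Gram-Schmidt turns the
  lift into a moving frame near a point, whose first leg is the unit normal.\<close>

lemma ext_deriv_noether_minimal_chart:
  assumes U: "open U" and G: "riemannian_metric U G" and S: "killing_field U G S"
    and Psi0: "is_Psi0 U G \<Psi>\<^sub>0" and V: "open V" and \<nu>: "smooth_on V \<nu>" "\<nu> ` V \<subseteq> unit_bundle U G"
    and leg: "\<And>u w. u \<in> V \<Longrightarrow> pullback \<nu> (contact_form G) u [w] = 0"
    and u: "u \<in> V" and e: "(fst (\<nu> u), snd (\<nu> u), e1, e2) \<in> frame_bundle U G"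
  shows "ext_deriv (\<lambda>y vs. vol_form G (fst (\<nu> y)) [snd (\<nu> y), S (fst (\<nu> y)), fst (frechet_derivative \<nu> (at y) (hd vs))]) u [v, w] =
    - rinner G (fst (\<nu> u)) (snd (\<nu> u)) (S (fst (\<nu> u))) * pullback \<nu> \<Psi>\<^sub>0 u [v, w]"
proof -
  obtain w01 w20 w12 where conn: "connection_forms U G w01 w20 w12"
    and Psi0: "form_eq (frame_bundle U G) 2 (pullback frame_proj \<Psi>\<^sub>0)
          (\<lambda>p vs. - wedge 1 1 w20 (theta1 G) p vs - wedge 1 1 w01 (theta2 G) p vs)"
    using Psi0 unfolding is_Psi0_def by blast
  note B = open_basis_domain[OF U]
  define B0 where "B0 y = (fst (\<nu> y), snd (\<nu> y), e1, e2)" for y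
  define V' where "V' = V \<inter> B0 -` basis_domain U"
  define E where "E y = gram_schmidt G (B0 y)" for y
  have sB0: "smooth_on V B0" unfolding B0_def by (intro smooth_intros V \<nu>)
  have V': "open V'" "u \<in> V'" "V' \<subseteq> V"
    using open_preimage[OF V sB0 B] u e frame_bundle_subset[OF G] by (auto simp: V'_def B0_def)
  have sE: "smooth_on V' E"
    unfolding E_def using smooth_on_subset[OF sB0 V'(3)]
    by - (rule smooth_on_compose[OF V'(1) _ _ smooth_on_gram_schmidt[OF U G]], auto simp: V'_def)
  have EF: "E y \<in> frame_bundle U G" if "y \<in> V'" for y
    using gram_schmidt_in_frame_bundle[OF G] that by (simp add: E_def V'_def)
  have E0: "fst (E y) = fst (\<nu> y)" "fst (snd (E y)) = snd (\<nu> y)" if "y \<in> V" for y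
  proof -
    have "rinner G (fst (\<nu> y)) (snd (\<nu> y)) (snd (\<nu> y)) = 1"
      using \<nu>(2) that by (force simp: unit_bundle_def)
    then show "fst (E y) = fst (\<nu> y)" "fst (snd (E y)) = snd (\<nu> y)"
      by (simp_all add: E_def B0_def gram_schmidt_def gs0_def gs_unit_idem)
  qed
  have Eu: "E u = B0 u" using gram_schmidt_frame[OF e] by (simp add: E_def B0_def)
  have proj: "frame_proj q = (fst q, fst (snd q))" for q by (simp add: frame_proj_def case_prod_beta')
  have lin: "bounded_linear frame_proj"
    unfolding proj[abs_def] by (intro bounded_linear_Pair bounded_linear_fst bounded_linear_fst_comp bounded_linear_snd)
  let ?E' = "\<lambda>y. frechet_derivative E (at y)"
  have DE: "frame_proj (?E' y z) = frechet_derivative \<nu> (at y) z" if y: "y \<in> V'" for y z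
  proof -
    have "((\<lambda>y. frame_proj (E y)) has_derivative (\<lambda>z. frame_proj (?E' y z))) (at y)"
      using smooth_on_has_derivative[OF sE y] by (rule bounded_linear.has_derivative[OF lin])
    then have "(\<nu> has_derivative (\<lambda>z. frame_proj (?E' y z))) (at y)"
      by (rule has_derivative_transform_within_open[OF _ V'(1) y]) (use E0 V' in \<open>auto simp: proj\<close>)
    then show ?thesis by (simp add: frechet_derivative_eq_if_has_derivative)
  qed
  have DE1: "fst (?E' y z) = fst (frechet_derivative \<nu> (at y) z)" if "y \<in> V'" for y z
    using DE[OF that, of z] by (metis fst_conv proj)
  let ?a = "?E' u v" and ?b = "?E' u w"
  have T: "?E' u z \<in> tangent_space (frame_bundle U G) (E u)" for z
    using EF by (intro tangent_space_image[OF V'(1) sE _ V'(2)]) auto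
  have th0: "theta0 G (E u) [?E' u z] = 0" for z
    using leg[OF u, of z] DE1[OF V'(2), of z]
    by (simp add: Eu B0_def theta0_def pullback_def contact_form_def case_prod_beta')
  have "ext_deriv (\<lambda>y vs. vol_form G (fst (\<nu> y)) [snd (\<nu> y), S (fst (\<nu> y)), fst (frechet_derivative \<nu> (at y) (hd vs))]) u [v, w]
    = ext_deriv (pullback E (noether_frame_form G S)) u [v, w]"
  proof (rule ext_deriv_1_cong[OF V'(1,2)])
    fix y z assume y: "y \<in> V'"
    have yV: "y \<in> V" using y V' by blast
    have "(fst (\<nu> y), snd (\<nu> y), fst (snd (snd (E y))), snd (snd (snd (E y)))) \<in> frame_bundle U G"
      using EF[OF y] E0[OF yV] by (metis prod.collapse)
    from frame_vol[OF G this]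
    show "vol_form G (fst (\<nu> y)) [snd (\<nu> y), S (fst (\<nu> y)), fst (frechet_derivative \<nu> (at y) (hd [z]))] =
      pullback E (noether_frame_form G S) y [z]"
      unfolding pullback_def noether_frame_form_def theta_frame_lift
      by (simp add: theta1_leg theta2_leg leg_form_def E0[OF yV] DE1[OF y])
  qed
  also have "\<dots> = ext_deriv (noether_frame_form G S) (E u) [?a, ?b]"
    using EF frame_bundle_subset[OF G] S
    by (intro ext_deriv_pullback[OF smooth_noether_frame_form[OF U G] B V'(1) _ sE V'(2)])
       (auto simp: killing_field_def)
  also have "\<dots> = - theta0 G (E u) [frame_lift S (E u)] *
      (- wedge 1 1 w20 (theta1 G) (E u) [?a, ?b] - wedge 1 1 w01 (theta2 G) (E u) [?a, ?b])"
    by (rule ext_deriv_noether_frame_form[OF U G S conn EF[OF V'(2)] T th0 T th0])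
  also have "- wedge 1 1 w20 (theta1 G) (E u) [?a, ?b] - wedge 1 1 w01 (theta2 G) (E u) [?a, ?b] =
      pullback frame_proj \<Psi>\<^sub>0 (E u) [?a, ?b]"
    using Psi0 EF[OF V'(2)] T unfolding form_eq_def by simp
  also have "\<dots> = pullback \<nu> \<Psi>\<^sub>0 u [v, w]"
    using frechet_derivative_eq_if_has_derivative[OF bounded_linear_imp_has_derivative[OF lin], of "E u"]
      DE[OF V'(2)] E0[OF u] by (simp add: pullback_def) (simp add: proj)
  finally show ?thesis
    by (simp add: Eu B0_def theta_frame_lift)
qed

text \<open>On a CMC lift \<open>\<Psi>\<^sub>0 = -2H \<Lambda>\<^sub>0\<close>, so the minimal part contributes \<open>2H \<theta>\<^sup>0(S) \<Lambda>\<^sub>0\<close>, and the CMC part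
  contributes \<open>-2H S \<lrcorner> vol\<^sub>M\<close>. These cancel because the volume form evaluated on \<open>S\<close> and two tangent
  vectors sees only the normal component of \<open>S\<close>.\<close>

lemma ext_deriv_noether_chart:
  assumes U: "open U" and G: "riemannian_metric U G" and S: "killing_field U G S"
    and F: "potential_vector U G S F"
    and Psi0: "is_Psi0 U G \<Psi>\<^sub>0" and V: "open V" and \<nu>: "smooth_on V \<nu>" "\<nu> ` V \<subseteq> unit_bundle U G"
    and leg: "\<And>u w. u \<in> V \<Longrightarrow> pullback \<nu> (contact_form G) u [w] = 0"
    and cmc: "pullback \<nu> (Psi G H \<Psi>\<^sub>0) u [v, w] = 0"
    and u: "u \<in> V" and e: "(fst (\<nu> u), snd (\<nu> u), e1, e2) \<in> frame_bundle U G"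
  shows "ext_deriv (\<lambda>y vs. vol_form G (fst (\<nu> y)) [snd (\<nu> y), S (fst (\<nu> y)), fst (frechet_derivative \<nu> (at y) (hd vs))]
      - 2 * H * flat G F (fst (\<nu> y)) [fst (frechet_derivative \<nu> (at y) (hd vs))]) u [v, w] = 0"
    (is "ext_deriv (\<lambda>y vs. ?\<alpha> y vs - 2 * H * ?\<beta> y vs) u [v, w] = 0")
proof -
  let ?f = "\<lambda>y. fst (\<nu> y)" and ?x = "fst (\<nu> u)" and ?n = "snd (\<nu> u)"
  let ?d = "\<lambda>z. fst (frechet_derivative \<nu> (at u) z)"
  have fV: "?f ` V \<subseteq> U" using \<nu>(2) by (force simp: unit_bundle_def)
  have sf: "smooth_on V ?f" by (intro smooth_intros V \<nu>)
  have sS: "smooth_on U S" and sF: "smooth_on U F"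
    using S F by (auto simp: killing_field_def potential_vector_def)
  have D\<nu>: "smooth_on V (\<lambda>y. fst (frechet_derivative \<nu> (at y) z))" for z
    by (intro smooth_intros V smooth_on_derivative \<nu>)
  have flat: "smooth_form_on U (Suc 0) (flat G F)"
    unfolding smooth_form_on_1_iff flat_def
    using smooth_on_rinner[OF G U _ smooth_on_ident sF smooth_on_const]
      linear_rinner_right[OF linear_ident] by simp
  have Df: "frechet_derivative ?f (at y) z = fst (frechet_derivative \<nu> (at y) z)" if "y \<in> V" for y z
    using frechet_derivative_eq_if_has_derivative[OF has_derivative_fst[OF smooth_on_has_derivative[OF \<nu>(1) that]]] by simp
  have "smooth_on V (\<lambda>y. ?\<alpha> y [z])" for z
    by (simp, intro smooth_on_vol_form[OF G V fV] sf smooth_intros V \<nu> smooth_on_compose[OF V fV sf sS] D\<nu>)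
  moreover have "smooth_on V (\<lambda>y. ?\<beta> y [z])" for z
    by (simp, intro smooth_on_form_apply[OF flat V fV sf D\<nu>])
  ultimately have "((\<lambda>y. ?\<alpha> y [z] - 2 * H * ?\<beta> y [z]) has_derivative (\<lambda>h. frechet_derivative (\<lambda>y. ?\<alpha> y [z]) (at u) h
      - 2 * H * frechet_derivative (\<lambda>y. ?\<beta> y [z]) (at u) h)) (at u)" for z
    using u by (intro has_derivative_diff has_derivative_mult_right smooth_on_has_derivative) auto
  from frechet_derivative_eq_if_has_derivative[OF this]
  have "ext_deriv (\<lambda>y vs. ?\<alpha> y vs - 2 * H * ?\<beta> y vs) u [v, w] = ext_deriv ?\<alpha> u [v, w] - 2 * H * ext_deriv ?\<beta> u [v, w]"
    unfolding ext_deriv_1 by (simp add: algebra_simps)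
  also have "ext_deriv ?\<alpha> u [v, w] = - rinner G ?x ?n (S ?x) * pullback \<nu> \<Psi>\<^sub>0 u [v, w]"
    by (rule ext_deriv_noether_minimal_chart[OF U G S Psi0 V \<nu> leg u e])
  also have "pullback \<nu> \<Psi>\<^sub>0 u [v, w] = - 2 * H * vol_form G ?x [?n, ?d v, ?d w]"
    using cmc by (simp add: pullback_def Psi_def Lambda0_def case_prod_beta')
  also have "ext_deriv ?\<beta> u [v, w] = ext_deriv (pullback ?f (flat G F)) u [v, w]"
    by (rule ext_deriv_1_cong[OF V u]) (simp add: pullback_def Df)
  also have "\<dots> = ext_deriv (flat G F) ?x [?d v, ?d w]"
    using ext_deriv_pullback[OF flat U V fV sf u, of v w] Df[OF u] by simp
  also have "\<dots> = vol_form G ?x [S ?x, ?d v, ?d w]"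
    using F fV u by (auto simp: potential_vector_def interior_product_def)
  also have "\<dots> = rinner G ?x ?n (S ?x) * vol_form G ?x [?n, ?d v, ?d w]"
    using leg[OF u, of v] leg[OF u, of w]
    by (intro frame_vol_tangent[OF G e]) (simp_all add: pullback_def contact_form_def case_prod_beta')
  finally show ?thesis by simp
qed

section \<open>The Noether form on the unit bundle\<close>

text \<open>The lifted generator is the velocity of a curve in the unit bundle. Its first component is the
  velocity of the flow line only once that whole curve is known to be differentiable, and its second
  component is, being a partial derivative of the smooth flow.\<close>

lemma fst_lifted_generator:
  assumes \<phi>: "local_flow U S \<phi>" and x: "x \<in> U"
  shows "fst (lifted_generator \<phi> (x, e0)) = S x"
proof -
  let ?\<Phi> = "\<lambda>(t, x). \<phi> t x"
  obtain D where D: "open D" "{0} \<times> U \<subseteq> D" "smooth_on D ?\<Phi>" "\<forall>x\<in>U. \<phi> 0 x = x"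
    and flow: "\<forall>(t, x)\<in>D. \<phi> t x \<in> U \<and> ((\<lambda>s. \<phi> s x) has_vector_derivative S (\<phi> t x)) (at t)"
    using \<phi> unfolding local_flow_def by blast
  let ?i = "\<lambda>t::real. (t, x)"
  have i: "(?i has_derivative (\<lambda>s. (s, 0))) (at t)" for t
    by (auto intro!: derivative_eq_intros)
  have T: "open (?i -` D)" "0 \<in> ?i -` D"
    using D x by (auto intro!: open_vimage continuous_intros)
  have "((\<lambda>s. \<phi> s x) has_vector_derivative S (\<phi> 0 x)) (at 0)"
    using flow T(2) by fastforce
  then have base: "((\<lambda>t. \<phi> t x) has_vector_derivative S x) (at 0)" using D(4) x by simp
  have e: "frechet_derivative ?\<Phi> (at (t, x)) (0, e0) = frechet_derivative (\<phi> t) (at x) e0" if "t \<in> ?i -` D" for t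
  proof -
    have "((\<lambda>y. (t, y)) has_derivative (\<lambda>v. (0, v))) (at x)" by (auto intro!: derivative_eq_intros)
    moreover have "(?\<Phi> has_derivative frechet_derivative ?\<Phi> (at (t, x))) (at (t, x))"
      using that by (intro smooth_on_has_derivative[OF D(3)]) simp
    ultimately have "((\<lambda>y. ?\<Phi> (t, y)) has_derivative (\<lambda>v. frechet_derivative ?\<Phi> (at (t, x)) (0, v))) (at x)"
      by (rule has_derivative_compose)
    from frechet_derivative_eq_if_has_derivative[OF this] show ?thesis by simp
  qed
  obtain g where "((\<lambda>t. frechet_derivative ?\<Phi> (at (t, x)) (0, e0)) has_derivative g) (at 0)"
    using has_derivative_compose[OF i smooth_on_has_derivative[OF smooth_on_derivative[OF D(3)]], of 0] T(2) by auto
  then have g: "((\<lambda>t. frechet_derivative (\<phi> t) (at x) e0) has_derivative g) (at 0)"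
    by (rule has_derivative_transform_within_open[OF _ T e])
  have g1: "g s = s *\<^sub>R g 1" for s
    using linear_cmul[OF has_derivative_linear[OF g], of s 1] by simp
  have "((\<lambda>t. frechet_derivative (\<phi> t) (at x) e0) has_vector_derivative g 1) (at 0)"
    unfolding has_vector_derivative_def by (rule has_derivative_eq_rhs[OF g]) (rule ext, rule g1)
  then have "((\<lambda>t. (\<phi> t x, frechet_derivative (\<phi> t) (at x) e0)) has_vector_derivative (S x, g 1)) (at 0)"
    by (rule has_vector_derivative_Pair[OF base])
  then show ?thesis by (simp add: lifted_generator_def vector_derivative_at)
qed

lemma noether_minimal_apply:
  assumes "local_flow U S \<phi>" "fst p \<in> U"
  shows "noether_minimal G \<phi> p [v] = vol_form G (fst p) [snd p, S (fst p), fst v]"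
  using fst_lifted_generator[OF assms, of "snd p"]
  by (simp add: noether_minimal_def interior_product_def Lambda0_def case_prod_beta')

lemma noether_cmc_apply: "noether_cmc G F p [v] = flat G F (fst p) [fst v]"
proof -
  have "frechet_derivative fst (at p) = fst"
    by (intro frechet_derivative_eq_if_has_derivative bounded_linear_imp_has_derivative bounded_linear_fst)
  then show ?thesis by (simp add: noether_cmc_def pullback_def)
qed

lemma smooth_noether_representative:
  assumes U: "open U" and G: "riemannian_metric U G" and \<phi>: "local_flow U S \<phi>"
    and S: "smooth_on U S" and F: "smooth_on U F"
  shows "smooth_form (unit_bundle U G) 1 (\<lambda>p vs. noether_minimal G \<phi> p vs - 2 * H * noether_cmc G F p vs)"
  unfolding smooth_form_def
proof (intro ballI exI conjI allI impI)
  let ?W = "U \<times> (UNIV :: (real^3) set)"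
  let ?\<omega> = "\<lambda>p vs. vol_form G (fst p) [snd p, S (fst p), fst (hd vs)] - 2 * H * flat G F (fst p) [fst (hd vs)]"
  fix p assume "p \<in> unit_bundle U G"
  then show "p \<in> ?W" by (auto simp: unit_bundle_def)
  show W: "open ?W" using U by (intro open_Times open_UNIV)
  have x: "fst ` ?W \<subseteq> U" by auto
  have "linear (\<lambda>v. ?\<omega> p [v])" for p
    by (rule linearI)
       (simp_all add: vol_form_def flat_def det_vector_3_simps rinner_simps algebra_simps)
  moreover have "smooth_on ?W (\<lambda>p. ?\<omega> p [v])" for v
    unfolding flat_def list.sel
    by (intro smooth_intros smooth_on_vol_form[OF G W x] smooth_on_rinner[OF G W x] W
        smooth_on_compose[OF W x _ S] smooth_on_compose[OF W x _ F])
  ultimately show "smooth_form_on ?W 1 ?\<omega>"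
    unfolding One_nat_def smooth_form_on_1_iff by blast
  fix q and vs :: "contact_pt list"
  assume q: "q \<in> unit_bundle U G \<inter> ?W" and "length vs = 1 \<and> set vs \<subseteq> tangent_space (unit_bundle U G) q"
  then obtain v where "vs = [v]" by (auto simp: length_1_iff)
  then show "noether_minimal G \<phi> q vs - 2 * H * noether_cmc G F q vs = ?\<omega> q vs"
    using q noether_minimal_apply[OF \<phi>, of q G v] by (simp add: noether_cmc_apply mem_Times_iff)
qed

section \<open>The Noether form on an immersed surface\<close>

text \<open>Gram-Schmidt on the images of the coordinate vectors; it acts on the coordinate vectors by a
  triangular matrix with positive diagonal, which keeps the orientation.\<close>

lemma tangent_frame_exists:
  assumes G: "riemannian_metric U G" and x: "f (snd c u) \<in> U"
    and lin: "linear (df f c u)" and inj: "inj (df f c u)"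
  shows "\<exists>e1 e2. tangent_frame G f c u e1 e2"
proof -
  let ?x = "f (snd c u)" and ?T = "df f c u"
  let ?i = "axis 1 1 :: real^2" and ?j = "axis 2 1 :: real^2"
  have nz: "?T w \<noteq> 0" if "w \<noteq> 0" for w
    using that lin inj linear_injective_0 by blast
  define k where "k = inverse (sqrt (rinner G ?x (?T ?i) (?T ?i)))"
  define e1 where "e1 = gs_unit G ?x (?T ?i)"
  have i: "?T ?i \<noteq> 0" by (rule nz) (simp add: axis_eq_0_iff)
  have e1: "e1 = ?T (k *\<^sub>R ?i)" by (simp add: e1_def k_def gs_unit_def linear_cmul[OF lin])
  have k: "k > 0" unfolding k_def by (rule gs_unit_scale_pos[OF G x i])
  define b where "b = ?j - rinner G ?x e1 (?T ?j) *\<^sub>R (k *\<^sub>R ?i)"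
  have b: "gs_reject G ?x e1 (?T ?j) = ?T b"
    by (simp add: gs_reject_def b_def e1 linear_diff[OF lin] linear_cmul[OF lin])
  have "b $ 2 = 1" by (simp add: b_def axis_def)
  then have Tb: "?T b \<noteq> 0" by (intro nz) auto
  define l where "l = inverse (sqrt (rinner G ?x (?T b) (?T b)))"
  define e2 where "e2 = gs_unit G ?x (?T b)"
  have e2: "e2 = ?T (l *\<^sub>R b)" by (simp add: e2_def l_def gs_unit_def linear_cmul[OF lin])
  have l: "l > 0" unfolding l_def by (rule gs_unit_scale_pos[OF G x Tb])
  have "det (vector [k *\<^sub>R ?i, l *\<^sub>R b] :: real^2^2) = k * l"
    using \<open>b $ 2 = 1\<close> by (simp add: det_2 axis_def)
  then have d: "det (vector [k *\<^sub>R ?i, l *\<^sub>R b] :: real^2^2) > 0" using k l by simp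
  have n1: "rinner G ?x e1 e1 = 1" unfolding e1_def by (rule gs_unit_norm[OF G x i])
  have n2: "rinner G ?x e2 e2 = 1" unfolding e2_def by (rule gs_unit_norm[OF G x Tb])
  have "rinner G ?x e1 e2 = 0"
    unfolding e2_def b[symmetric] by (intro gs_unit_orthogonal gs_reject_orthogonal n1)
  then show ?thesis
    unfolding tangent_frame_def using d e1 e2 n1 n2 by blast
qed

lemma legendrian_chart:
  assumes \<Sigma>: "oriented_surface \<Sigma> A" and N: "legendrian_lift U G \<Sigma> A f N" and c: "c \<in> A"
  defines "\<nu> \<equiv> N \<circ> snd c"
  shows "open (fst c)" "smooth_on (fst c) \<nu>" "\<nu> ` fst c \<subseteq> unit_bundle U G"
    "\<And>u w. u \<in> fst c \<Longrightarrow> pullback \<nu> (contact_form G) u [w] = 0"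
    "\<And>u. u \<in> fst c \<Longrightarrow> fst (\<nu> u) = f (snd c u)"
    "\<And>u w. u \<in> fst c \<Longrightarrow> fst (frechet_derivative \<nu> (at u) w) = df f c u w"
    "\<And>u. u \<in> fst c \<Longrightarrow> f (snd c u) \<in> U"
proof -
  show o: "open (fst c)" by (rule surface_chart_open[OF \<Sigma> c])
  show s: "smooth_on (fst c) \<nu>" using N c by (simp add: legendrian_lift_def surface_smooth_def \<nu>_def)
  show X: "\<nu> ` fst c \<subseteq> unit_bundle U G"
    using N surface_chart_in[OF \<Sigma> c] by (auto simp: legendrian_lift_def \<nu>_def)
  show "pullback \<nu> (contact_form G) u [w] = 0" if "u \<in> fst c" for u w
    using N c that by (auto simp: legendrian_lift_def surface_form_eq_def surface_pullback_def \<nu>_def)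
  show f: "fst (\<nu> u) = f (snd c u)" if "u \<in> fst c" for u
    using N surface_chart_in[OF \<Sigma> c that] by (simp add: legendrian_lift_def \<nu>_def)
  show "fst (frechet_derivative \<nu> (at u) w) = df f c u w" if u: "u \<in> fst c" for u w
  proof -
    have "((\<lambda>y. fst (\<nu> y)) has_derivative (\<lambda>w. fst (frechet_derivative \<nu> (at u) w))) (at u)"
      by (rule has_derivative_fst[OF smooth_on_has_derivative[OF s u]])
    then have "((f \<circ> snd c) has_derivative (\<lambda>w. fst (frechet_derivative \<nu> (at u) w))) (at u)"
      by (rule has_derivative_transform_within_open[OF _ o u]) (simp add: f)
    from frechet_derivative_eq_if_has_derivative[OF this] show ?thesis by (simp add: df_def)
  qed
  show "f (snd c u) \<in> U" if "u \<in> fst c" for u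
  proof -
    have "\<nu> u \<in> unit_bundle U G" using X that by blast
    then show ?thesis using f[OF that] by (auto simp: unit_bundle_def)
  qed
qed

lemma tangent_frame_some:
  assumes G: "riemannian_metric U G" and \<Sigma>: "oriented_surface \<Sigma> A" and N: "legendrian_lift U G \<Sigma> A f N"
    and f: "immersion_into \<Sigma> A U f" and c: "c \<in> A" and u: "u \<in> fst c"
    and SOME: "(e1, e2) = (SOME (e1, e2). tangent_frame G f c u e1 e2)"
  shows "tangent_frame G f c u e1 e2"
proof -
  note ch = legendrian_chart[OF \<Sigma> N c]
  have "(f \<circ> snd c) differentiable (at u)"
    using f c u by (auto simp: immersion_into_def surface_smooth_def intro: smooth_on_differentiable)
  then have "linear (df f c u)" unfolding df_def[abs_def] by (rule linear_frechet_derivative)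
  moreover have "inj (df f c u)" using f c u by (simp add: immersion_into_def df_def[abs_def])
  ultimately obtain d1 d2 where "tangent_frame G f c u d1 d2"
    using tangent_frame_exists[of U G f c u, OF G ch(7)[OF u]] by blast
  then have "case (SOME (e1, e2). tangent_frame G f c u e1 e2) of (e1, e2) \<Rightarrow> tangent_frame G f c u e1 e2"
    by (intro someI[of "\<lambda>(e1, e2). tangent_frame G f c u e1 e2" "(d1, d2)"]) simp
  then show ?thesis unfolding SOME[symmetric] by simp
qed

text \<open>The first leg is orthogonal to the others because the lift is legendrian; the orientation of
  the surface makes the frame positive.\<close>

lemma adapted_frame:
  assumes G: "riemannian_metric U G" and \<Sigma>: "oriented_surface \<Sigma> A" and N: "legendrian_lift U G \<Sigma> A f N"
    and or: "oriented_by_normal G A f N" and c: "c \<in> A" and u: "u \<in> fst c"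
    and t: "tangent_frame G f c u e1 e2"
  shows "(f (snd c u), snd (N (snd c u)), e1, e2) \<in> frame_bundle U G"
proof -
  note ch = legendrian_chart[OF \<Sigma> N c]
  let ?x = "f (snd c u)" and ?n = "snd (N (snd c u))"
  have "(N \<circ> snd c) u \<in> unit_bundle U G" using ch(3) u by blast
  then have "rinner G ?x ?n ?n = 1" using ch(5)[OF u] by (simp add: unit_bundle_def case_prod_beta')
  moreover have "rinner G ?x ?n (df f c u w) = 0" for w
    using ch(4)[OF u, of w] ch(5,6)[OF u] by (simp add: pullback_def contact_form_def case_prod_beta')
  moreover have "vol_form G ?x [?n, e1, e2] > 0" using or c u t by (simp add: oriented_by_normal_def)
  ultimately show ?thesis using t ch(7)[OF u] by (auto simp: frame_bundle_def tangent_frame_def)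
qed

text \<open>In a frame \<open>(N, e\<^sub>1, e\<^sub>2)\<close> adapted to the surface, \<open>vol\<^sub>M(N, S, \<cdot>) = \<theta>\<^sup>1(S) \<theta>\<^sup>2 - \<theta>\<^sup>2(S) \<theta>\<^sup>1\<close>, which is
  \<open>\<langle>S, *df\<rangle>\<close>.\<close>

lemma pullback_noether_minimal:
  assumes G: "riemannian_metric U G" and \<Sigma>: "oriented_surface \<Sigma> A" and f: "immersion_into \<Sigma> A U f"
    and N: "legendrian_lift U G \<Sigma> A f N" and or: "oriented_by_normal G A f N" and \<phi>: "local_flow U S \<phi>"
  shows "surface_form_eq A 1 (surface_pullback N (noether_minimal G \<phi>)) (inner_star_df G S f)"
  unfolding surface_form_eq_def
proof (intro ballI allI impI)
  fix c u and ws :: "(real^2) list"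
  assume c: "c \<in> A" and u: "u \<in> fst c" and "length ws = 1"
  then obtain w where ws: "ws = [w]" by (auto simp: length_1_iff)
  note ch = legendrian_chart[OF \<Sigma> N c]
  let ?x = "f (snd c u)" and ?n = "snd (N (snd c u))"
  obtain e1 e2 where e: "(e1, e2) = (SOME (e1, e2). tangent_frame G f c u e1 e2)" by (metis prod.collapse)
  note fr = adapted_frame[OF G \<Sigma> N or c u tangent_frame_some[OF G \<Sigma> N f c u e]]
  have "surface_pullback N (noether_minimal G \<phi>) c u ws = vol_form G ?x [?n, S ?x, df f c u w]"
    using noether_minimal_apply[OF \<phi>, of "N (snd c u)"] ch(5-7)[OF u]
    by (simp add: surface_pullback_def pullback_def ws)
  also have "\<dots> = inner_star_df G S f c u ws"
    unfolding frame_vol[OF G fr] inner_star_df_def star_df_def e[symmetric] ws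
    using rinner_commute[OF G ch(7)[OF u], of e1 "S ?x"] rinner_commute[OF G ch(7)[OF u], of e2 "S ?x"]
    by (simp add: rinner_simps)
  finally show "surface_pullback N (noether_minimal G \<phi>) c u ws = inner_star_df G S f c u ws" .
qed

lemma pullback_noether_cmc:
  assumes \<Sigma>: "oriented_surface \<Sigma> A" and N: "legendrian_lift U G \<Sigma> A f N"
  shows "surface_form_eq A 1 (surface_pullback N (noether_cmc G F)) (inner_df G F f)"
  unfolding surface_form_eq_def
proof (intro ballI allI impI)
  fix c u and ws :: "(real^2) list"
  assume c: "c \<in> A" and u: "u \<in> fst c" and "length ws = 1"
  then obtain w where "ws = [w]" by (auto simp: length_1_iff)
  then show "surface_pullback N (noether_cmc G F) c u ws = inner_df G F f c u ws"
    using legendrian_chart(5,6)[OF \<Sigma> N c u]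
    by (simp add: surface_pullback_def pullback_def noether_cmc_apply inner_df_def flat_def)
qed

lemma pullback_noether_closed:
  assumes U: "open U" and G: "riemannian_metric U G" and Psi0: "is_Psi0 U G \<Psi>\<^sub>0"
    and \<Sigma>: "oriented_surface \<Sigma> A" and f: "immersion_into \<Sigma> A U f"
    and N: "legendrian_lift U G \<Sigma> A f N" and or: "oriented_by_normal G A f N"
    and cmc: "cmc_lift G H \<Psi>\<^sub>0 A N"
    and S: "killing_field U G S" and \<phi>: "local_flow U S \<phi>" and F: "potential_vector U G S F"
  shows "surface_pullback N (\<lambda>p vs. noether_minimal G \<phi> p vs - 2 * H * noether_cmc G F p vs) \<in> closed_1forms A"
    (is "surface_pullback N ?\<mu> \<in> _")
proof -
  have "smooth_form (unit_bundle U G) 1 ?\<mu>"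
    using S F by (intro smooth_noether_representative[OF U G \<phi>]) (auto simp: killing_field_def potential_vector_def)
  then have "smooth_surface_form A 1 (surface_pullback N ?\<mu>)"
    using N by (intro smooth_surface_form_pullback[OF \<Sigma>]) (auto simp: legendrian_lift_def)
  moreover have "ext_deriv (pullback (N \<circ> snd c) ?\<mu>) u [v, w] = 0" if c: "c \<in> A" and u: "u \<in> fst c" for c u v w
  proof -
    note ch = legendrian_chart[OF \<Sigma> N c]
    let ?\<nu> = "N \<circ> snd c"
    obtain e1 e2 where "(e1, e2) = (SOME (e1, e2). tangent_frame G f c u e1 e2)" by (metis prod.collapse)
    then have e: "(fst (?\<nu> u), snd (?\<nu> u), e1, e2) \<in> frame_bundle U G"
      using adapted_frame[OF G \<Sigma> N or c u tangent_frame_some[OF G \<Sigma> N f c u]] ch(5)[OF u] by simp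
    have cmc': "pullback ?\<nu> (Psi G H \<Psi>\<^sub>0) u [v, w] = 0"
      using cmc c u by (simp add: cmc_lift_def surface_form_eq_def surface_pullback_def)
    have "ext_deriv (pullback ?\<nu> ?\<mu>) u [v, w] = ext_deriv (\<lambda>y vs. vol_form G (fst (?\<nu> y)) [snd (?\<nu> y),
         S (fst (?\<nu> y)), fst (frechet_derivative ?\<nu> (at y) (hd vs))]
      - 2 * H * flat G F (fst (?\<nu> y)) [fst (frechet_derivative ?\<nu> (at y) (hd vs))]) u [v, w]"
    proof (rule ext_deriv_1_cong[OF ch(1) u])
      fix y z assume y: "y \<in> fst c"
      then have "fst (?\<nu> y) \<in> U" using ch(5,7) by simp
      then show "pullback ?\<nu> ?\<mu> y [z] = vol_form G (fst (?\<nu> y)) [snd (?\<nu> y),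
         S (fst (?\<nu> y)), fst (frechet_derivative ?\<nu> (at y) (hd [z]))]
          - 2 * H * flat G F (fst (?\<nu> y)) [fst (frechet_derivative ?\<nu> (at y) (hd [z]))]"
        using noether_minimal_apply[OF \<phi>, of "?\<nu> y"] by (simp add: pullback_def noether_cmc_apply)
    qed
    also have "\<dots> = 0"
      by (rule ext_deriv_noether_chart[OF U G S F Psi0 ch(1-4) cmc' u e])
    finally show ?thesis .
  qed
  ultimately show ?thesis
    by (auto simp: closed_1forms_def surface_form_eq_def surface_ext_deriv_def surface_pullback_def
        numeral_2_eq_2 length_2_iff)
qed

lemma pullback_cmc_ideal:
  assumes \<Sigma>: "oriented_surface \<Sigma> A" and N: "legendrian_lift U G \<Sigma> A f N" and c: "c \<in> A"
    and \<epsilon>: "cmc_ideal U G H \<Psi>\<^sub>0 1 \<epsilon>" and u: "u \<in> fst c"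
  shows "pullback (N \<circ> snd c) \<epsilon> u [w] = 0"
proof (rule pullback_diff_ideal_vanishes[OF \<epsilon>[unfolded cmc_ideal_def]])
  note ch = legendrian_chart[OF \<Sigma> N c]
  show "open (fst c)" "smooth_on (fst c) (N \<circ> snd c)" "(N \<circ> snd c) ` fst c \<subseteq> unit_bundle U G"
    by (rule ch)+
  fix k \<omega> y and ws :: "(real^2) list"
  assume "(k, \<omega>) \<in> {(1, contact_form G)} \<union>
        {(2, \<delta>) | \<delta>. has_ext_deriv (unit_bundle U G) 1 (contact_form G) \<delta>} \<union> {(2, Psi G H \<Psi>\<^sub>0)}"
    and "k \<le> 1" "y \<in> fst c" "length ws = k"
  then show "pullback (N \<circ> snd c) \<omega> y ws = 0" using ch(4) by (auto simp: length_1_iff)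
qed (use u in auto)

text \<open>Representatives of one class differ by an exact form, whose pullback is exact, and by an element of
  the ideal, whose pullback vanishes.\<close>

lemma pullback_noether_class:
  assumes \<Sigma>: "oriented_surface \<Sigma> A" and N: "legendrian_lift U G \<Sigma> A f N"
    and \<mu>: "surface_pullback N \<mu> \<in> closed_1forms A"
    and \<eta>: "\<eta> \<in> class_mod_ideal U G H \<Psi>\<^sub>0 \<mu>"
  shows "(surface_pullback N \<mu>, surface_pullback N \<eta>) \<in> cohomologous A"
proof -
  obtain h \<xi> \<epsilon> where \<eta>: "smooth_form (unit_bundle U G) 1 \<eta>" and h: "smooth_form (unit_bundle U G) 0 h"
    and \<xi>: "has_ext_deriv (unit_bundle U G) 0 h \<xi>" and \<epsilon>: "cmc_ideal U G H \<Psi>\<^sub>0 1 \<epsilon>"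
    and eq: "form_eq (unit_bundle U G) 1 \<eta> (\<lambda>p vs. \<mu> p vs + \<xi> p vs + \<epsilon> p vs)"
    using \<eta> unfolding class_mod_ideal_def by blast
  have N': "surface_smooth A N" "N ` topspace \<Sigma> \<subseteq> unit_bundle U G" using N by (auto simp: legendrian_lift_def)
  have sh: "smooth_surface_form A 0 (surface_pullback N h)"
    by (rule smooth_surface_form_pullback[OF \<Sigma> N' h]) simp
  have s\<eta>: "smooth_surface_form A 1 (surface_pullback N \<eta>)"
    by (rule smooth_surface_form_pullback[OF \<Sigma> N' \<eta>]) simp
  have "surface_pullback N \<eta> c u [w] - surface_pullback N \<mu> c u [w] = surface_ext_deriv (surface_pullback N h) c u [w]"
    if c: "c \<in> A" and u: "u \<in> fst c" for c u w
  proof -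
    note ch = legendrian_chart[OF \<Sigma> N c]
    let ?\<nu> = "N \<circ> snd c"
    have "?\<nu> u \<in> unit_bundle U G" using ch(3) u by blast
    then have "pullback ?\<nu> \<eta> u [w] = pullback ?\<nu> \<mu> u [w] + pullback ?\<nu> \<xi> u [w] + pullback ?\<nu> \<epsilon> u [w]"
      using eq tangent_space_image[OF ch(1-3) u] by (simp add: form_eq_def pullback_def)
    also have "pullback ?\<nu> \<xi> u [w] = ext_deriv (pullback ?\<nu> h) u [w]"
      by (rule pullback_has_ext_deriv_0[OF \<xi> ch(1-3) u])
    also have "pullback ?\<nu> \<epsilon> u [w] = 0" by (rule pullback_cmc_ideal[OF \<Sigma> N c \<epsilon> u])
    finally show ?thesis by (simp add: surface_pullback_def surface_ext_deriv_def o_def)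
  qed
  then have e: "surface_form_eq A 1 (\<lambda>c u ws. surface_pullback N \<eta> c u ws - surface_pullback N \<mu> c u ws)
      (surface_ext_deriv (surface_pullback N h))"
    by (auto simp: surface_form_eq_def length_1_iff)
  then show ?thesis
    using \<mu> sh closed_1forms_add_exact[OF \<Sigma> \<mu> s\<eta> sh e] unfolding cohomologous_def by blast
qed

lemma mem_class_mod_ideal:
  assumes "smooth_form (unit_bundle U G) 1 \<mu>"
  shows "\<mu> \<in> class_mod_ideal U G H \<Psi>\<^sub>0 \<mu>"
proof -
  have z: "smooth_form (unit_bundle U G) k (\<lambda>p vs. 0)" for k
    unfolding smooth_form_def smooth_form_on_def alternating_form_def
    by (auto intro!: exI[of _ UNIV] exI[of _ "\<lambda>p vs. 0"] smooth_on_const linear_zero)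
  have "has_ext_deriv (unit_bundle U G) 0 (\<lambda>p vs. 0) (\<lambda>p vs. 0)"
    unfolding has_ext_deriv_def
  proof (intro ballI exI[of _ UNIV] exI[of _ "\<lambda>p vs. 0"] conjI)
    show "smooth_form_on UNIV 0 (\<lambda>(p::contact_pt) vs. 0)"
      by (simp add: smooth_form_on_0_iff smooth_on_const)
  qed (auto simp: ext_deriv_def)
  moreover have "cmc_ideal U G H \<Psi>\<^sub>0 1 (\<lambda>p vs. 0)" unfolding cmc_ideal_def by (rule diff_ideal.zero)
  moreover have "form_eq (unit_bundle U G) 1 \<mu> (\<lambda>p vs. \<mu> p vs + 0 + 0)" by (simp add: form_eq_def)
  ultimately show ?thesis unfolding class_mod_ideal_def using assms z[of 0] z[of 1] by blast
qed

section \<open>The pullback of the Noether form\<close>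

theorem proposition2p8:
  fixes U :: "(real^3) set" and G :: "real^3 \<Rightarrow> real^3^3"
    and H :: real
    and \<Psi>\<^sub>0 :: "contact_pt form"
    and \<Sigma> :: "'s topology" and A :: "'s chart set"
    and f :: "'s \<Rightarrow> real^3" and N :: "'s \<Rightarrow> contact_pt"
    and S F :: "real^3 \<Rightarrow> real^3" and \<phi> :: "real \<Rightarrow> real^3 \<Rightarrow> real^3"
  assumes "open U" and "contractible U"
    and "riemannian_metric U G"
    and "is_Psi0 U G \<Psi>\<^sub>0"
    and "oriented_surface \<Sigma> A"
    and "immersion_into \<Sigma> A U f"
    and "legendrian_lift U G \<Sigma> A f N"
    and "oriented_by_normal G A f N"
    and "cmc_lift G H \<Psi>\<^sub>0 A N"
    and "killing_field U G S"
    and "local_flow U S \<phi>"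
    and "potential_vector U G S F"
  shows "(\<forall>\<eta>\<in>noether_form U G H \<Psi>\<^sub>0 \<phi> F. surface_pullback N \<eta> \<in> closed_1forms A)
    \<and> (\<lambda>\<eta>. H1_class A (surface_pullback N \<eta>)) ` noether_form U G H \<Psi>\<^sub>0 \<phi> F
        = {H1_class A (\<lambda>c u ws. inner_star_df G S f c u ws - 2 * H * inner_df G F f c u ws)}
    \<and> H1_class A (\<lambda>c u ws. inner_star_df G S f c u ws - 2 * H * inner_df G F f c u ws) \<in> H1 A
    \<and> surface_form_eq A 1 (surface_pullback N (noether_minimal G \<phi>)) (inner_star_df G S f)
    \<and> surface_form_eq A 1 (surface_pullback N (noether_cmc G F)) (inner_df G F f)"
proof -
  note U = assms(1) and G = assms(3) and \<Sigma> = assms(5) and N = assms(7) and S = assms(10) and \<phi> = assms(11)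
  let ?\<mu> = "\<lambda>p vs. noether_minimal G \<phi> p vs - 2 * H * noether_cmc G F p vs"
  let ?\<alpha> = "surface_pullback N ?\<mu>"
  let ?\<beta> = "\<lambda>c u ws. inner_star_df G S f c u ws - 2 * H * inner_df G F f c u ws"
  have closed: "?\<alpha> \<in> closed_1forms A"
    by (rule pullback_noether_closed[OF U G assms(4) \<Sigma> assms(6) N assms(8,9) S \<phi> assms(12)])
  have minimal: "surface_form_eq A 1 (surface_pullback N (noether_minimal G \<phi>)) (inner_star_df G S f)"
    by (rule pullback_noether_minimal[OF G \<Sigma> assms(6) N assms(8) \<phi>])
  have cmc: "surface_form_eq A 1 (surface_pullback N (noether_cmc G F)) (inner_df G F f)"
    by (rule pullback_noether_cmc[OF \<Sigma> N])
  have "surface_form_eq A 1 ?\<alpha> ?\<beta>"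
    using minimal cmc by (simp add: surface_form_eq_def surface_pullback_def pullback_def)
  then have \<alpha>\<beta>: "(?\<alpha>, ?\<beta>) \<in> cohomologous A" by (rule cohomologous_if_eq[OF \<Sigma> closed])
  note equiv = equiv_cohomologous[OF \<Sigma>]
  have cls: "H1_class A ?\<alpha> = H1_class A ?\<beta>"
    unfolding H1_class_def by (rule equiv_class_eq[OF equiv \<alpha>\<beta>])
  have coh: "(?\<alpha>, surface_pullback N \<eta>) \<in> cohomologous A" if "\<eta> \<in> noether_form U G H \<Psi>\<^sub>0 \<phi> F" for \<eta>
    using pullback_noether_class[OF \<Sigma> N closed] that unfolding noether_form_def by blast
  then have cl: "surface_pullback N \<eta> \<in> closed_1forms A"
    and eq: "H1_class A (surface_pullback N \<eta>) = H1_class A ?\<beta>" if "\<eta> \<in> noether_form U G H \<Psi>\<^sub>0 \<phi> F" for \<eta>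
    using that equiv_class_eq[OF equiv, of ?\<alpha> "surface_pullback N \<eta>"] cls
    by (auto simp: H1_class_def cohomologous_def)
  have "?\<mu> \<in> noether_form U G H \<Psi>\<^sub>0 \<phi> F"
    unfolding noether_form_def using S assms(12)
    by (intro mem_class_mod_ideal smooth_noether_representative[OF U G \<phi>])
       (auto simp: killing_field_def potential_vector_def)
  then have "(\<lambda>\<eta>. H1_class A (surface_pullback N \<eta>)) ` noether_form U G H \<Psi>\<^sub>0 \<phi> F = {H1_class A ?\<beta>}"
    using eq by (intro equalityI subsetI) (auto intro: image_eqI[where x = ?\<mu>])
  moreover have "H1_class A ?\<alpha> \<in> H1 A"
    unfolding H1_def H1_class_def by (rule quotientI[OF closed])
  then have "H1_class A ?\<beta> \<in> H1 A" by (simp only: cls)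
  ultimately show ?thesis using cl minimal cmc by blast
qed

end
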